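(* Let $R$ be a one-dimensional noetherian domain such that its integral closure $\overline{R}$ is a finitely generated $R$-module, and let $\mathfrak{f} = (R:\overline{R})$ and $\mathcal{P}^* = \{\mathfrak{p}\in\mathfrak{X}(R) : \mathfrak{p}\supseteq\mathfrak{f}\}$. Consider the condition (C) For every $\mathfrak{p}\in\mathcal{P}^*$, there are only finitely many irreducible primary ideals $\mathfrak{q}$ with $\sqrt{\mathfrak{q}}=\mathfrak{p}$. If (C) holds, then $\mathcal{L}(\mathcal{I}(R))$ satisfies the Structure Theorem for Unions. In particular: (1) If $R$ is a Cohen–Kaplansky domain, then Condition (C) holds. (2) If $R$ is an order in a quadratic number field $K$ with discriminant $d_K$ and conductor $\mathfrak{f} = f\,\overline{R}$ with $f\in\mathbb{N}$, then Condition (C) is equivalent to each of the following: (C1) For every $\mathfrak{p}\in\mathcal{P}^*$, there are only finitely many invertible irreducible primary ideals $\mathfrak{q}$ with $\sqrt{\mathfrak{q}}=\mathfrak{p}$. (C2) For every $\mathfrak{p}\in\mathcal{P}^*$, there is precisely one prime ideal of $\overline{R}$ lying above $\mathfrak{p}$. (C3) For every prime divisor $p$ of $f$, $\left(\frac{d_K}{p}\right)\neq 1$.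
   Context: $\mathfrak{X}(R)$ is the set of height-one prime ideals of $R$ (here: the non-zero primes), and $(R:\overline{R})=\{x\in R: x\overline{R}\subseteq R\}$. $\mathcal{I}(R)$ is the semigroup of non-zero ideals of $R$ under ideal multiplication, a reduced commutative semigroup with identity $R$ (under the present hypotheses it is unit-cancellative, i.e. $IJ=I$ implies $J=R$, and every element other than $R$ is a finite product of irreducible elements). "Irreducible ideal" means an ideal which is an irreducible element (atom) of the semigroup $\mathcal{I}(R)$: $\mathfrak{q}\neq R$, and $\mathfrak{q}=IJ$ implies $I=R$ or $J=R$. A Cohen–Kaplansky domain is an atomic domain (every non-zero non-unit is a finite product of irreducible elements) with only finitely many pairwise non-associated irreducible elements. $\left(\frac{d_K}{p}\right)$ is the Legendre symbol, understood as the Kronecker symbol when $p=2$. For $I\in\mathcal{I}(R)$, $I\neq R$, $\mathsf{L}(I)\subseteq\mathbb{N}$ is the set of all $k$ such that $I$ is a product of $k$ irreducible ideals; $\mathsf{L}(R)=\{0\}$. $\mathcal{L}(\mathcal{I}(R))=\{\mathsf{L}(I): I\in\mathcal{I}(R)\}$, and $\mathcal{U}_k$ is the union of all $L\in\mathcal{L}(\mathcal{I}(R))$ with $k\in L$. For $L\subseteq\mathbb{N}_0$, $\Delta(L)$ is the set of all $d\in\mathbb{N}$ such that there are $k,\ell\in L$ with $\ell-k=d$ and no element of $L$ strictly between $k$ and $\ell$. $L$ is an AP with difference $d\in\mathbb{N}$ if $L\ne\emptyset$ and $\Delta(L)\subseteq\{d\}$. $L$ is an AAP with difference $d$ and bound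 $M\in\mathbb{N}_0$ if $L\subseteq y+d\mathbb{Z}$ for some $y\in\mathbb{Z}$ and $\{x\in L:\inf L+M\le x\le\sup L-M\}$ is an AP with difference $d$. $\mathcal{L}(\mathcal{I}(R))$ satisfies the Structure Theorem for Unions if there are $d\in\mathbb{N}$, $M\in\mathbb{N}_0$ such that $\mathcal{U}_k$ is an AAP with difference $d$ and bound $M$ for all sufficiently large $k\in\mathbb{N}$. *)

theory Defs
  imports
    "HOL-Algebra.Algebra"
    "HOL-Number_Theory.Number_Theory"
    "HOL-Computational_Algebra.Squarefree"
    "HOL-Library.Extended_Nat"
begin

section \<open>Commutative algebra\<close>

definition prime_height :: "('a, 'b) ring_scheme \<Rightarrow> 'a set \<Rightarrow> enat"
  where "prime_height A P =
    Sup {enat n |n. \<exists>C. (\<forall>i\<le>n. primeideal (C i) A) \<and> (\<forall>i<n. C i \<subset> C (Suc i)) \<and> C n = P}"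

definition krull_dim :: "('a, 'b) ring_scheme \<Rightarrow> enat"
  where "krull_dim A = Sup (prime_height A ` {P. primeideal P A})"

definition height_one_primes :: "('a, 'b) ring_scheme \<Rightarrow> 'a set set"
  where "height_one_primes A = {P. primeideal P A \<and> prime_height A P = 1}"

definition ideal_radical :: "('a, 'b) ring_scheme \<Rightarrow> 'a set \<Rightarrow> 'a set"
  where "ideal_radical A I = {x \<in> carrier A. \<exists>n::nat. x [^]\<^bsub>A\<^esub> n \<in> I}"

definition primary_ideal :: "'a set \<Rightarrow> ('a, 'b) ring_scheme \<Rightarrow> bool"
  where "primary_ideal Q A \<longleftrightarrow> ideal Q A \<and> Q \<noteq> carrier A \<and>
    (\<forall>a\<in>carrier A. \<forall>b\<in>carrier A. a \<otimes>\<^bsub>A\<^esub> b \<in> Q \<longrightarrow> a \<in> Q \<or> b \<in> ideal_radical A Q)"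

definition cohen_kaplansky_domain :: "('a, 'b) ring_scheme \<Rightarrow> bool"
  where "cohen_kaplansky_domain A \<longleftrightarrow> domain A \<and>
    (let irr = {a \<in> carrier A. ring_irreducible\<^bsub>A\<^esub> a} in
      (\<forall>a \<in> carrier A - {\<zero>\<^bsub>A\<^esub>} - Units A. \<exists>as. set as \<subseteq> irr \<and> foldr (\<otimes>\<^bsub>A\<^esub>) as \<one>\<^bsub>A\<^esub> = a) \<and>
      finite (irr // {(a, b). a \<in> irr \<and> b \<in> irr \<and> a \<sim>\<^bsub>A\<^esub> b}))"

text \<open>
  A domain is represented as a subring \<open>R\<close> of its quotient field \<open>K\<close>; as a ring in its own right
  it is \<open>K\<lparr>carrier := R\<rparr>\<close>.
\<close>

definition is_quotient_field :: "('a, 'b) ring_scheme \<Rightarrow> 'a set \<Rightarrow> bool"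
  where "is_quotient_field K R \<longleftrightarrow> field K \<and> subring R K \<and>
    (\<forall>x\<in>carrier K. \<exists>a\<in>R. \<exists>b\<in>R - {\<zero>\<^bsub>K\<^esub>}. x = a \<otimes>\<^bsub>K\<^esub> inv\<^bsub>K\<^esub> b)"

text \<open>Polynomials of \<^theory>\<open>HOL-Algebra.Polynomials\<close> are coefficient lists, leading coefficient first.\<close>

definition integral_closure :: "('a, 'b) ring_scheme \<Rightarrow> 'a set \<Rightarrow> 'a set"
  where "integral_closure K R =
    {x \<in> carrier K. \<exists>p \<in> carrier (univ_poly K R). p \<noteq> [] \<and> lead_coeff p = \<one>\<^bsub>K\<^esub> \<and>
       ring.eval K p x = \<zero>\<^bsub>K\<^esub>}"

definition fin_gen_submodule :: "('a, 'b) ring_scheme \<Rightarrow> 'a set \<Rightarrow> 'a set \<Rightarrow> bool"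
  where "fin_gen_submodule K R N \<longleftrightarrow> (\<exists>us. set us \<subseteq> carrier K \<and> N = ring.Span K R us)"

definition conductor :: "('a, 'b) ring_scheme \<Rightarrow> 'a set \<Rightarrow> 'a set"
  where "conductor K R = {x \<in> R. \<forall>y\<in>integral_closure K R. x \<otimes>\<^bsub>K\<^esub> y \<in> R}"

definition conductor_primes :: "('a, 'b) ring_scheme \<Rightarrow> 'a set \<Rightarrow> 'a set set"
  where "conductor_primes K R =
    {P \<in> height_one_primes (K\<lparr>carrier := R\<rparr>). conductor K R \<subseteq> P}"

text \<open>
  The library's \<^const>\<open>ideal_prod\<close> taken in \<open>K\<close> is the set of finite sums of products, which
  is what is needed for the product of fractional ideals.
\<close>

definition invertible_ideal :: "('a, 'b) ring_scheme \<Rightarrow> 'a set \<Rightarrow> 'a set \<Rightarrow> bool"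
  where "invertible_ideal K R I \<longleftrightarrow> ideal I (K\<lparr>carrier := R\<rparr>) \<and>
    ideal_prod K I {x \<in> carrier K. \<forall>y\<in>I. x \<otimes>\<^bsub>K\<^esub> y \<in> R} = R"


section \<open>Ideal semigroup and sets of lengths\<close>

definition ideal_monoid :: "('a, 'b) ring_scheme \<Rightarrow> 'a set monoid"
  where "ideal_monoid A =
    \<lparr>carrier = {I. ideal I A \<and> I \<noteq> {\<zero>\<^bsub>A\<^esub>}}, monoid.mult = ideal_prod A, one = carrier A\<rparr>"

text \<open>The following notions are meant for reduced commutative monoids, where the only unit is \<open>\<one>\<close>.\<close>

definition atoms :: "('a, 'b) monoid_scheme \<Rightarrow> 'a set"
  where "atoms H = {a \<in> carrier H. a \<noteq> \<one>\<^bsub>H\<^esub> \<and>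
    (\<forall>b\<in>carrier H. \<forall>c\<in>carrier H. a = b \<otimes>\<^bsub>H\<^esub> c \<longrightarrow> b = \<one>\<^bsub>H\<^esub> \<or> c = \<one>\<^bsub>H\<^esub>)}"

definition lengths_of :: "('a, 'b) monoid_scheme \<Rightarrow> 'a \<Rightarrow> nat set"
  where "lengths_of H a = (if a = \<one>\<^bsub>H\<^esub> then {0}
    else {length as |as. set as \<subseteq> atoms H \<and> foldr (\<otimes>\<^bsub>H\<^esub>) as \<one>\<^bsub>H\<^esub> = a})"

definition system_of_lengths :: "('a, 'b) monoid_scheme \<Rightarrow> nat set set"
  where "system_of_lengths H = lengths_of H ` carrier H"

definition union_of_lengths :: "nat set set \<Rightarrow> nat \<Rightarrow> nat set"
  where "union_of_lengths \<L> k = \<Union>{L \<in> \<L>. k \<in> L}"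

definition distances :: "nat set \<Rightarrow> nat set"
  where "distances L = {d. d > 0 \<and> (\<exists>k\<in>L. k + d \<in> L \<and> (\<forall>m\<in>L. \<not> (k < m \<and> m < k + d)))}"

definition is_AP :: "nat \<Rightarrow> nat set \<Rightarrow> bool"
  where "is_AP d L \<longleftrightarrow> L \<noteq> {} \<and> distances L \<subseteq> {d}"

text \<open>
  The supremum is taken in \<^typ>\<open>enat\<close> because \<open>L\<close> may be unbounded, in which case the upper
  bound on \<open>x\<close> is vacuous; \<open>M\<close> is moved to the left to avoid truncated subtraction.
\<close>

definition is_AAP :: "nat \<Rightarrow> nat \<Rightarrow> nat set \<Rightarrow> bool"
  where "is_AAP d M L \<longleftrightarrow>
    (\<exists>y::int. int ` L \<subseteq> {y + int d * z |z. True}) \<and>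
    is_AP d {x \<in> L. Inf L + M \<le> x \<and> enat (x + M) \<le> Sup (enat ` L)}"

definition structure_theorem_for_unions :: "nat set set \<Rightarrow> bool"
  where "structure_theorem_for_unions \<L> \<longleftrightarrow>
    (\<exists>d>0. \<exists>M. \<exists>k\<^sub>0. \<forall>k\<ge>k\<^sub>0. is_AAP d M (union_of_lengths \<L> k))"


section \<open>Orders in quadratic number fields\<close>

definition prime_subfield :: "('a, 'b) ring_scheme \<Rightarrow> 'a set"
  where "prime_subfield K = generate_field K {}"

definition integers_in :: "('a, 'b) ring_scheme \<Rightarrow> 'a set"
  where "integers_in K = range (\<lambda>n::int. add_pow K n \<one>\<^bsub>K\<^esub>)"

definition quadratic_number_field :: "('a, 'b) ring_scheme \<Rightarrow> bool"
  where "quadratic_number_field K \<longleftrightarrow> field K \<and>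
    (\<forall>n::nat. n > 0 \<longrightarrow> add_pow K n \<one>\<^bsub>K\<^esub> \<noteq> \<zero>\<^bsub>K\<^esub>) \<and>
    ring.dimension K 2 (prime_subfield K) (carrier K)"

text \<open>
  A quadratic number field is \<open>\<rat>(\<surd>d)\<close> for exactly one squarefree \<open>d \<noteq> 1\<close>, namely the only
  squarefree integer other than \<open>1\<close> that is a square in \<open>K\<close>; its discriminant is \<open>d\<close> or \<open>4 * d\<close>.
\<close>

definition quadratic_radicand :: "('a, 'b) ring_scheme \<Rightarrow> int"
  where "quadratic_radicand K =
    (THE d. squarefree d \<and> d \<noteq> 1 \<and> (\<exists>w\<in>carrier K. w \<otimes>\<^bsub>K\<^esub> w = add_pow K d \<one>\<^bsub>K\<^esub>))"

definition quadratic_discriminant :: "('a, 'b) ring_scheme \<Rightarrow> int"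
  where "quadratic_discriminant K =
    (let d = quadratic_radicand K in if d mod 4 = 1 then d else 4 * d)"

text \<open>
  An order is a subring that is finitely generated as an abelian group and contains a generating
  set of \<open>K\<close> over \<open>\<rat>\<close>.
\<close>

definition order_in :: "('a, 'b) ring_scheme \<Rightarrow> 'a set \<Rightarrow> bool"
  where "order_in K R \<longleftrightarrow> subring R K \<and> fin_gen_submodule K (integers_in K) R \<and>
    (\<exists>us. set us \<subseteq> R \<and> ring.Span K (prime_subfield K) us = carrier K)"

text \<open>Kronecker symbol with a prime lower entry.\<close>

definition kronecker_prime :: "int \<Rightarrow> nat \<Rightarrow> int"
  where "kronecker_prime a p =
    (if p = 2 then (if even a then 0 else if a mod 8 = 1 \<or> a mod 8 = 7 then 1 else -1)
     else Legendre a (int p))"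


section \<open>The conditions\<close>

definition cond_C :: "('a, 'b) ring_scheme \<Rightarrow> 'a set \<Rightarrow> bool"
  where "cond_C K R \<longleftrightarrow> (\<forall>P \<in> conductor_primes K R.
    finite {Q \<in> atoms (ideal_monoid (K\<lparr>carrier := R\<rparr>)).
      primary_ideal Q (K\<lparr>carrier := R\<rparr>) \<and> ideal_radical (K\<lparr>carrier := R\<rparr>) Q = P})"

definition cond_C1 :: "('a, 'b) ring_scheme \<Rightarrow> 'a set \<Rightarrow> bool"
  where "cond_C1 K R \<longleftrightarrow> (\<forall>P \<in> conductor_primes K R.
    finite {Q \<in> atoms (ideal_monoid (K\<lparr>carrier := R\<rparr>)). invertible_ideal K R Q \<and>
      primary_ideal Q (K\<lparr>carrier := R\<rparr>) \<and> ideal_radical (K\<lparr>carrier := R\<rparr>) Q = P})"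

definition cond_C2 :: "('a, 'b) ring_scheme \<Rightarrow> 'a set \<Rightarrow> bool"
  where "cond_C2 K R \<longleftrightarrow> (\<forall>P \<in> conductor_primes K R.
    \<exists>!P'. primeideal P' (K\<lparr>carrier := integral_closure K R\<rparr>) \<and> P' \<inter> R = P)"

definition cond_C3 :: "('a, 'b) ring_scheme \<Rightarrow> nat \<Rightarrow> bool"
  where "cond_C3 K f \<longleftrightarrow> (\<forall>p::nat. Factorial_Ring.prime p \<and> p dvd f \<longrightarrow>
    kronecker_prime (quadratic_discriminant K) p \<noteq> 1)"

end

(*
  Every non-zero ideal is a product of atoms of I(R), and each atom is primary. A prime not
  containing the conductor is invertible and is the only atom belonging to it; by (C) all but
  finitely many atoms are of this kind. Call two products u, v of the remaining atoms stably equal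
  if J u = J v for some J. This is a cancellative congruence, so by Dickson's lemma its pairs form
  a finitely generated monoid, and one J, a product of t atoms, serves for all of them. Hence the
  set T of pairs of lengths of a common ideal satisfies S + (t, t) <= T <= S for a finitely
  generated submonoid S of N x N, and S contains all points of its group that lie deep inside its
  cone. This is the Structure Theorem for Unions, with no need for the integral closure to be
  local at P.

  In a Cohen-Kaplansky domain a P-primary atom of I(R) that is locally divisible by an irreducible
  a in P contains a, and long products of irreducibles in P are locally divisible by a. So the atom
  contains a short product of irreducibles, and only finitely many P-primary ideals contain a given
  non-zero element.

  In an order Z + f O_K the primes over the conductor are P = p Z + f O_K with p dividing f. If p
  does not split, the norm bounds the power of p contained in a P-primary atom. If p splits, the
  two homomorphisms from O_K to Z/p^L given by the two roots of the minimal polynomial of omega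
  distinguish two primes over P and produce infinitely many invertible P-primary atoms.
*)

theory Submission
  imports Defs
begin

section \<open>Submonoids of \<open>\<nat> \<times> \<nat>\<close> and almost arithmetical progressions\<close>

text \<open>The ideal monoid need not be cancellative, so pairs of factorizations of a common ideal
  cannot be subtracted from one another, and Dickson's lemma does not apply to them directly. Stable
  equality repairs this at the price of the factor J; the price is uniform because a J that serves
  for finitely many generators serves for their sums, and it reappears in the bound M. The weak
  cancellation that does hold, I J = I only for J = R, comes from Nakayama's lemma. It keeps both
  components of a non-trivial generator non-empty, so the ratios l / k in S are bounded and the cone
  of S has a steepest ray.

  No localization is formed. The contraction of the extension of I to the local ring at P is
  described by multipliers outside P, and in dimension one an ideal containing a power of every
  element of P is already local at P, so that local statements can be checked in R.

  In the quadratic case the basis 1, omega = (D + sqrt D)/2 treats all residues of d modulo 4 alike.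
  Statements about ideals become congruences between integer coordinates, because R consists of the
  a + b omega with f dividing b.\<close>

lemma pair_multiple_closed:
  fixes S :: "(nat \<times> nat) set"
  assumes add: "\<And>k l k' l'. (k, l) \<in> S \<Longrightarrow> (k', l') \<in> S \<Longrightarrow> (k + k', l + l') \<in> S"
    and zero: "(0, 0) \<in> S" and mem: "(k, l) \<in> S"
  shows "(n * k, n * l) \<in> S"
  by (induction n) (use zero add[OF mem] in auto)

text \<open>With j = q s + r and r < q, the pair is the sum of s copies of (a, a + d q), r copies of
  (m, m + d) and a multiple of (1, 1). Fewer than q copies of (m, m + d) occur, so the constant d
  q^2 m pays for them wherever (m, m + d) lies in the cone; the hypothesis \<open>deep\<close> makes
  the remaining multiple of (1, 1) non-negative.\<close>

lemma deep_pairs_in_monoid: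
  fixes S :: "(nat \<times> nat) set"
  assumes add: "\<And>k l k' l'. (k, l) \<in> S \<Longrightarrow> (k', l') \<in> S \<Longrightarrow> (k + k', l + l') \<in> S"
    and zero: "(0, 0) \<in> S" and one: "(1, 1) \<in> S"
    and ab: "(a, a + d * q) \<in> S" and q: "q > 0"
    and md: "(m, m + d) \<in> S" and d: "d > 0"
    and deep: "a * (k + d * j) + d * q * q * m \<le> (a + d * q) * k"
  shows "(k, k + d * j) \<in> S"
proof -
  define s r where "s = j div q" and "r = j mod q"
  have j: "j = q * s + r" and r: "r < q" using q by (auto simp: s_def r_def)
  have "d * q * (s * a + r * m) \<le> d * q * k"
  proof -
    have "r * m \<le> q * m" using r by simp
    then have "d * q * (s * a + r * m) \<le> a * (d * (q * s)) + d * q * (q * m)"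
      by (simp add: algebra_simps)
    also have "\<dots> \<le> a * (d * j) + d * q * q * m"
      unfolding j by (simp add: algebra_simps)
    also have "\<dots> \<le> d * q * k" using deep by (simp add: algebra_simps)
    finally show ?thesis .
  qed
  then have le: "s * a + r * m \<le> k" using d q by simp
  define w where "w = k - (s * a + r * m)"
  have k: "k = s * a + r * m + w * 1" using le by (simp add: w_def)
  have l: "k + d * j = s * (a + d * q) + r * (m + d) + w * 1"
    unfolding k j by (simp add: algebra_simps)
  show ?thesis
    unfolding l by (subst k, intro add pair_multiple_closed[OF add zero] ab md one)
qed

text \<open>\<open>U\<close> is a column of a symmetric cone: \<open>slope\<close> confines it, and
  \<open>deep\<close> fills it, in the right residue class, up to depth C below the two boundary
  lines. Trimming C at each end suffices because a and b are at least 1, so that moving l by C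
  changes a l and b l by at least C.\<close>

lemma is_AAP_deep_column:
  fixes U :: "nat set" and d a b C k M :: nat
  assumes d: "d > 0" and a: "a > 0" and ab: "a < b"
    and mod: "\<And>l. l \<in> U \<Longrightarrow> int d dvd int l - int k"
    and slope: "\<And>l. l \<in> U \<Longrightarrow> a * l \<le> b * k \<and> a * k \<le> b * l"
    and deep: "\<And>l. int d dvd int l - int k \<Longrightarrow> a * l + C \<le> b * k \<Longrightarrow> a * k + C \<le> b * l \<Longrightarrow> l \<in> U"
    and large: "k \<ge> C + d * b * C"
  shows "is_AAP d C U"
proof -
  have fin: "finite U"
  proof (rule finite_subset)
    show "U \<subseteq> {..b * k}"
    proof
      fix l assume "l \<in> U"
      then have "a * l \<le> b * k" using slope by blast
      moreover have "l \<le> a * l" using a by (cases a) simp_all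
      ultimately have "l \<le> b * k" by (rule order_trans[rotated])
      then show "l \<in> {..b * k}" by simp
    qed
  qed simp
  have gap: "a * k + k \<le> b * k"
    using mult_le_mono1[of "a + 1" b k] ab by simp
  have dbC: "d * (b * C) \<le> k" and dC: "d * C \<le> k"
  proof -
    show "d * (b * C) \<le> k" using large by (simp add: mult.assoc)
    moreover have "d * C \<le> d * (b * C)" using ab by simp
    ultimately show "d * C \<le> k" by linarith
  qed
  \<comment> \<open>The elements k + d C and k - d C lie at least C away from k, one on either side,
    which keeps k itself in the trimmed column. The bound \<open>large\<close> is chosen for
    them.\<close>
  have up: "k + d * C \<in> U"
  proof (rule deep)
    have "a * (d * C) \<le> d * b * C" using ab by (simp add: algebra_simps)
    then show "a * (k + d * C) + C \<le> b * k" using large gap unfolding distrib_left by linarith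
    show "a * k + C \<le> b * (k + d * C)" using large gap by (simp add: distrib_left)
  qed simp
  have down: "k - d * C \<in> U"
  proof (rule deep)
    have e: "int (k - d * C) = int k - int d * int C" using dC by simp
    show "int d dvd int (k - d * C) - int k" unfolding e by simp
    have "a * (k - d * C) \<le> a * k" by simp
    then show "a * (k - d * C) + C \<le> b * k" using large gap by linarith
    have "b * (k - d * C) = b * k - b * (d * C)" by (simp add: diff_mult_distrib2)
    moreover have "b * (d * C) = d * b * C" by simp
    ultimately show "a * k + C \<le> b * (k - d * C)" using large gap by linarith
  qed
  have k: "k \<in> U"
    by (rule deep) (use large gap in auto)
  have InfU: "Inf U \<in> U" using k Inf_nat_def1 by blast
  have Inf_le: "Inf U \<le> x" if "x \<in> U" for x using that by (simp add: cInf_lower)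
  have ne: "enat ` U \<noteq> {}" "finite (enat ` U)" using k fin by auto
  have Sup_eq: "Sup (enat ` U) = enat (Max U)"
  proof -
    have "Sup (enat ` U) = Max (enat ` U)" using ne by (simp add: Max_Sup)
    also have "\<dots> = enat (Max U)"
      using k fin by (intro mono_Max_commute[symmetric]) (auto simp: mono_def)
    finally show ?thesis .
  qed
  have MaxU: "Max U \<in> U" using k fin by (intro Max_in) auto
  have Max_ge: "x \<le> Max U" if "x \<in> U" for x using that fin by simp
  define V where "V = {x \<in> U. Inf U + C \<le> x \<and> enat (x + C) \<le> Sup (enat ` U)}"
  have V: "x \<in> V \<longleftrightarrow> x \<in> U \<and> Inf U + C \<le> x \<and> x + C \<le> Max U" for x
    by (simp add: V_def Sup_eq)
  have C_le: "C \<le> d * C" using d by simp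
  have "k \<in> V"
    unfolding V using k Inf_le[OF down] Max_ge[OF up] dC C_le by linarith
  moreover have "distances V \<subseteq> {d}"
  proof
    fix e assume "e \<in> distances V"
    then obtain x where e: "e > 0" and x: "x \<in> V" and xe: "x + e \<in> V"
      and between: "\<And>m. m \<in> V \<Longrightarrow> \<not> (x < m \<and> m < x + e)"
      by (auto simp: distances_def)
    have dx: "int d dvd int x - int k" and dxe: "int d dvd int (x + e) - int k"
      using x xe mod unfolding V by blast+
    have "int d dvd int e" using dvd_diff[OF dxe dx] by simp
    then have de: "d \<le> e" using e by (auto intro: dvd_imp_le)
    have "\<not> d < e"
    proof
      assume lt: "d < e"
      have low: "Inf U + C \<le> x + d" and high: "x + d + C \<le> Max U"
        using x xe lt by (auto simp: V)
      have "x + d \<in> U"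
      proof (rule deep)
        show "int d dvd int (x + d) - int k"
          using dvd_add[OF dx dvd_refl] by (simp add: algebra_simps)
        have "a * (x + d) + a * C \<le> a * Max U"
          using high by (metis mult_le_mono2 distrib_left)
        moreover have "C \<le> a * C" using a by simp
        ultimately show "a * (x + d) + C \<le> b * k" using slope[OF MaxU] by linarith
        have "b * Inf U + b * C \<le> b * (x + d)"
          using low by (metis mult_le_mono2 distrib_left)
        moreover have "C \<le> b * C" using ab by simp
        ultimately show "a * k + C \<le> b * (x + d)" using slope[OF InfU] by linarith
      qed
      then have "x + d \<in> V" using low high by (simp add: V)
      then show False using between[of "x + d"] lt d by simp
    qed
    then show "e \<in> {d}" using de by simp
  qed
  moreover have "int ` U \<subseteq> {int k + int d * z |z. True}"
  proof
    fix y assume "y \<in> int ` U"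
    then obtain l where l: "y = int l" "l \<in> U" by blast
    then obtain z where "int l - int k = int d * z" using mod by (meson dvdE)
    then show "y \<in> {int k + int d * z |z. True}" using l by (auto intro: exI[of _ z])
  qed
  ultimately show ?thesis unfolding is_AAP_def is_AP_def V_def by blast
qed

lemma int_subgroup_generator:
  fixes D :: "int set"
  assumes add: "\<And>x y. x \<in> D \<Longrightarrow> y \<in> D \<Longrightarrow> x + y \<in> D"
    and neg: "\<And>x. x \<in> D \<Longrightarrow> - x \<in> D"
    and x: "x \<in> D" "x \<noteq> 0"
  obtains d :: nat where "d > 0" "int d \<in> D" "\<And>y. y \<in> D \<Longrightarrow> int d dvd y"
proof -
  define d where "d = (LEAST n::nat. n > 0 \<and> int n \<in> D)"
  have "\<exists>n::nat. n > 0 \<and> int n \<in> D"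
    using x neg[OF x(1)] by (cases "x > 0") (auto intro!: exI[of _ "nat \<bar>x\<bar>"])
  then have d: "d > 0 \<and> int d \<in> D" unfolding d_def by (rule LeastI_ex)
  have least: "\<not> (n > 0 \<and> int n \<in> D)" if "n < d" for n
    using that not_less_Least unfolding d_def by blast
  have mult: "int n * int d \<in> D" if "n > 0" for n :: nat
    using that
  proof (induction n)
    case (Suc n)
    then show ?case using d add[of "int n * int d" "int d"]
      by (cases "n = 0") (auto simp: algebra_simps)
  qed simp
  have zero: "0 \<in> D" using add[OF x(1) neg[OF x(1)]] by simp
  have mult': "z * int d \<in> D" for z :: int
    using mult[of "nat \<bar>z\<bar>"] neg[OF mult[of "nat \<bar>z\<bar>"]] zero
    by (cases "z = 0"; cases "z > 0") auto
  have "int d dvd y" if y: "y \<in> D" for y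
  proof -
    have "y mod int d = y + (- (y div int d)) * int d" by (simp add: minus_div_mult_eq_mod[symmetric])
    then have "y mod int d \<in> D" using add[OF y mult'] by metis
    then have "int (nat (y mod int d)) \<in> D" using d by simp
    moreover have "nat (y mod int d) < d" using d by (simp add: nat_less_iff)
    ultimately have "y mod int d = 0" using least d by (smt (verit) int_nat_eq of_nat_0_less_iff pos_mod_sign)
    then show ?thesis by auto
  qed
  then show thesis using that d by blast
qed

text \<open>(a, b) spans the steepest ray of S and by symmetry (b, a) the flattest. Every point deep
  inside the cone whose difference is a multiple of d lies in S, and passing from S to T only costs
  some more depth.\<close>

lemma eventually_AAP_if_cofinal_in_fg_monoid:
  fixes S T :: "(nat \<times> nat) set"
  assumes add: "\<And>k l k' l'. (k, l) \<in> S \<Longrightarrow> (k', l') \<in> S \<Longrightarrow> (k + k', l + l') \<in> S"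
    and sym: "\<And>k l. (k, l) \<in> S \<Longrightarrow> (l, k) \<in> S"
    and zero: "(0, 0) \<in> S" and one: "(1, 1) \<in> S"
    and ab: "(a, b) \<in> S" "a > 0" "\<And>k l. (k, l) \<in> S \<Longrightarrow> a * l \<le> b * k"
    and TS: "T \<subseteq> S" and ST: "\<And>k l. (k, l) \<in> S \<Longrightarrow> (t + k, t + l) \<in> T"
  shows "\<exists>d>0. \<exists>M. \<exists>k\<^sub>0. \<forall>k\<ge>k\<^sub>0. is_AAP d M {l. (k, l) \<in> T}"
proof (cases "\<forall>(k, l) \<in> S. k = l")
  case True
  \<comment> \<open>If S is diagonal, the columns of T from t on are singletons; the difference 1 is
    then a default.\<close>
  have "is_AAP 1 0 {l. (k, l) \<in> T}" if "k \<ge> t" for k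
  proof -
    have "((k - t) * 1, (k - t) * 1) \<in> S" by (rule pair_multiple_closed[OF add zero one])
    then have "(k, k) \<in> T" using ST[of "k - t" "k - t"] that by simp
    then have "{l. (k, l) \<in> T} = {k}" using True TS by auto
    moreover have "is_AAP 1 0 {k}"
    proof -
      have "int ` {k} \<subseteq> {int k + int 1 * z |z. True}" by (auto intro: exI[of _ 0])
      moreover have "is_AP 1 {x \<in> {k}. Inf {k} + 0 \<le> x \<and> enat (x + 0) \<le> Sup (enat ` {k})}"
        by (auto simp: is_AP_def distances_def cInf_singleton)
      ultimately show ?thesis unfolding is_AAP_def by blast
    qed
    ultimately show ?thesis by simp
  qed
  then show ?thesis by (intro exI[of _ 1] exI[of _ 0] exI[of _ t] conjI) auto
next
  case False
  define D where "D = {int l - int k |k l. (k, l) \<in> S}"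
  have D_add: "x + y \<in> D" if xy: "x \<in> D" "y \<in> D" for x y
  proof -
    obtain k l k' l' where *: "x = int l - int k" "(k, l) \<in> S" "y = int l' - int k'" "(k', l') \<in> S"
      using xy by (auto simp: D_def)
    then have "x + y = int (l + l') - int (k + k')" by simp
    with add[OF *(2,4)] show ?thesis unfolding D_def by blast
  qed
  have D_neg: "- x \<in> D" if x: "x \<in> D" for x
  proof -
    obtain k l where *: "x = int l - int k" "(k, l) \<in> S"
      using x by (auto simp: D_def)
    then have "- x = int k - int l" by simp
    with sym[OF *(2)] show ?thesis unfolding D_def by blast
  qed
  from False obtain k l where kl: "(k, l) \<in> S" "k \<noteq> l" by auto
  then have "int l - int k \<in> D" "int l - int k \<noteq> 0" unfolding D_def by auto
  then obtain d where d: "d > 0" "int d \<in> D" and d_dvd: "\<And>y. y \<in> D \<Longrightarrow> int d dvd y"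
    using int_subgroup_generator[of D, OF D_add D_neg] by metis
  obtain m where m: "(m, m + d) \<in> S"
  proof -
    obtain k l where *: "int d = int l - int k" "(k, l) \<in> S" using d(2) unfolding D_def by auto
    then have "l = k + d" by simp
    with * show thesis using that by blast
  qed
  have slope2: "a * k \<le> b * l" if "(k, l) \<in> S" for k l using ab(3)[OF sym[OF that]] .
  have lt: "a < b"
  proof -
    have "a \<le> b" using ab(3)[OF one] by simp
    moreover have "a \<noteq> b"
    proof
      assume "a = b"
      then have "a * l \<le> a * k" "a * k \<le> a * l" using ab(3)[OF kl(1)] slope2[OF kl(1)] by auto
      then show False using kl(2) ab(2) by simp
    qed
    ultimately show ?thesis by simp
  qed
  have dvd: "int d dvd int l - int k" if "(k, l) \<in> S" for k l
    using that d_dvd unfolding D_def by blast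
  obtain q where q: "b = a + d * q" "q > 0"
  proof -
    obtain z where z: "int b - int a = int d * z" using dvd[OF ab(1)] by (meson dvdE)
    have "z > 0"
    proof -
      have "int d * z > 0" using z lt by simp
      then show ?thesis using d(1) by (simp add: zero_less_mult_iff)
    qed
    then have "int b = int (a + d * nat z)" using z by simp
    then have "b = a + d * nat z" by (simp only: of_nat_eq_iff)
    with \<open>z > 0\<close> show thesis by (intro that[of "nat z"]) simp_all
  qed
  define E where "E = d * q * q * m"
  have deep1: "(k, l) \<in> S" if h: "k \<le> l" "int d dvd int l - int k" "a * l + E \<le> b * k" for k l
  proof -
    obtain z where z: "int l - int k = int d * z" using h(2) by (meson dvdE)
    have "z \<ge> 0"
    proof -
      have "int d * z \<ge> 0" using z h by simp
      then show ?thesis using d(1) by (simp add: zero_le_mult_iff)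
    qed
    then have "int l = int (k + d * nat z)" using z by simp
    then have l: "l = k + d * nat z" by (simp only: of_nat_eq_iff)
    show ?thesis unfolding l
      by (rule deep_pairs_in_monoid[OF add zero one ab(1)[unfolded q(1)] q(2) m d(1)])
        (use h(3) in \<open>simp_all add: l E_def q(1)\<close>)
  qed
  have deep: "(k, l) \<in> S"
    if "int d dvd int l - int k" "a * l + E \<le> b * k" "a * k + E \<le> b * l" for k l
  proof (cases "k \<le> l")
    case True then show ?thesis using deep1 that by blast
  next
    case False
    have "int d dvd int k - int l" using that(1) by (metis dvd_minus_iff minus_diff_eq)
    then show ?thesis using sym[OF deep1[of l k]] that False by simp
  qed
  \<comment> \<open>E is the depth from which on S is full, and b t pays for the shift by (t, t)
    that leads into T.\<close>
  define C where "C = E + b * t"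
  have deepT: "(k, l) \<in> T"
    if h: "int d dvd int l - int k" "a * l + C \<le> b * k" "a * k + C \<le> b * l" for k l
  proof -
    have "b * t \<le> b * k" "b * t \<le> b * l" using h unfolding C_def by linarith+
    then have t: "t \<le> k" "t \<le> l" using lt by auto
    have "int d dvd int (l - t) - int (k - t)" using h(1) t by simp
    moreover have "a * (l - t) + E \<le> b * (k - t)" "a * (k - t) + E \<le> b * (l - t)"
    proof -
      have "a * (l - t) \<le> a * l" "a * (k - t) \<le> a * k" by auto
      then show "a * (l - t) + E \<le> b * (k - t)" "a * (k - t) + E \<le> b * (l - t)"
        using h unfolding C_def diff_mult_distrib2[of b] by linarith+
    qed
    ultimately have "(k - t, l - t) \<in> S" by (rule deep)
    from ST[OF this] t show ?thesis by simp
  qed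
  have "is_AAP d C {l. (k, l) \<in> T}" if k: "k \<ge> C + d * b * C" for k
  proof (rule is_AAP_deep_column[where a = a and b = b and k = k])
    show "int d dvd int l - int k" if "l \<in> {l. (k, l) \<in> T}" for l
      using that TS dvd by blast
    show "a * l \<le> b * k \<and> a * k \<le> b * l" if "l \<in> {l. (k, l) \<in> T}" for l
      using that TS ab(3) slope2 by blast
  qed (use d ab lt deepT k in auto)
  then show ?thesis using d(1) by blast
qed

section \<open>Unit-cancellative monoids with almost all atoms prime\<close>

text \<open>Let G be a basis for the coordinates in I and m a bound for the i-th coordinates on G.
  Elements whose i-th coordinate is at least m are dominated by G; each of the finitely many smaller
  values j gets a basis \<open>F j\<close> of its own.\<close>

lemma dickson_finite_basis:
  fixes c :: "'s \<Rightarrow> 'i \<Rightarrow> nat"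
  assumes "finite I"
  shows "\<exists>G \<subseteq> Z. finite G \<and> (\<forall>z\<in>Z. \<exists>g\<in>G. \<forall>i\<in>I. c g i \<le> c z i)"
  using assms
proof (induction I arbitrary: Z)
  case empty
  show ?case
  proof (cases "Z = {}")
    case False
    then obtain z where "z \<in> Z" by blast
    then show ?thesis by (intro exI[of _ "{z}"]) auto
  qed auto
next
  case (insert i I)
  obtain G where G: "G \<subseteq> Z" "finite G" "\<And>z. z \<in> Z \<Longrightarrow> \<exists>g\<in>G. \<forall>i\<in>I. c g i \<le> c z i"
    using insert.IH[of Z] by blast
  obtain m where m: "\<And>g. g \<in> G \<Longrightarrow> c g i \<le> m"
    using G(2) finite_nat_set_iff_bounded_le[of "(\<lambda>g. c g i) ` G"] by auto
  have "\<forall>j. \<exists>F \<subseteq> {z \<in> Z. c z i = j}. finite F \<and>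
      (\<forall>z \<in> {z \<in> Z. c z i = j}. \<exists>g\<in>F. \<forall>i\<in>I. c g i \<le> c z i)"
    using insert.IH by blast
  from choice[OF this] obtain F where F': "\<forall>j. F j \<subseteq> {z \<in> Z. c z i = j} \<and> finite (F j) \<and>
      (\<forall>z \<in> {z \<in> Z. c z i = j}. \<exists>g\<in>F j. \<forall>i\<in>I. c g i \<le> c z i)" ..
  then have F: "F j \<subseteq> {z \<in> Z. c z i = j}" "finite (F j)"
    "\<And>z. z \<in> Z \<Longrightarrow> c z i = j \<Longrightarrow> \<exists>g\<in>F j. \<forall>i\<in>I. c g i \<le> c z i" for j
    by simp_all
  show ?case
  proof (intro exI[of _ "G \<union> (\<Union>j<m. F j)"] conjI ballI)
    fix z assume z: "z \<in> Z"
    show "\<exists>g \<in> G \<union> (\<Union>j<m. F j). \<forall>i \<in> insert i I. c g i \<le> c z i"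
    proof (cases "c z i < m")
      case True
      obtain g where g: "g \<in> F (c z i)" "\<forall>i\<in>I. c g i \<le> c z i" using F(3)[OF z] by blast
      then have "c g i = c z i" using F(1) by blast
      with g True show ?thesis by (intro bexI[of _ g]) auto
    next
      case False
      obtain g where g: "g \<in> G" "\<forall>i\<in>I. c g i \<le> c z i" using G(3)[OF z] by blast
      then have "c g i \<le> c z i" using m[OF g(1)] False by simp
      with g show ?thesis by (intro bexI[of _ g]) auto
    qed
  next
    show "G \<union> (\<Union>j<m. F j) \<subseteq> Z" using G(1) F(1) by blast
    show "finite (G \<union> (\<Union>j<m. F j))" using G(2) F(2) by simp
  qed
qed

lemma finite_pairs_max_slope:
  fixes Y :: "(nat \<times> nat) set"
  assumes "finite Y" "Y \<noteq> {}" "\<And>k l. (k, l) \<in> Y \<Longrightarrow> k > 0"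
  shows "\<exists>a b. (a, b) \<in> Y \<and> (\<forall>k l. (k, l) \<in> Y \<longrightarrow> a * l \<le> b * k)"
proof -
  define g where "g = (\<lambda>(k::nat, l::nat). real l / real k)"
  have "Max (g ` Y) \<in> g ` Y" using assms by (intro Max_in) auto
  then obtain z where z: "z \<in> Y" "g z = Max (g ` Y)" by auto
  obtain a b where ab: "z = (a, b)" by (cases z)
  have "a * l \<le> b * k" if kl: "(k, l) \<in> Y" for k l
  proof -
    have "g (k, l) \<le> g z" using z kl assms(1) by simp
    moreover have "k > 0" "a > 0" using assms(3) kl z ab by auto
    ultimately have "real (a * l) \<le> real (b * k)" by (simp add: g_def ab field_simps)
    then show ?thesis by (simp only: of_nat_le_iff)
  qed
  then show ?thesis using z ab by blast
qed

text \<open>Factorizations are taken as multisets so that they can be added, subtracted and compared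
  coordinatewise. In a commutative monoid every enumeration gives the same product.\<close>

definition mset_prod :: "('a, 'b) monoid_scheme \<Rightarrow> 'a multiset \<Rightarrow> 'a"
  where "mset_prod H M = foldr (\<otimes>\<^bsub>H\<^esub>) (SOME as. mset as = M) \<one>\<^bsub>H\<^esub>"

context comm_monoid
begin

lemma mset_prod_mset:
  assumes "set as \<subseteq> carrier G"
  shows "mset_prod G (mset as) = foldr (\<otimes>) as \<one>"
proof -
  have "mset (SOME bs. mset bs = mset as) = mset as" by (rule someI) simp
  then show ?thesis unfolding mset_prod_def
    using assms by (intro multlist_perm_cong) (auto dest: mset_eq_setD)
qed

lemma mset_prod_empty [simp]: "mset_prod G {#} = \<one>"
  using mset_prod_mset[of "[]"] by simp

lemma mset_prod_closed [simp]:
  assumes "set_mset M \<subseteq> carrier G"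
  shows "mset_prod G M \<in> carrier G"
proof -
  obtain as where "M = mset as" using ex_mset by metis
  then show ?thesis using assms multlist_closed[of as] by (simp add: mset_prod_mset)
qed

lemma mset_prod_add_mset:
  assumes "a \<in> carrier G" "set_mset M \<subseteq> carrier G"
  shows "mset_prod G (add_mset a M) = a \<otimes> mset_prod G M"
proof -
  obtain as where "M = mset as" using ex_mset by metis
  then show ?thesis using assms mset_prod_mset[of "a # as"] by (simp add: mset_prod_mset)
qed

lemma mset_prod_union:
  assumes "set_mset M \<subseteq> carrier G" "set_mset N \<subseteq> carrier G"
  shows "mset_prod G (M + N) = mset_prod G M \<otimes> mset_prod G N"
  using assms(1) by (induction M) (use assms(2) in \<open>auto simp: mset_prod_add_mset m_assoc\<close>)

end

text \<open>Cancellation may fail for ideals; \<open>unit_cancel\<close> is the part of it that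
  Nakayama's lemma supplies.\<close>

locale reduced_atomic_monoid = comm_monoid H for H (structure) +
  assumes reduced: "\<lbrakk>x \<in> carrier H; y \<in> carrier H; x \<otimes> y = \<one>\<rbrakk> \<Longrightarrow> x = \<one>"
    and unit_cancel: "\<lbrakk>x \<in> carrier H; y \<in> carrier H; x \<otimes> y = x\<rbrakk> \<Longrightarrow> y = \<one>"
    and atomic: "x \<in> carrier H \<Longrightarrow> \<exists>as. set as \<subseteq> atoms H \<and> foldr (\<otimes>) as \<one> = x"
begin

lemma atoms_closed: "a \<in> atoms H \<Longrightarrow> a \<in> carrier H"
  by (simp add: atoms_def)

lemma atoms_subset: "atoms H \<subseteq> carrier H"
  using atoms_closed by blast

lemma atomic_mset:
  assumes "x \<in> carrier H"
  obtains M where "set_mset M \<subseteq> atoms H" "mset_prod H M = x"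
proof -
  obtain as where as: "set as \<subseteq> atoms H" "foldr (\<otimes>) as \<one> = x" using atomic[OF assms] by blast
  then show thesis using that[of "mset as"] mset_prod_mset[of as] atoms_subset by auto
qed

lemma mset_prod_eq_oneD:
  assumes "set_mset M \<subseteq> atoms H" "mset_prod H M = \<one>"
  shows "M = {#}"
proof (cases M)
  case (add a N)
  have "a \<in> atoms H" "set_mset N \<subseteq> carrier H" using assms(1) add atoms_subset by auto
  then have "a = \<one>"
    using assms(2) reduced[of a "mset_prod H N"] atoms_closed
    by (simp add: add mset_prod_add_mset)
  with \<open>a \<in> atoms H\<close> show ?thesis by (simp add: atoms_def)
qed simp

lemma lengths_of_eq_sizes:
  "lengths_of H x = {size M |M. set_mset M \<subseteq> atoms H \<and> mset_prod H M = x}"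
proof -
  have "{length as |as. set as \<subseteq> atoms H \<and> foldr (\<otimes>) as \<one> = x} =
      {size M |M. set_mset M \<subseteq> atoms H \<and> mset_prod H M = x}" (is "?A = ?B")
  proof (intro equalityI subsetI)
    fix n assume "n \<in> ?A"
    then obtain as where "n = length as" "set as \<subseteq> atoms H" "foldr (\<otimes>) as \<one> = x" by blast
    then show "n \<in> ?B" using mset_prod_mset[of as] atoms_subset
      by (intro CollectI exI[of _ "mset as"]) auto
  next
    fix n assume "n \<in> ?B"
    then obtain M where M: "n = size M" "set_mset M \<subseteq> atoms H" "mset_prod H M = x" by blast
    obtain as where "M = mset as" using ex_mset by metis
    with M show "n \<in> ?A" using mset_prod_mset[of as] atoms_subset
      by (intro CollectI exI[of _ as]) auto
  qed
  moreover have "?B = {0}" if "x = \<one>"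
    using that mset_prod_eq_oneD by (force intro: exI[of _ "{#}"])
  ultimately show ?thesis unfolding lengths_of_def by auto
qed

lemma size_in_lengths_of:
  "\<lbrakk>set_mset M \<subseteq> atoms H; mset_prod H M = x\<rbrakk> \<Longrightarrow> size M \<in> lengths_of H x"
  unfolding lengths_of_eq_sizes by blast

text \<open>
  Equality in the Grothendieck group. Unlike equality in \<open>H\<close>, it is a cancellative congruence,
  so that its pairs of factorizations form a finitely generated monoid.
\<close>

definition stably_equal :: "'a multiset \<Rightarrow> 'a multiset \<Rightarrow> bool"
  where "stably_equal u v \<longleftrightarrow> (\<exists>J\<in>carrier H. J \<otimes> mset_prod H u = J \<otimes> mset_prod H v)"

lemma stably_equal_sym: "stably_equal u v \<Longrightarrow> stably_equal v u"
  unfolding stably_equal_def by metis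

text \<open>Here unit-cancellativity enters. It makes both components of a non-trivial pair
  non-empty, which bounds the ratios of lengths.\<close>

lemma stably_equal_emptyD:
  assumes "set_mset v \<subseteq> atoms H" "stably_equal {#} v"
  shows "v = {#}"
proof -
  have "mset_prod H v \<in> carrier H" using assms(1) atoms_subset by auto
  moreover obtain J where "J \<in> carrier H" "J \<otimes> mset_prod H v = J"
    using assms(2) by (auto simp: stably_equal_def)
  ultimately have "mset_prod H v = \<one>" using unit_cancel by metis
  then show ?thesis using mset_prod_eq_oneD assms(1) by blast
qed

lemma stabilizer_add:
  assumes "J \<in> carrier H" "{a, b, c, d} \<subseteq> carrier H" "J \<otimes> a = J \<otimes> b" "J \<otimes> c = J \<otimes> d"
  shows "J \<otimes> (a \<otimes> c) = J \<otimes> (b \<otimes> d)"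
proof -
  have "J \<otimes> (a \<otimes> c) = (J \<otimes> a) \<otimes> c" using assms(1,2) by (simp add: m_assoc)
  also have "\<dots> = b \<otimes> (J \<otimes> c)" using assms(1,2) unfolding assms(3) by (simp add: m_ac)
  also have "\<dots> = J \<otimes> (b \<otimes> d)" using assms by (simp add: m_lcomm)
  finally show ?thesis .
qed

lemma stably_equal_add:
  assumes "set_mset u \<subseteq> carrier H" "set_mset v \<subseteq> carrier H" "set_mset u' \<subseteq> carrier H"
    "set_mset v' \<subseteq> carrier H" "stably_equal u v" "stably_equal u' v'"
  shows "stably_equal (u + u') (v + v')"
proof -
  obtain J J' where J: "J \<in> carrier H" "J \<otimes> mset_prod H u = J \<otimes> mset_prod H v"
    and J': "J' \<in> carrier H" "J' \<otimes> mset_prod H u' = J' \<otimes> mset_prod H v'"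
    using assms(5,6) unfolding stably_equal_def by blast
  have "(J' \<otimes> J) \<otimes> mset_prod H u = (J' \<otimes> J) \<otimes> mset_prod H v"
    using J J'(1) assms(1-4) by (simp add: m_assoc)
  then have "(J \<otimes> J') \<otimes> mset_prod H u = (J \<otimes> J') \<otimes> mset_prod H v"
    using m_comm[OF J(1) J'(1)] by simp
  moreover have "(J \<otimes> J') \<otimes> mset_prod H u' = (J \<otimes> J') \<otimes> mset_prod H v'"
    using J J' assms by (simp add: m_assoc)
  ultimately have "(J \<otimes> J') \<otimes> mset_prod H (u + u') = (J \<otimes> J') \<otimes> mset_prod H (v + v')"
    using stabilizer_add[of "J \<otimes> J'"] J(1) J'(1) assms(1-4) by (simp add: mset_prod_union)
  then show ?thesis unfolding stably_equal_def using J(1) J'(1) by blast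
qed

text \<open>If J equates u with v and J' equates u + u' with v + v', then J' J u equates u' with v':
  in J' J u u' replace u u' by v v', then J v by J u.\<close>

lemma stably_equal_cancel:
  assumes "set_mset u \<subseteq> carrier H" "set_mset v \<subseteq> carrier H" "set_mset u' \<subseteq> carrier H"
    "set_mset v' \<subseteq> carrier H" "stably_equal u v" "stably_equal (u + u') (v + v')"
  shows "stably_equal u' v'"
proof -
  let ?p = "mset_prod H"
  obtain J J' where J: "J \<in> carrier H" "J \<otimes> ?p u = J \<otimes> ?p v"
    and J': "J' \<in> carrier H" "J' \<otimes> (?p u \<otimes> ?p u') = J' \<otimes> (?p v \<otimes> ?p v')"
    using assms unfolding stably_equal_def by (auto simp: mset_prod_union)
  have cl: "?p u \<in> carrier H" "?p v \<in> carrier H" "?p u' \<in> carrier H" "?p v' \<in> carrier H"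
    using assms by auto
  have "(J' \<otimes> (J \<otimes> ?p u)) \<otimes> ?p u' = J \<otimes> (J' \<otimes> (?p u \<otimes> ?p u'))"
    using J(1) J'(1) cl by (simp add: m_ac)
  also have "\<dots> = J' \<otimes> (J \<otimes> ?p v) \<otimes> ?p v'"
    unfolding J'(2) using J(1) J'(1) cl by (simp add: m_ac)
  also have "\<dots> = J' \<otimes> (J \<otimes> ?p u) \<otimes> ?p v'" by (simp add: J(2))
  finally show ?thesis unfolding stably_equal_def using J(1) J'(1) cl by blast
qed

section \<open>Finite generation of the pairs of stably equal factorizations\<close>

definition factorization_pairs :: "'a set \<Rightarrow> ('a multiset \<times> 'a multiset) set"
  where "factorization_pairs A = {(u, v). set_mset u \<subseteq> A \<and> set_mset v \<subseteq> A \<and> stably_equal u v}"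

text \<open>The generators form a Dickson basis of the non-trivial pairs. Subtracting one of them
  from a pair above it stays in the set because stable equality is cancellative, and shortens the
  first component because no component of a generator is empty. Generation is stated as an induction
  principle, the form in which the uniform stabilizer and the bound on slopes need it.\<close>

lemma factorization_pairs_finite_generators:
  assumes A: "A \<subseteq> atoms H" and fin: "finite A"
  obtains G where "finite G" "G \<subseteq> factorization_pairs A"
    "\<And>u v. (u, v) \<in> G \<Longrightarrow> u \<noteq> {#} \<and> v \<noteq> {#}"
    "\<forall>P. P ({#}, {#}) \<longrightarrow>
      (\<forall>u v u' v'. (u, v) \<in> G \<longrightarrow> (u', v') \<in> factorization_pairs A \<longrightarrow> P (u', v') \<longrightarrow>
        P (u + u', v + v')) \<longrightarrow> (\<forall>z\<in>factorization_pairs A. P z)"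
proof -
  let ?Z = "factorization_pairs A"
  \<comment> \<open>Indexing by A times bool turns a pair of multisets into a single vector of
    multiplicities.\<close>
  define c where "c z = (\<lambda>(a::'a, i). if i then count (fst z) a else count (snd z) a)"
    for z :: "'a multiset \<times> 'a multiset"
  obtain G where G: "G \<subseteq> ?Z - {({#}, {#})}" "finite G"
    and basis: "\<And>z. z \<in> ?Z - {({#}, {#})} \<Longrightarrow>
        \<exists>g\<in>G. \<forall>i\<in>A \<times> (UNIV :: bool set). c g i \<le> c z i"
    using dickson_finite_basis[of "A \<times> (UNIV :: bool set)" "?Z - {({#}, {#})}" c] fin by auto
  have carr: "set_mset u \<subseteq> carrier H" "set_mset v \<subseteq> carrier H" if "(u, v) \<in> ?Z" for u v
    using that A atoms_subset unfolding factorization_pairs_def by auto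
  have ne: "u \<noteq> {#} \<and> v \<noteq> {#}" if uv: "(u, v) \<in> G" for u v
  proof -
    have *: "set_mset u \<subseteq> atoms H" "set_mset v \<subseteq> atoms H" "stably_equal u v"
      "u \<noteq> {#} \<or> v \<noteq> {#}"
      using uv G(1) A unfolding factorization_pairs_def by auto
    then show ?thesis using stably_equal_emptyD stably_equal_sym by blast
  qed
  have ind: "P z"
    if z: "z \<in> ?Z" and zero: "P ({#}, {#})"
      and step: "\<And>u v u' v'. (u, v) \<in> G \<Longrightarrow> (u', v') \<in> ?Z \<Longrightarrow> P (u', v') \<Longrightarrow> P (u + u', v + v')"
    for P z
    using z
  proof (induction "size (fst z)" arbitrary: z rule: less_induct)
    case less
    show ?case
    proof (cases "z = ({#}, {#})")
      case False
      with less.prems basis obtain g where g: "g \<in> G"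
        and le: "\<forall>i\<in>A \<times> (UNIV :: bool set). c g i \<le> c z i" by blast
      obtain u v x y where uv: "g = (u, v)" and xy: "z = (x, y)" by (cases g, cases z)
      have gZ: "(u, v) \<in> ?Z" using g uv G(1) by blast
      have "count u a \<le> count x a" for a
      proof (cases "a \<in> A")
        case True
        then show ?thesis using le[rule_format, of "(a, True)"] by (simp add: c_def uv xy)
      next
        case False
        then have "a \<notin># u" using gZ by (auto simp: factorization_pairs_def)
        then show ?thesis by (simp add: not_in_iff)
      qed
      then have ux: "u \<subseteq># x" by (simp add: subseteq_mset_def)
      have "count v a \<le> count y a" for a
      proof (cases "a \<in> A")
        case True
        then show ?thesis using le[rule_format, of "(a, False)"] by (simp add: c_def uv xy)
      next
        case False
        then have "a \<notin># v" using gZ by (auto simp: factorization_pairs_def)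
        then show ?thesis by (simp add: not_in_iff)
      qed
      then have vy: "v \<subseteq># y" by (simp add: subseteq_mset_def)
      have x: "x = u + (x - u)" and y: "y = v + (y - v)" using ux vy by auto
      have sub: "set_mset (x - u) \<subseteq> A" "set_mset (y - v) \<subseteq> A"
        using less.prems xy by (auto simp: factorization_pairs_def dest: in_diffD)
      have "(x - u, y - v) \<in> ?Z"
      proof -
        have "stably_equal (u + (x - u)) (v + (y - v))"
          using less.prems x y xy by (auto simp: factorization_pairs_def)
        moreover have "stably_equal u v" using gZ by (simp add: factorization_pairs_def)
        ultimately have "stably_equal (x - u) (y - v)"
          using stably_equal_cancel[of u v "x - u" "y - v"] carr[OF gZ] sub A atoms_subset by blast
        then show ?thesis using sub by (simp add: factorization_pairs_def)
      qed
      moreover have "size (x - u) < size x"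
        using ne[of u v] g uv arg_cong[OF x, of size] by (simp add: nonempty_has_size)
      ultimately have "P (x - u, y - v)" using less.hyps[of "(x - u, y - v)"] xy by simp
      then have "P (u + (x - u), v + (y - v))"
        using step g uv \<open>(x - u, y - v) \<in> ?Z\<close> by blast
      then show ?thesis using x y xy by simp
    qed (use zero in simp)
  qed
  show thesis
  proof (rule that[of G])
    show "\<forall>P. P ({#}, {#}) \<longrightarrow>
      (\<forall>u v u' v'. (u, v) \<in> G \<longrightarrow> (u', v') \<in> ?Z \<longrightarrow> P (u', v') \<longrightarrow> P (u + u', v + v')) \<longrightarrow>
      (\<forall>z\<in>?Z. P z)"
    proof (intro allI impI ballI)
      fix P z assume zero: "P ({#}, {#})" and z: "z \<in> ?Z"
        and step: "\<forall>u v u' v'. (u, v) \<in> G \<longrightarrow> (u', v') \<in> ?Z \<longrightarrow> P (u', v') \<longrightarrow> P (u + u', v + v')"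
      show "P z" by (rule ind[OF z, of P]) (rule zero, rule step[rule_format])
    qed
  qed (use G ne in blast)+
qed

text \<open>A product of stabilizers, one for each generator, stabilizes all generators, and a
  common stabilizer passes to sums.\<close>

lemma uniform_stabilizer:
  assumes A: "A \<subseteq> atoms H" and fin: "finite A"
  obtains J where "J \<in> carrier H"
    "\<And>u v. (u, v) \<in> factorization_pairs A \<Longrightarrow> J \<otimes> mset_prod H u = J \<otimes> mset_prod H v"
proof -
  obtain G where G: "finite G" "G \<subseteq> factorization_pairs A"
    and "\<And>u v. (u, v) \<in> G \<Longrightarrow> u \<noteq> {#} \<and> v \<noteq> {#}"
    and G_ind: "\<forall>P. P ({#}, {#}) \<longrightarrow>
      (\<forall>u v u' v'. (u, v) \<in> G \<longrightarrow> (u', v') \<in> factorization_pairs A \<longrightarrow> P (u', v') \<longrightarrow>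
        P (u + u', v + v')) \<longrightarrow> (\<forall>z\<in>factorization_pairs A. P z)"
    by (rule factorization_pairs_finite_generators[OF A fin]) (rule that)
  have carr: "set_mset u \<subseteq> carrier H" "set_mset v \<subseteq> carrier H"
    if "(u, v) \<in> factorization_pairs A" for u v
    using that A atoms_subset unfolding factorization_pairs_def by auto
  have "\<exists>J\<in>carrier H. \<forall>(u, v)\<in>G. J \<otimes> mset_prod H u = J \<otimes> mset_prod H v"
    using G
  proof (induction G)
    case empty
    show ?case by (intro bexI[of _ \<one>]) auto
  next
    case (insert g G)
    obtain u v where g: "g = (u, v)" by (cases g)
    have uv: "(u, v) \<in> factorization_pairs A" using insert.prems g by blast
    obtain J where J: "J \<in> carrier H" "J \<otimes> mset_prod H u = J \<otimes> mset_prod H v"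
      using uv unfolding factorization_pairs_def stably_equal_def by blast
    obtain J' where J': "J' \<in> carrier H"
      "\<And>u v. (u, v) \<in> G \<Longrightarrow> J' \<otimes> mset_prod H u = J' \<otimes> mset_prod H v"
      using insert.IH insert.prems by blast
    have "(J \<otimes> J') \<otimes> mset_prod H x = (J \<otimes> J') \<otimes> mset_prod H y" if xy: "(x, y) \<in> insert g G" for x y
    proof -
      have xy': "(x, y) \<in> factorization_pairs A" using xy insert.prems by blast
      have cl: "mset_prod H x \<in> carrier H" "mset_prod H y \<in> carrier H"
        using carr[OF xy'] by auto
      show ?thesis
      proof (cases "(x, y) \<in> G")
        case True
        then show ?thesis using J'(1) J'(2)[OF True] J(1) cl by (simp add: m_assoc)
      next
        case False
        then have "J \<otimes> mset_prod H x = J \<otimes> mset_prod H y" using xy g J(2) by simp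
        then have "J' \<otimes> J \<otimes> mset_prod H x = J' \<otimes> J \<otimes> mset_prod H y"
          using J(1) J'(1) cl by (simp add: m_assoc)
        then show ?thesis using m_comm[OF J(1) J'(1)] by simp
      qed
    qed
    then show ?case using J(1) J'(1) by (intro bexI[of _ "J \<otimes> J'"]) auto
  qed
  then obtain J where J: "J \<in> carrier H"
    "\<And>u v. (u, v) \<in> G \<Longrightarrow> J \<otimes> mset_prod H u = J \<otimes> mset_prod H v"
    by blast
  have "J \<otimes> mset_prod H (fst z) = J \<otimes> mset_prod H (snd z)" if z: "z \<in> factorization_pairs A" for z
    using z
  proof (rule spec[OF G_ind, rule_format, rotated -1])
    fix u v u' v' assume *: "(u, v) \<in> G" "(u', v') \<in> factorization_pairs A"
      "J \<otimes> mset_prod H (fst (u', v')) = J \<otimes> mset_prod H (snd (u', v'))"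
    have "(u, v) \<in> factorization_pairs A" using *(1) G(2) by blast
    note cl = carr[OF this] carr[OF *(2)]
    have "J \<otimes> (mset_prod H u \<otimes> mset_prod H u') = J \<otimes> (mset_prod H v \<otimes> mset_prod H v')"
      by (rule stabilizer_add) (use J * cl in auto)
    then show "J \<otimes> mset_prod H (fst (u + u', v + v')) = J \<otimes> mset_prod H (snd (u + u', v + v'))"
      using cl by (simp add: mset_prod_union)
  qed simp
  then show thesis using that[OF J(1)] by fastforce
qed

text \<open>An atom divisible by the atom b equals b, so a prime b divides a product of atoms only
  by occurring in it.\<close>

lemma prime_dvd_mset_prod:
  assumes b: "b \<in> atoms H"
    and prime: "\<And>x y c. \<lbrakk>x \<in> carrier H; y \<in> carrier H; c \<in> carrier H; x \<otimes> y = b \<otimes> c\<rbrakk> \<Longrightarrow>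
      (\<exists>c'\<in>carrier H. x = b \<otimes> c') \<or> (\<exists>c'\<in>carrier H. y = b \<otimes> c')"
    and N: "set_mset N \<subseteq> atoms H" and eq: "mset_prod H N = b \<otimes> c" and c: "c \<in> carrier H"
  shows "b \<in># N"
  using N eq c
proof (induction N arbitrary: c)
  case empty
  then have "b = \<one>" using reduced[OF atoms_closed[OF b] empty.prems(3)] by simp
  then show ?case using b by (simp add: atoms_def)
next
  case (add a N)
  have a: "a \<in> atoms H" and N: "set_mset N \<subseteq> atoms H" using add.prems by auto
  have "a \<otimes> mset_prod H N = b \<otimes> c"
    using add.prems a N atoms_subset by (subst mset_prod_add_mset[symmetric]) auto
  then consider (1) c' where "c' \<in> carrier H" "a = b \<otimes> c'"
    | (2) c' where "c' \<in> carrier H" "mset_prod H N = b \<otimes> c'"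
    using prime[OF atoms_closed[OF a] mset_prod_closed[OF subset_trans[OF N atoms_subset]] add.prems(3)]
    by blast
  then show ?case
  proof cases
    case 1
    have "\<forall>x\<in>carrier H. \<forall>y\<in>carrier H. a = x \<otimes> y \<longrightarrow> x = \<one> \<or> y = \<one>" and "b \<noteq> \<one>"
      using a b by (simp_all add: atoms_def)
    then have "c' = \<one>" using 1 atoms_closed[OF b] by blast
    then have "a = b" using 1 atoms_closed[OF b] by simp
    then show ?thesis by simp
  next
    case 2
    then show ?thesis using add.IH[OF N 2(2,1)] by simp
  qed
qed

text \<open>A prime b on one side divides the product on the other; as it is not in A, it occurs
  there among the atoms of B and can be cancelled. Two factorizations of one element thus share
  their atoms of B, and their lengths differ only through A.\<close>

lemma strip_primes:
  assumes B: "B \<subseteq> atoms H" and A: "A \<subseteq> atoms H" "A \<inter> B = {}"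
    and cancel: "\<And>b x y. \<lbrakk>b \<in> B; x \<in> carrier H; y \<in> carrier H; b \<otimes> x = b \<otimes> y\<rbrakk> \<Longrightarrow> x = y"
    and prime: "\<And>b x y c. \<lbrakk>b \<in> B; x \<in> carrier H; y \<in> carrier H; c \<in> carrier H; x \<otimes> y = b \<otimes> c\<rbrakk> \<Longrightarrow>
      (\<exists>c'\<in>carrier H. x = b \<otimes> c') \<or> (\<exists>c'\<in>carrier H. y = b \<otimes> c')"
    and sub: "set_mset u \<subseteq> A" "set_mset v \<subseteq> A" "set_mset u' \<subseteq> B" "set_mset v' \<subseteq> B"
    and eq: "mset_prod H (u' + u) = mset_prod H (v' + v)"
  shows "u' = v' \<and> mset_prod H u = mset_prod H v"
  using sub(3,4) eq
proof (induction u' arbitrary: v')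
  case empty
  have "v' = {#}"
  proof (rule ccontr)
    assume "v' \<noteq> {#}"
    then obtain b w where w: "v' = add_mset b w" by (meson multiset_cases)
    have b: "b \<in> B" using empty w by auto
    have cl: "set_mset (w + v) \<subseteq> carrier H" "b \<in> carrier H"
      using empty w sub A B atoms_subset by auto
    have "mset_prod H u = b \<otimes> mset_prod H (w + v)"
      using empty.prems(3) cl by (simp add: w mset_prod_add_mset)
    have "b \<in># u"
    proof (rule prime_dvd_mset_prod)
      show "mset_prod H u = b \<otimes> mset_prod H (w + v)" by fact
      show "b \<in> atoms H" using b B by blast
      show "set_mset u \<subseteq> atoms H" using sub(1) A(1) by auto
    qed (use cl prime[OF b] in auto)
    then show False using b sub A by blast
  qed
  then show ?case using empty.prems by simp
next
  case (add b u')
  have b: "b \<in> B" "set_mset u' \<subseteq> B" using add.prems by auto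
  have cl: "set_mset (u' + u) \<subseteq> carrier H" "b \<in> carrier H"
    using b sub A B atoms_subset by auto
  have eq: "mset_prod H (v' + v) = b \<otimes> mset_prod H (u' + u)"
    using add.prems(3) cl by (simp add: mset_prod_add_mset)
  have "b \<in># v' + v"
  proof (rule prime_dvd_mset_prod)
    show "mset_prod H (v' + v) = b \<otimes> mset_prod H (u' + u)" by fact
    show "b \<in> atoms H" using b(1) B by blast
    show "set_mset (v' + v) \<subseteq> atoms H" using add.prems(2) sub(2) A(1) B by auto
  qed (use cl prime[OF b(1)] in auto)
  then have "b \<in># v'" using b sub A by auto
  then obtain w where w: "v' = add_mset b w" by (meson mset_add)
  have cl': "set_mset (w + v) \<subseteq> carrier H"
    using add.prems(2) w sub A B atoms_subset by auto
  have "b \<otimes> mset_prod H (w + v) = b \<otimes> mset_prod H (u' + u)"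
    using eq cl' cl by (simp add: w mset_prod_add_mset)
  then have "mset_prod H (u' + u) = mset_prod H (w + v)"
    using cancel[OF b(1) mset_prod_closed[OF cl'] mset_prod_closed[OF cl(1)]] by simp
  then have "u' = w \<and> mset_prod H u = mset_prod H v"
    using add.IH[of w] b(2) add.prems(2) w by auto
  then show ?case using w by simp
qed

theorem structure_theorem_if_almost_all_atoms_prime:
  assumes atoms: "atoms H = A \<union> B" "A \<inter> B = {}" "finite A" and ex: "atoms H \<noteq> {}"
    and cancel: "\<And>b x y. \<lbrakk>b \<in> B; x \<in> carrier H; y \<in> carrier H; b \<otimes> x = b \<otimes> y\<rbrakk> \<Longrightarrow> x = y"
    and prime: "\<And>b x y c. \<lbrakk>b \<in> B; x \<in> carrier H; y \<in> carrier H; c \<in> carrier H; x \<otimes> y = b \<otimes> c\<rbrakk> \<Longrightarrow>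
      (\<exists>c'\<in>carrier H. x = b \<otimes> c') \<or> (\<exists>c'\<in>carrier H. y = b \<otimes> c')"
  shows "structure_theorem_for_unions (system_of_lengths H)"
proof -
  let ?Z = "factorization_pairs A" and ?p = "mset_prod H"
  have A: "A \<subseteq> atoms H" and B: "B \<subseteq> atoms H" using atoms by auto
  obtain b where b: "b \<in> atoms H" using ex by blast
  have carr: "set_mset u \<subseteq> carrier H" "set_mset v \<subseteq> carrier H" if "(u, v) \<in> ?Z" for u v
    using that A atoms_subset unfolding factorization_pairs_def by auto
  obtain G where G: "finite G" "G \<subseteq> ?Z" "\<And>u v. (u, v) \<in> G \<Longrightarrow> u \<noteq> {#} \<and> v \<noteq> {#}"
    and G_ind: "\<forall>P. P ({#}, {#}) \<longrightarrow>
      (\<forall>u v u' v'. (u, v) \<in> G \<longrightarrow> (u', v') \<in> ?Z \<longrightarrow> P (u', v') \<longrightarrow> P (u + u', v + v')) \<longrightarrow>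
      (\<forall>z\<in>?Z. P z)"
    by (rule factorization_pairs_finite_generators[OF A atoms(3)]) (rule that)
  obtain J where J: "J \<in> carrier H" "\<And>u v. (u, v) \<in> ?Z \<Longrightarrow> J \<otimes> ?p u = J \<otimes> ?p v"
    by (rule uniform_stabilizer[OF A atoms(3)]) (rule that)
  obtain C where C: "set_mset C \<subseteq> atoms H" "?p C = J" using atomic_mset[OF J(1)] by metis
  \<comment> \<open>The number n stands for the atoms of B, which are common to both
    factorizations.\<close>
  define S where "S = {(n + size u, n + size v) |n u v. (u, v) \<in> ?Z}"
  define T where "T = {(k, l). \<exists>x\<in>carrier H. k \<in> lengths_of H x \<and> l \<in> lengths_of H x}"
  have SI: "(n + size u, n + size v) \<in> S" if "(u, v) \<in> ?Z" for n u v
    using that unfolding S_def by blast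
  have zeroZ: "({#}, {#}) \<in> ?Z"
    by (auto simp: factorization_pairs_def stably_equal_def)
  \<comment> \<open>(1, 1) belongs to S in any case; including it makes Y non-empty and forces r
    \<le> s for the steepest slope.\<close>
  define Y where "Y = insert (1, 1) ((\<lambda>(u, v). (size u, size v)) ` G)"
  have Y: "finite Y" "Y \<noteq> {}" "\<And>k l. (k, l) \<in> Y \<Longrightarrow> k > 0"
    using G(1,3) by (auto simp: Y_def nonempty_has_size[symmetric])
  have "\<exists>r s. (r, s) \<in> Y \<and> (\<forall>k l. (k, l) \<in> Y \<longrightarrow> r * l \<le> s * k)"
    by (rule finite_pairs_max_slope[OF Y(1,2)]) (rule Y(3))
  then obtain r s where rs: "(r, s) \<in> Y" "\<And>k l. (k, l) \<in> Y \<Longrightarrow> r * l \<le> s * k" by blast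
  have "r \<le> s" using rs(2)[of 1 1] by (simp add: Y_def)
  have "\<exists>d>0. \<exists>M. \<exists>k\<^sub>0. \<forall>k\<ge>k\<^sub>0. is_AAP d M {l. (k, l) \<in> T}"
  proof (rule eventually_AAP_if_cofinal_in_fg_monoid[of S r s T "size C"])
    show "(k + k', l + l') \<in> S" if kl: "(k, l) \<in> S" "(k', l') \<in> S" for k l k' l'
    proof -
      obtain n u v n' u' v' where *: "(u, v) \<in> ?Z" "(u', v') \<in> ?Z"
        "k = n + size u" "l = n + size v" "k' = n' + size u'" "l' = n' + size v'"
        using kl unfolding S_def by blast
      have "(u + u', v + v') \<in> ?Z"
        using stably_equal_add[of u v u' v'] carr[OF *(1)] carr[OF *(2)] *(1,2)
        by (auto simp: factorization_pairs_def)
      from SI[OF this, of "n + n'"] show ?thesis using * by (simp add: ac_simps)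
    qed
    show "(l, k) \<in> S" if "(k, l) \<in> S" for k l
    proof -
      obtain n u v where *: "(u, v) \<in> ?Z" "k = n + size u" "l = n + size v"
        using \<open>(k, l) \<in> S\<close> unfolding S_def by blast
      then have "(v, u) \<in> ?Z" by (auto simp: factorization_pairs_def stably_equal_sym)
      from SI[OF this] * show ?thesis by simp
    qed
    show "(0, 0) \<in> S" "(1, 1) \<in> S" using SI[OF zeroZ, of 0] SI[OF zeroZ, of 1] by auto
    show "(r, s) \<in> S"
    proof (cases "(r, s) = (1, 1)")
      case True then show ?thesis using \<open>(1, 1) \<in> S\<close> by simp
    next
      case False
      then obtain u v where "(u, v) \<in> G" "r = size u" "s = size v"
        using rs(1) by (auto simp: Y_def)
      then show ?thesis using SI[of u v 0] G(2) by auto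
    qed
    show "r > 0" using Y(3) rs(1) by blast
    show "r * l \<le> s * k" if "(k, l) \<in> S" for k l
    proof -
      have Z: "r * size (snd z) \<le> s * size (fst z)" if z: "z \<in> ?Z" for z
        using z
      proof (rule spec[OF G_ind, rule_format, rotated -1])
        fix u v u' v' :: "'a multiset"
        assume *: "(u, v) \<in> G" "r * size (snd (u', v')) \<le> s * size (fst (u', v'))"
        have "(size u, size v) \<in> Y" using *(1) by (force simp: Y_def)
        then have "r * size v \<le> s * size u" by (rule rs(2))
        then show "r * size (snd (u + u', v + v')) \<le> s * size (fst (u + u', v + v'))"
          using *(2) by (simp add: distrib_left)
      qed simp
      obtain n u v where *: "(u, v) \<in> ?Z" "k = n + size u" "l = n + size v"
        using \<open>(k, l) \<in> S\<close> unfolding S_def by blast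
      have "r * n \<le> s * n" by (rule mult_le_mono1) (rule \<open>r \<le> s\<close>)
      moreover have "r * size v \<le> s * size u" using Z[OF *(1)] by simp
      ultimately show ?thesis unfolding *(2,3) distrib_left by linarith
    qed
    show "T \<subseteq> S"
    proof
      fix z assume "z \<in> T"
      then obtain M N where MN: "z = (size M, size N)" "set_mset M \<subseteq> atoms H"
        "set_mset N \<subseteq> atoms H" "?p M = ?p N"
        unfolding T_def lengths_of_eq_sizes by fastforce
      define u u' v v' where uv: "u = filter_mset (\<lambda>x. x \<in> A) M" "u' = filter_mset (\<lambda>x. x \<notin> A) M"
        "v = filter_mset (\<lambda>x. x \<in> A) N" "v' = filter_mset (\<lambda>x. x \<notin> A) N"
      have M: "M = u' + u" and N: "N = v' + v"
        unfolding uv by (simp_all add: add.commute multiset_partition[symmetric])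
      have sub: "set_mset u \<subseteq> A" "set_mset v \<subseteq> A" "set_mset u' \<subseteq> B" "set_mset v' \<subseteq> B"
        using MN(2,3) atoms(1) unfolding uv by auto
      have *: "u' = v' \<and> ?p u = ?p v"
        by (rule strip_primes[OF B A atoms(2) cancel prime sub]) (use MN(4) M N in simp_all)
      then have "stably_equal u v" unfolding stably_equal_def by (intro bexI[of _ \<one>]) auto
      then have "(u, v) \<in> ?Z" using sub by (simp add: factorization_pairs_def)
      from SI[OF this, of "size u'"] show "z \<in> S" using * MN(1) M N by simp
    qed
    show "(size C + k, size C + l) \<in> T" if kl: "(k, l) \<in> S" for k l
    proof -
      obtain n u v where *: "(u, v) \<in> ?Z" "k = n + size u" "l = n + size v"
        using kl unfolding S_def by blast
      \<comment> \<open>The diagonal part (n, n) is realized by n copies of an arbitrary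
        atom.\<close>
      define E where "E = replicate_mset n b"
      have E: "set_mset E \<subseteq> atoms H" "size E = n" using b by (auto simp: E_def)
      have at: "set_mset u \<subseteq> atoms H" "set_mset v \<subseteq> atoms H"
        using *(1) A by (auto simp: factorization_pairs_def)
      have cl: "set_mset C \<subseteq> carrier H" "set_mset E \<subseteq> carrier H"
        using C E atoms_subset by auto
      have eq: "?p (E + (C + u)) = ?p (E + (C + v))"
        using cl carr[OF *(1)] J(2)[OF *(1)] C(2) by (simp add: mset_prod_union)
      have "size (E + (C + u)) \<in> lengths_of H (?p (E + (C + u)))"
        "size (E + (C + v)) \<in> lengths_of H (?p (E + (C + u)))"
        by (rule size_in_lengths_of; use E C at eq in simp)+
      moreover have "?p (E + (C + u)) \<in> carrier H" using cl carr[OF *(1)] by simp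
      moreover have "size (E + (C + u)) = size C + k" "size (E + (C + v)) = size C + l"
        using * E by auto
      ultimately show ?thesis unfolding T_def by (auto simp del: size_union)
    qed
  qed
  moreover have "union_of_lengths (system_of_lengths H) k = {l. (k, l) \<in> T}" for k
    unfolding union_of_lengths_def system_of_lengths_def T_def by auto
  ultimately show ?thesis unfolding structure_theorem_for_unions_def by simp
qed

end

section \<open>Ideals of noetherian domains\<close>

lemma (in ring) noetherian_maximal:
  assumes "noetherian_ring R" "S \<noteq> {}" "\<And>I. I \<in> S \<Longrightarrow> ideal I R"
  obtains M where "M \<in> S" "\<And>I. \<lbrakk>I \<in> S; M \<subseteq> I\<rbrakk> \<Longrightarrow> I = M"
proof -
  have "\<exists>M\<in>S. \<forall>I\<in>S. M \<subseteq> I \<longrightarrow> I = M"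
  proof (rule subset_Zorn)
    fix C assume C: "subset.chain S C"
    show "\<exists>U\<in>S. \<forall>I\<in>C. I \<subseteq> U"
    proof (cases "C = {}")
      case False
      have "subset.chain {I. ideal I R} C" using C assms(3) unfolding pred_on.chain_def by blast
      then have "\<Union>C \<in> C" by (rule noetherian_ring.ideal_chain_is_trivial[OF assms(1) False])
      moreover have "C \<subseteq> S" using C unfolding pred_on.chain_def by blast
      ultimately show ?thesis by blast
    qed (use assms(2) in blast)
  qed
  then show thesis using that by blast
qed

lemma (in ring) genideal_insert_mem:
  assumes "ideal I R" "a \<in> carrier R" "x \<in> I <+>\<^bsub>R\<^esub> PIdl a"
  obtains i r where "i \<in> I" "r \<in> carrier R" "x = i \<oplus> r \<otimes> a"
  using assms(3) unfolding set_add_def' cgenideal_def by blast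

lemma (in cring) subset_add_principal:
  assumes "ideal I R" "a \<in> carrier R"
  shows "ideal (I <+>\<^bsub>R\<^esub> PIdl a) R" "I \<subseteq> I <+>\<^bsub>R\<^esub> PIdl a" "a \<in> I <+>\<^bsub>R\<^esub> PIdl a"
proof -
  have P: "ideal (PIdl a) R" by (rule cgenideal_ideal[OF assms(2)])
  show "ideal (I <+>\<^bsub>R\<^esub> PIdl a) R" by (rule add_ideals[OF assms(1) P])
  have zI: "\<zero> \<in> I" "\<zero> \<in> PIdl a"
    using assms(1) P by (simp_all add: additive_subgroup.zero_closed ideal.axioms(1))
  have "x \<in> I <+>\<^bsub>R\<^esub> PIdl a" if "x \<in> I" for x
    using that zI ideal.Icarr[OF assms(1) that] unfolding set_add_def' by force
  then show "I \<subseteq> I <+>\<^bsub>R\<^esub> PIdl a" by blast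
  have "a \<in> PIdl a" by (rule cgenideal_self[OF assms(2)])
  then show "a \<in> I <+>\<^bsub>R\<^esub> PIdl a" using zI assms(2) unfolding set_add_def' by force
qed

lemma (in cring) proper_ideal_in_primeideal:
  assumes noeth: "noetherian_ring R" and I: "ideal I R" "I \<noteq> carrier R"
  obtains P where "primeideal P R" "I \<subseteq> P"
proof -
  obtain M where M: "M \<in> {J. ideal J R \<and> I \<subseteq> J \<and> J \<noteq> carrier R}"
    and max: "\<And>J. \<lbrakk>J \<in> {J. ideal J R \<and> I \<subseteq> J \<and> J \<noteq> carrier R}; M \<subseteq> J\<rbrakk> \<Longrightarrow> J = M"
    by (rule noetherian_maximal[OF noeth, of "{J. ideal J R \<and> I \<subseteq> J \<and> J \<noteq> carrier R}"])
      (use I in auto)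
  have "maximalideal M R"
  proof (rule maximalidealI)
    fix J assume "ideal J R" "M \<subseteq> J" "J \<subseteq> carrier R"
    then show "J = M \<or> J = carrier R" using M max[of J] by blast
  qed (use M in auto)
  then show thesis using that maximalideal_prime M by blast
qed

lemma (in cring) ideal_prod_minimal:
  assumes "ideal L R" "\<And>i j. \<lbrakk>i \<in> I; j \<in> J\<rbrakk> \<Longrightarrow> i \<otimes> j \<in> L"
  shows "I \<cdot> J \<subseteq> L"
proof
  fix s assume "s \<in> I \<cdot> J"
  then show "s \<in> L"
    by induction (auto intro: assms(2) additive_subgroup.a_closed[OF ideal.axioms(1)[OF assms(1)]])
qed

lemma (in cring) ideal_prod_mono:
  assumes "ideal I R" "ideal J R" "A \<subseteq> I" "B \<subseteq> J"
  shows "A \<cdot> B \<subseteq> I \<cdot> J"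
  by (rule ideal_prod_minimal) (use assms in \<open>auto intro: ideal_prod_is_ideal ideal_prod.prod\<close>)

lemma (in cring) primeideal_prod_subset:
  assumes "primeideal P R" "ideal I R" "ideal J R" "I \<cdot> J \<subseteq> P"
  shows "I \<subseteq> P \<or> J \<subseteq> P"
proof (rule ccontr)
  assume "\<not> ?thesis"
  then obtain i j where ij: "i \<in> I" "i \<notin> P" "j \<in> J" "j \<notin> P" by blast
  have "i \<otimes> j \<in> P" using ij assms(4) by (blast intro: ideal_prod.prod)
  then show False
    using primeideal.I_prime[OF assms(1)] ij ideal.Icarr[OF assms(2)] ideal.Icarr[OF assms(3)] by blast
qed

lemma primeideal_pow_mem:
  fixes R (structure)
  assumes P: "primeideal P R" and x: "x \<in> carrier R" "x [^] (n::nat) \<in> P"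
  shows "x \<in> P"
proof -
  interpret primeideal P R by fact
  show ?thesis
    using x(2)
  proof (induction n)
    case 0
    then show ?case using one_imp_carrier I_notcarr by simp
  next
    case (Suc n)
    then show ?case using I_prime[of "x [^] n" x] x(1) by auto
  qed
qed

lemma (in cring) ideal_colon_is_ideal:
  assumes "ideal I R" "J \<subseteq> carrier R"
  shows "ideal {y \<in> carrier R. \<forall>x\<in>J. y \<otimes> x \<in> I} R"
proof -
  interpret ideal I R by fact
  show ?thesis
  proof (rule idealI[OF ring_axioms])
    show "subgroup {y \<in> carrier R. \<forall>x\<in>J. y \<otimes> x \<in> I} (add_monoid R)"
    proof (rule add.subgroupI)
      show "{y \<in> carrier R. \<forall>x\<in>J. y \<otimes> x \<in> I} \<noteq> {}" using assms(2) by (auto intro!: exI[of _ \<zero>])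
    qed (use assms(2) in \<open>auto simp: l_distr l_minus subset_iff simp flip: a_inv_def\<close>)
    fix a x assume a: "a \<in> {y \<in> carrier R. \<forall>x\<in>J. y \<otimes> x \<in> I}" and x: "x \<in> carrier R"
    have "(x \<otimes> a) \<otimes> z \<in> I" if "z \<in> J" for z
    proof -
      have "(x \<otimes> a) \<otimes> z = x \<otimes> (a \<otimes> z)" using a x that assms(2) by (auto simp: m_assoc)
      then show ?thesis using a x that I_l_closed by simp
    qed
    then show "x \<otimes> a \<in> {y \<in> carrier R. \<forall>x\<in>J. y \<otimes> x \<in> I}" using a x by simp
    moreover have "a \<otimes> x = x \<otimes> a" using a x by (simp add: m_comm)
    ultimately show "a \<otimes> x \<in> {y \<in> carrier R. \<forall>x\<in>J. y \<otimes> x \<in> I}" by simp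
  qed
qed

lemma (in domain) principal_ideal_prod:
  assumes "a \<in> carrier R" "ideal J R"
  shows "(PIdl a) \<cdot> J = (\<lambda>x. a \<otimes> x) ` J"
proof -
  interpret ideal J R by fact
  show ?thesis
  proof (intro equalityI subsetI)
    fix s assume "s \<in> (PIdl a) \<cdot> J"
    then show "s \<in> (\<lambda>x. a \<otimes> x) ` J"
    proof induction
      case (prod i j)
      then obtain r where r: "r \<in> carrier R" "i = r \<otimes> a" by (auto simp: cgenideal_def)
      have "i \<otimes> j = a \<otimes> (r \<otimes> j)" using r prod(2) assms(1) by (simp add: m_ac)
      then show ?case using r prod(2) I_l_closed by blast
    next
      case (sum s1 s2)
      then obtain x y where "x \<in> J" "y \<in> J" "s1 = a \<otimes> x" "s2 = a \<otimes> y" by blast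
      moreover from this have "s1 \<oplus> s2 = a \<otimes> (x \<oplus> y)" using assms(1) by (simp add: r_distr)
      ultimately show ?case by blast
    qed
  next
    fix s assume "s \<in> (\<lambda>x. a \<otimes> x) ` J"
    then show "s \<in> (PIdl a) \<cdot> J" using cgenideal_self[OF assms(1)] by (auto intro: ideal_prod.prod)
  qed
qed

lemma (in domain) principal_ideal_prod_cancel:
  assumes a: "a \<in> carrier R" "a \<noteq> \<zero>" and I: "ideal I R" and J: "ideal J R"
    and eq: "(PIdl a) \<cdot> I = (PIdl a) \<cdot> J"
  shows "I = J"
proof -
  have "inj_on (\<lambda>x. a \<otimes> x) (carrier R)" by (rule inj_onI) (use a m_lcancel in auto)
  moreover have "I \<subseteq> carrier R" "J \<subseteq> carrier R"
    using ideal.Icarr[OF I] ideal.Icarr[OF J] by auto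
  moreover have "(\<lambda>x. a \<otimes> x) ` I = (\<lambda>x. a \<otimes> x) ` J"
    using eq unfolding principal_ideal_prod[OF a(1) I] principal_ideal_prod[OF a(1) J] .
  ultimately show ?thesis by (simp add: inj_on_image_eq_iff)
qed

lemma (in domain) ideal_prod_nonzero:
  assumes "ideal I R" "ideal J R" "I \<noteq> {\<zero>}" "J \<noteq> {\<zero>}"
  shows "I \<cdot> J \<noteq> {\<zero>}"
proof -
  have "\<exists>x\<in>I. x \<noteq> \<zero>" "\<exists>y\<in>J. y \<noteq> \<zero>"
    using assms additive_subgroup.zero_closed[OF ideal.axioms(1)] by blast+
  then obtain x y where xy: "x \<in> I" "x \<noteq> \<zero>" "y \<in> J" "y \<noteq> \<zero>" by blast
  then have "x \<otimes> y \<noteq> \<zero>" using assms(1,2) by (auto simp: integral_iff ideal.Icarr)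
  then show ?thesis using ideal_prod.prod[OF xy(1,3)] by blast
qed

lemma (in noetherian_domain) noetherian_ring: "noetherian_ring R"
  by (rule noetherian_ring_axioms)

text \<open>
  The part of \<open>I\<close> that is visible at \<open>P\<close>, that is, the contraction to \<open>R\<close> of the extension of
  \<open>I\<close> to the localization at \<open>P\<close>.
\<close>

definition saturation :: "('a, 'b) ring_scheme \<Rightarrow> 'a set \<Rightarrow> 'a set \<Rightarrow> 'a set"
  where "saturation R P I = {y \<in> carrier R. \<exists>s\<in>carrier R - P. s \<otimes>\<^bsub>R\<^esub> y \<in> I}"

section \<open>Saturation at a prime ideal\<close>

context
  fixes R (structure) and P
  assumes P: "primeideal P R"
begin

interpretation primeideal P R by (rule P)

lemma compl_prime_mult_closed:
  "\<lbrakk>s \<in> carrier R - P; t \<in> carrier R - P\<rbrakk> \<Longrightarrow> s \<otimes>\<^bsub>R\<^esub> t \<in> carrier R - P"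
  using I_prime by auto

lemma one_in_compl_prime: "\<one>\<^bsub>R\<^esub> \<in> carrier R - P"
  using one_imp_carrier I_notcarr by auto

lemma saturation_ideal:
  assumes I: "ideal I R"
  shows "ideal (saturation R P I) R"
proof -
  interpret I: ideal I R by fact
  show ?thesis
  proof (rule idealI[OF ring_axioms])
    show "subgroup (saturation R P I) (add_monoid R)"
    proof (rule add.subgroupI)
      have "\<one> \<otimes> \<zero> \<in> I" using I.zero_closed by simp
      then have "\<zero> \<in> saturation R P I" unfolding saturation_def using one_in_compl_prime by blast
      then show "saturation R P I \<noteq> {}" by blast
    next
      fix y assume "y \<in> saturation R P I"
      then obtain s where s: "y \<in> carrier R" "s \<in> carrier R - P" "s \<otimes> y \<in> I"
        by (auto simp: saturation_def)
      then have "s \<otimes> (\<ominus> y) \<in> I" by (simp add: r_minus)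
      then show "\<ominus> y \<in> saturation R P I"
        using s by (auto simp: saturation_def)
    next
      fix y z assume "y \<in> saturation R P I" "z \<in> saturation R P I"
      then obtain s t where st: "y \<in> carrier R" "s \<in> carrier R - P" "s \<otimes> y \<in> I"
        "z \<in> carrier R" "t \<in> carrier R - P" "t \<otimes> z \<in> I"
        by (auto simp: saturation_def)
      have "(s \<otimes> t) \<otimes> (y \<oplus> z) = t \<otimes> (s \<otimes> y) \<oplus> s \<otimes> (t \<otimes> z)"
        using st by (simp add: r_distr m_ac)
      also have "\<dots> \<in> I" using st by (auto intro!: I.a_closed I.I_l_closed)
      finally show "y \<oplus> z \<in> saturation R P I"
        using st compl_prime_mult_closed[of s t] by (auto simp: saturation_def)
    qed (auto simp: saturation_def)
    fix a x assume "a \<in> saturation R P I" and x: "x \<in> carrier R"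
    then obtain s where s: "a \<in> carrier R" "s \<in> carrier R - P" "s \<otimes> a \<in> I"
      by (auto simp: saturation_def)
    have "s \<otimes> (x \<otimes> a) = x \<otimes> (s \<otimes> a)" using s x by (simp add: m_lcomm)
    then have "s \<otimes> (x \<otimes> a) \<in> I" using I.I_l_closed s(3) x by simp
    then show "x \<otimes> a \<in> saturation R P I" using s x by (auto simp: saturation_def)
    then show "a \<otimes> x \<in> saturation R P I" using s x by (simp add: m_comm)
  qed
qed

lemma subset_saturation:
  assumes I: "ideal I R"
  shows "I \<subseteq> saturation R P I"
proof
  fix y assume "y \<in> I"
  then show "y \<in> saturation R P I"
    using one_in_compl_prime ideal.Icarr[OF I] by (force simp: saturation_def)
qed

lemma saturation_subset_prime:
  assumes "I \<subseteq> P"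
  shows "saturation R P I \<subseteq> P"
proof
  fix y assume "y \<in> saturation R P I"
  then obtain s where s: "y \<in> carrier R" "s \<in> carrier R - P" "s \<otimes> y \<in> I"
    by (auto simp: saturation_def)
  then show "y \<in> P" using I_prime[of s y] assms by blast
qed

text \<open>J is finitely generated, and the product of the multipliers of its generators works for
  all of J.\<close>

lemma saturation_finite:
  assumes noeth: "noetherian_ring R" and I: "ideal I R" and J: "ideal J R" "J \<subseteq> saturation R P I"
  obtains s where "s \<in> carrier R - P" "\<And>y. y \<in> J \<Longrightarrow> s \<otimes>\<^bsub>R\<^esub> y \<in> I"
proof -
  obtain A where A: "A \<subseteq> carrier R" "finite A" "J = Idl\<^bsub>R\<^esub> A"
    using noetherian_ring.finetely_gen[OF noeth J(1)] by blast
  have "A \<subseteq> saturation R P I" using A J genideal_self by blast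
  from A(2) this have "\<exists>s\<in>carrier R - P. \<forall>y\<in>A. s \<otimes> y \<in> I"
  proof (induction A)
    case empty
    show ?case using one_in_compl_prime by blast
  next
    case (insert a A)
    then obtain s where s: "s \<in> carrier R - P" "\<And>y. y \<in> A \<Longrightarrow> s \<otimes> y \<in> I" by auto
    obtain t where t: "t \<in> carrier R - P" "t \<otimes> a \<in> I" and a: "a \<in> carrier R"
      using insert.prems by (auto simp: saturation_def)
    have "(s \<otimes> t) \<otimes> y \<in> I" if y: "y \<in> insert a A" for y
    proof -
      have yc: "y \<in> carrier R" using y insert.prems by (auto simp: saturation_def)
      have 1: "(s \<otimes> t) \<otimes> y = s \<otimes> (t \<otimes> y)" "(s \<otimes> t) \<otimes> y = t \<otimes> (s \<otimes> y)"
        using s(1) t(1) yc by (simp_all add: m_ac)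
      show ?thesis
      proof (cases "y = a")
        case True
        then show ?thesis unfolding 1(1) using t s(1) ideal.I_l_closed[OF I] by blast
      next
        case False
        then have "s \<otimes> y \<in> I" using y s(2) by blast
        then show ?thesis unfolding 1(2) using t(1) ideal.I_l_closed[OF I] by blast
      qed
    qed
    then show ?case using compl_prime_mult_closed[OF s(1) t(1)] by blast
  qed
  then obtain s where s: "s \<in> carrier R - P" "\<And>y. y \<in> A \<Longrightarrow> s \<otimes> y \<in> I" by blast
  have "ideal {y \<in> carrier R. \<forall>x\<in>{s}. y \<otimes> x \<in> I} R" by (rule ideal_colon_is_ideal[OF I]) (use s in auto)
  moreover have comm: "y \<otimes> s = s \<otimes> y" if "y \<in> carrier R" for y using that s(1) m_comm by auto
  then have "A \<subseteq> {y \<in> carrier R. \<forall>x\<in>{s}. y \<otimes> x \<in> I}" using s A(1) by auto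
  ultimately have "J \<subseteq> {y \<in> carrier R. \<forall>x\<in>{s}. y \<otimes> x \<in> I}" unfolding A(3) by (rule genideal_minimal)
  then have "s \<otimes> y \<in> I" if "y \<in> J" for y using that comm by auto
  then show thesis using that[OF s(1)] by blast
qed

end

section \<open>Nakayama's lemma and the monoid of non-zero ideals\<close>

context noetherian_domain
begin

text \<open>
  Nakayama, by a maximal \<open>N \<subseteq> I\<close> whose localization at a prime \<open>P \<supseteq> J\<close> is strictly smaller than
  that of \<open>I\<close>: for \<open>x \<in> I - N\<close> the ideal \<open>I J\<close> is locally contained in \<open>N + P x\<close>.
\<close>

lemma ideal_prod_eq_leftD:
  assumes I: "ideal I R" "I \<noteq> {\<zero>}" and J: "ideal J R" and eq: "I \<cdot> J = I"
  shows "J = carrier R"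
proof (rule ccontr)
  assume "J \<noteq> carrier R"
  then obtain P where P: "primeideal P R" "J \<subseteq> P"
    using proper_ideal_in_primeideal[OF noetherian_ring J] by blast
  interpret P: primeideal P R by (rule P(1))
  define S where "S = {N. ideal N R \<and> N \<subseteq> I \<and> \<not> (\<exists>s\<in>carrier R - P. \<forall>y\<in>I. s \<otimes> y \<in> N)}"
  have "{\<zero>} \<in> S"
  proof -
    obtain x where x: "x \<in> I" "x \<noteq> \<zero>"
      using I additive_subgroup.zero_closed[OF ideal.axioms(1)[OF I(1)]] by blast
    have "s \<otimes> x \<noteq> \<zero>" if "s \<in> carrier R - P" for s
      using that x ideal.Icarr[OF I(1)] P.zero_closed by (auto simp: integral_iff)
    then show ?thesis
      using x zeroideal additive_subgroup.zero_closed[OF ideal.axioms(1)[OF I(1)]]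
      by (auto simp: S_def)
  qed
  then have ne: "S \<noteq> {}" by blast
  have Sid: "ideal N R" if "N \<in> S" for N using that by (simp add: S_def)
  obtain N where N: "N \<in> S" and max: "\<And>N'. \<lbrakk>N' \<in> S; N \<subseteq> N'\<rbrakk> \<Longrightarrow> N' = N"
    by (rule noetherian_maximal[OF noetherian_ring ne], erule Sid, rule that)
  have Nid: "ideal N R" "N \<subseteq> I" and Nloc: "\<And>s. s \<in> carrier R - P \<Longrightarrow> \<not> (\<forall>y\<in>I. s \<otimes> y \<in> N)"
    using N by (auto simp: S_def)
  have "N \<noteq> I"
    using Nloc[OF one_in_compl_prime[OF P(1)]] ideal.Icarr[OF I(1)] by auto
  then obtain x where x: "x \<in> I" "x \<notin> N" using Nid(2) by blast
  have xc: "x \<in> carrier R" using x(1) ideal.Icarr[OF I(1)] by blast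
  note ax = subset_add_principal[OF Nid(1) xc]
  have "N <+>\<^bsub>R\<^esub> PIdl x \<noteq> N" using ax(3) x(2) by auto
  then have "N <+>\<^bsub>R\<^esub> PIdl x \<notin> S" using max ax(2) by auto
  moreover have "N <+>\<^bsub>R\<^esub> PIdl x \<subseteq> I"
  proof
    fix y assume "y \<in> N <+>\<^bsub>R\<^esub> PIdl x"
    then obtain i r where "i \<in> N" "r \<in> carrier R" "y = i \<oplus> r \<otimes> x"
      by (rule genideal_insert_mem[OF Nid(1) xc])
    then show "y \<in> I"
      using x(1) Nid(2) I(1) ideal.I_l_closed[OF I(1)]
      by (auto intro!: additive_subgroup.a_closed[OF ideal.axioms(1)])
  qed
  ultimately obtain s where s: "s \<in> carrier R - P" "\<And>y. y \<in> I \<Longrightarrow> s \<otimes> y \<in> N <+>\<^bsub>R\<^esub> PIdl x"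
    using ax(1) by (auto simp: S_def)
  \<comment> \<open>The equation I J = I, with J contained in P, sharpens the inclusion of s I in N
    + R x to one in N + P x.\<close>
  define L where "L = N <+>\<^bsub>R\<^esub> ((PIdl x) \<cdot> P)"
  have Pid: "ideal P R" by (rule P.is_ideal)
  have Lid: "ideal L R" unfolding L_def
    by (intro add_ideals Nid ideal_prod_is_ideal cgenideal_ideal xc Pid)
  have sI: "s \<otimes> y \<in> L" if "y \<in> I" for y
  proof -
    have "I \<cdot> J \<subseteq> {y \<in> carrier R. \<forall>t\<in>{s}. y \<otimes> t \<in> L}"
    proof (rule ideal_prod_minimal)
      show "ideal {y \<in> carrier R. \<forall>t\<in>{s}. y \<otimes> t \<in> L} R"
        by (rule ideal_colon_is_ideal[OF Lid]) (use s in auto)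
      fix i j assume ij: "i \<in> I" "j \<in> J"
      have c: "i \<in> carrier R" "j \<in> carrier R"
        using ij ideal.Icarr[OF I(1)] ideal.Icarr[OF J] by auto
      obtain n r where nr: "n \<in> N" "r \<in> carrier R" "s \<otimes> i = n \<oplus> r \<otimes> x"
        using s(2)[OF ij(1)] by (rule genideal_insert_mem[OF Nid(1) xc])
      have nc: "n \<in> carrier R" using nr ideal.Icarr[OF Nid(1)] by blast
      have "(i \<otimes> j) \<otimes> s = (s \<otimes> i) \<otimes> j" using s(1) c by (simp add: m_ac)
      also have "\<dots> = j \<otimes> n \<oplus> x \<otimes> (r \<otimes> j)"
        unfolding nr(3) using nc nr(2) c xc by (simp add: l_distr r_distr m_ac)
      also have "\<dots> \<in> L"
      proof -
        have "j \<otimes> n \<in> N" using nr(1) c(2) ideal.I_l_closed[OF Nid(1)] by blast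
        moreover have "x \<otimes> (r \<otimes> j) \<in> (PIdl x) \<cdot> P"
          using P.I_l_closed P(2) ij(2) nr(2) principal_ideal_prod[OF xc Pid] by blast
        ultimately show ?thesis unfolding L_def set_add_def' by blast
      qed
      finally show "i \<otimes> j \<in> {y \<in> carrier R. \<forall>t\<in>{s}. y \<otimes> t \<in> L}" using c by simp
    qed
    then have "y \<otimes> s \<in> L" using that eq by auto
    then show ?thesis using s(1) that ideal.Icarr[OF I(1)] by (simp add: m_comm)
  qed
  obtain n q where nq: "n \<in> N" "q \<in> (PIdl x) \<cdot> P" "s \<otimes> x = n \<oplus> q"
    using sI[OF x(1)] unfolding L_def set_add_def' by blast
  obtain p where p: "p \<in> P" "q = x \<otimes> p"
    using nq(2) unfolding principal_ideal_prod[OF xc Pid] by blast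
  have pc: "p \<in> carrier R" and nc: "n \<in> carrier R"
    using p nq ideal.Icarr[OF Nid(1)] P.Icarr by auto
  \<comment> \<open>From s x = n + x p follows that (s - p) x lies in N, with s - p outside P. Since
    s I is contained in N + R x, multiplication by (s - p) s carries I into N, against the choice of
    N.\<close>
  have sp: "s \<ominus> p \<in> carrier R - P"
  proof
    show "s \<ominus> p \<in> carrier R" using s(1) pc by simp
    show "s \<ominus> p \<notin> P"
    proof
      assume "s \<ominus> p \<in> P"
      then have "(s \<ominus> p) \<oplus> p \<in> P" using p(1) by (rule P.a_closed)
      then show False using s(1) pc by (simp add: a_minus_def a_assoc l_neg)
    qed
  qed
  have spx: "(s \<ominus> p) \<otimes> x = n"
  proof -
    have "(s \<ominus> p) \<otimes> x = s \<otimes> x \<ominus> x \<otimes> p"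
      using s(1) pc xc unfolding m_comm[OF xc pc] by (simp add: a_minus_def l_distr l_minus)
    also have "\<dots> = n" unfolding nq(3) p(2) using nc xc pc
      by (simp add: a_minus_def a_assoc r_neg)
    finally show ?thesis .
  qed
  have "\<forall>y\<in>I. ((s \<ominus> p) \<otimes> s) \<otimes> y \<in> N"
  proof
    fix y assume y: "y \<in> I"
    obtain i r where ir: "i \<in> N" "r \<in> carrier R" "s \<otimes> y = i \<oplus> r \<otimes> x"
      using s(2)[OF y] by (rule genideal_insert_mem[OF Nid(1) xc])
    have c: "y \<in> carrier R" "i \<in> carrier R"
      using y ir ideal.Icarr[OF I(1)] ideal.Icarr[OF Nid(1)] by auto
    have "((s \<ominus> p) \<otimes> s) \<otimes> y = (s \<ominus> p) \<otimes> (i \<oplus> r \<otimes> x)"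
      unfolding ir(3)[symmetric] using sp s(1) c by (simp add: m_assoc)
    also have "\<dots> = (s \<ominus> p) \<otimes> i \<oplus> r \<otimes> ((s \<ominus> p) \<otimes> x)"
      using sp c ir(2) xc by (simp add: r_distr m_lcomm)
    also have "\<dots> \<in> N"
      unfolding spx using sp ir nq(1) ideal.I_l_closed[OF Nid(1)]
      by (auto intro!: additive_subgroup.a_closed[OF ideal.axioms(1)[OF Nid(1)]])
    finally show "((s \<ominus> p) \<otimes> s) \<otimes> y \<in> N" .
  qed
  then show False using Nloc[OF compl_prime_mult_closed[OF P(1) sp s(1)]] by blast
qed

lemma ideal_monoid_simps [simp]:
  "carrier (ideal_monoid R) = {I. ideal I R \<and> I \<noteq> {\<zero>}}"
  "\<one>\<^bsub>ideal_monoid R\<^esub> = carrier R"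
  "I \<otimes>\<^bsub>ideal_monoid R\<^esub> J = I \<cdot> J"
  by (simp_all add: ideal_monoid_def)

lemma comm_monoid_ideal_monoid: "comm_monoid (ideal_monoid R)"
proof (rule comm_monoidI)
  show "I \<otimes>\<^bsub>ideal_monoid R\<^esub> J \<in> carrier (ideal_monoid R)"
    if "I \<in> carrier (ideal_monoid R)" "J \<in> carrier (ideal_monoid R)" for I J
    using that ideal_prod_nonzero ideal_prod_is_ideal by simp
  show "\<one>\<^bsub>ideal_monoid R\<^esub> \<in> carrier (ideal_monoid R)"
    using oneideal carrier_one_not_zero by auto
  show "\<one>\<^bsub>ideal_monoid R\<^esub> \<otimes>\<^bsub>ideal_monoid R\<^esub> I = I" if "I \<in> carrier (ideal_monoid R)" for I
    using that ideal_prod_commute[OF oneideal, of I] ideal_prod_one[of I] by simp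
qed (use ideal_prod_assoc ideal_prod_commute in auto)

text \<open>Noetherian induction. In a proper factorization N = I J both factors are strictly larger
  than N, because N = I would give J = R by Nakayama's lemma.\<close>

lemma ideal_is_prod_of_atoms:
  assumes "ideal I R" "I \<noteq> {\<zero>}"
  shows "\<exists>as. set as \<subseteq> atoms (ideal_monoid R) \<and> foldr (\<cdot>) as (carrier R) = I"
proof (rule ccontr)
  interpret M: comm_monoid "ideal_monoid R" by (rule comm_monoid_ideal_monoid)
  let ?ok = "\<lambda>I. \<exists>as. set as \<subseteq> atoms (ideal_monoid R) \<and> foldr (\<cdot>) as (carrier R) = I"
  assume "\<not> ?ok I"
  define S where "S = {I. ideal I R \<and> I \<noteq> {\<zero>} \<and> \<not> ?ok I}"
  have ne: "S \<noteq> {}" using assms \<open>\<not> ?ok I\<close> by (auto simp: S_def)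
  have Sid: "ideal N R" if "N \<in> S" for N using that by (simp add: S_def)
  obtain N where N: "N \<in> S" and max: "\<And>J. \<lbrakk>J \<in> S; N \<subseteq> J\<rbrakk> \<Longrightarrow> J = N"
    by (rule noetherian_maximal[OF noetherian_ring ne], erule Sid, rule that)
  have Nid: "ideal N R" "N \<noteq> {\<zero>}" and bad: "\<not> ?ok N" using N by (simp_all add: S_def)
  have "N \<noteq> carrier R" using bad by (auto dest: spec[of _ "[]"])
  have "N \<notin> atoms (ideal_monoid R)"
  proof
    assume "N \<in> atoms (ideal_monoid R)"
    then have "?ok N" using ideal_prod_one[OF Nid(1)] by (intro exI[of _ "[N]"]) simp
    then show False using bad by blast
  qed
  then obtain I J where IJ: "ideal I R" "I \<noteq> {\<zero>}" "ideal J R" "J \<noteq> {\<zero>}" "N = I \<cdot> J"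
    "I \<noteq> carrier R" "J \<noteq> carrier R"
    using Nid \<open>N \<noteq> carrier R\<close> by (auto simp: atoms_def)
  have "N \<subseteq> I" "N \<subseteq> J" using ideal_prod_inter[OF IJ(1,3)] IJ(5) by auto
  moreover have "N \<noteq> I" using ideal_prod_eq_leftD[of I J] IJ by auto
  moreover have "N \<noteq> J" using ideal_prod_eq_leftD[of J I] IJ ideal_prod_commute[of I J] by auto
  ultimately have "?ok I" "?ok J" using max[of I] max[of J] IJ(1-4) unfolding S_def by blast+
  then obtain as bs where as: "set as \<subseteq> atoms (ideal_monoid R)" "foldr (\<cdot>) as (carrier R) = I"
    and bs: "set bs \<subseteq> atoms (ideal_monoid R)" "foldr (\<cdot>) bs (carrier R) = J" by blast
  have "set cs \<subseteq> atoms (ideal_monoid R) \<Longrightarrow> foldr (\<cdot>) (cs @ bs) (carrier R) = foldr (\<cdot>) cs (carrier R) \<cdot> J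
      \<and> ideal (foldr (\<cdot>) cs (carrier R)) R" for cs
  proof (induction cs)
    case Nil
    then show ?case
      using bs ideal_prod_commute[OF oneideal IJ(3)] ideal_prod_one[OF IJ(3)] oneideal by simp
  next
    case (Cons c cs)
    then have "ideal c R" by (simp add: atoms_def)
    then show ?case using Cons IJ(3) by (simp add: ideal_prod_assoc ideal_prod_is_ideal)
  qed
  from this[OF as(1)] have "foldr (\<cdot>) (as @ bs) (carrier R) = N" using as(2) IJ(5) by simp
  then have "?ok N" using as(1) bs(1) by (intro exI[of _ "as @ bs"]) simp
  then show False using bad by blast
qed

lemma reduced_atomic_ideal_monoid: "reduced_atomic_monoid (ideal_monoid R)"
proof -
  interpret M: comm_monoid "ideal_monoid R" by (rule comm_monoid_ideal_monoid)
  show ?thesis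
  proof
    show "I = \<one>\<^bsub>ideal_monoid R\<^esub>"
      if "I \<in> carrier (ideal_monoid R)" "J \<in> carrier (ideal_monoid R)"
        "I \<otimes>\<^bsub>ideal_monoid R\<^esub> J = \<one>\<^bsub>ideal_monoid R\<^esub>" for I J
      using that ideal_prod_inter[of I J] ideal.Icarr[of I R] by auto
    show "J = \<one>\<^bsub>ideal_monoid R\<^esub>"
      if "I \<in> carrier (ideal_monoid R)" "J \<in> carrier (ideal_monoid R)"
        "I \<otimes>\<^bsub>ideal_monoid R\<^esub> J = I" for I J
      using that ideal_prod_eq_leftD[of I J] by auto
    show "\<exists>as. set as \<subseteq> atoms (ideal_monoid R) \<and>
        foldr (\<otimes>\<^bsub>ideal_monoid R\<^esub>) as \<one>\<^bsub>ideal_monoid R\<^esub> = I"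
      if "I \<in> carrier (ideal_monoid R)" for I
      using ideal_is_prod_of_atoms[of I] that by (simp add: ideal_monoid_def)
  qed
qed

end

section \<open>One-dimensional noetherian domains\<close>

locale one_dim_noetherian_domain = noetherian_domain +
  assumes krull_dim: "krull_dim R = 1"
begin

lemma prime_height_ge:
  assumes "\<forall>i\<le>n. primeideal (C i) R" "\<forall>i<n. C i \<subset> C (Suc i)"
  shows "enat n \<le> prime_height R (C n)"
  unfolding prime_height_def using assms by (intro Sup_upper) blast

lemma prime_height_le:
  assumes "primeideal P R"
  shows "prime_height R P \<le> 1"
proof -
  have "prime_height R P \<le> krull_dim R"
    unfolding krull_dim_def using assms by (intro Sup_upper) blast
  then show ?thesis by (simp add: krull_dim)
qed

lemma primeideal_zero_subset: "primeideal P R \<Longrightarrow> {\<zero>} \<subseteq> P"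
  using additive_subgroup.zero_closed[OF ideal.axioms(1)[OF primeideal.axioms(1)]] by blast

lemma primes_incomparable:
  assumes P: "primeideal P R" "P \<noteq> {\<zero>}" and Q: "primeideal Q R" and sub: "P \<subseteq> Q"
  shows "P = Q"
proof (rule ccontr)
  assume ne: "P \<noteq> Q"
  define C where "C i = (if i = 0 then {\<zero>} else if i = 1 then P else Q)" for i :: nat
  have "enat 2 \<le> prime_height R (C 2)"
  proof (rule prime_height_ge)
    show "\<forall>i\<le>2. primeideal (C i) R" using P Q zeroprimeideal by (auto simp: C_def)
    show "\<forall>i<2. C i \<subset> C (Suc i)"
      using primeideal_zero_subset[OF P(1)] P(2) sub ne by (auto simp: C_def less_2_cases_iff)
  qed
  also have "\<dots> \<le> 1" by (rule prime_height_le) (simp add: C_def Q)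
  finally show False by (simp add: one_enat_def)
qed

lemma height_one_primes_eq: "height_one_primes R = {P. primeideal P R \<and> P \<noteq> {\<zero>}}"
proof (intro equalityI subsetI)
  fix P assume "P \<in> height_one_primes R"
  then have P: "primeideal P R" "prime_height R P = 1" by (auto simp: height_one_primes_def)
  have "P \<noteq> {\<zero>}"
  proof
    assume z: "P = {\<zero>}"
    have "prime_height R P \<le> 0"
      unfolding prime_height_def
    proof (rule Sup_least)
      fix e assume "e \<in> {enat n |n. \<exists>C. (\<forall>i\<le>n. primeideal (C i) R) \<and> (\<forall>i<n. C i \<subset> C (Suc i)) \<and> C n = P}"
      then obtain n C where n: "e = enat n" "\<forall>i\<le>n. primeideal (C i) R"
        "\<forall>i<n. C i \<subset> C (Suc i)" "C n = P" by blast
      have "n = 0"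
      proof (rule ccontr)
        assume "n \<noteq> 0"
        then obtain m where m: "n = Suc m" using not0_implies_Suc by blast
        then have "C m \<subset> {\<zero>}" "primeideal (C m) R" using n z by auto
        then show False using primeideal_zero_subset by blast
      qed
      then show "e \<le> 0" using n(1) by (simp add: zero_enat_def)
    qed
    then show False using P(2) by simp
  qed
  then show "P \<in> {P. primeideal P R \<and> P \<noteq> {\<zero>}}" using P(1) by blast
next
  fix P assume "P \<in> {P. primeideal P R \<and> P \<noteq> {\<zero>}}"
  then have P: "primeideal P R" "P \<noteq> {\<zero>}" by auto
  define C where "C i = (if i = 0 then {\<zero>} else P)" for i :: nat
  have "enat 1 \<le> prime_height R (C 1)"
  proof (rule prime_height_ge)
    show "\<forall>i\<le>1. primeideal (C i) R" using P zeroprimeideal by (auto simp: C_def)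
    show "\<forall>i<1. C i \<subset> C (Suc i)"
      using primeideal_zero_subset[OF P(1)] P(2) by (auto simp: C_def)
  qed
  then have "prime_height R P = 1"
    using prime_height_le[OF P(1)] by (simp add: C_def one_enat_def)
  then show "P \<in> height_one_primes R" using P(1) by (simp add: height_one_primes_def)
qed

text \<open>Dimension one excludes fields. The prime found here guarantees that there is an atom at
  all.\<close>

lemma ex_nonzero_prime: "\<exists>P. primeideal P R \<and> P \<noteq> {\<zero>}"
proof (rule ccontr)
  assume "\<not> ?thesis"
  then have z: "P = {\<zero>}" if "primeideal P R" for P using that by blast
  have le: "prime_height R P \<le> 0" if "primeideal P R" for P
  proof -
    have "prime_height R P \<noteq> 1"
      using height_one_primes_eq that z[OF that] unfolding height_one_primes_def by blast
    then show ?thesis using prime_height_le[OF that]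
      by (metis iless_eSuc0 one_eSuc order_le_less le_zero_eq)
  qed
  have "krull_dim R \<le> 0"
    unfolding krull_dim_def
  proof (rule Sup_least)
    fix e assume "e \<in> prime_height R ` {P. primeideal P R}"
    then show "e \<le> 0" using le by blast
  qed
  then show False by (simp add: krull_dim)
qed

text \<open>An ideal containing I that is maximal among those disjoint from the set of all s x^n
  with s outside P is prime. It is non-zero and lies in P, hence equals P by dimension one; but x
  belongs both to P and to that set.\<close>

lemma nilpotent_mod_saturation:
  assumes P: "primeideal P R" and I: "ideal I R" "I \<noteq> {\<zero>}" and x: "x \<in> P"
  shows "\<exists>n::nat. x [^] n \<in> saturation R P I"
proof (rule ccontr)
  interpret P: primeideal P R by (rule P)
  assume neg: "\<not> ?thesis"
  have xc: "x \<in> carrier R" using x P.Icarr by blast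
  define S where "S = {s \<otimes> x [^] n |s n. s \<in> carrier R - P \<and> n \<in> (UNIV :: nat set)}"
  have SI: "s \<otimes> x [^] n \<in> S" if "s \<in> carrier R - P" for s and n :: nat
    using that by (auto simp: S_def)
  define T where "T = {J. ideal J R \<and> I \<subseteq> J \<and> J \<inter> S = {}}"
  have "I \<inter> S = {}"
  proof (rule ccontr)
    assume "I \<inter> S \<noteq> {}"
    then obtain s n where "s \<in> carrier R - P" "s \<otimes> x [^] (n::nat) \<in> I" by (auto simp: S_def)
    then have "x [^] n \<in> saturation R P I" using xc by (auto simp: saturation_def)
    then show False using neg by blast
  qed
  then have ne: "T \<noteq> {}" using I(1) by (auto simp: T_def)
  have Tid: "ideal N R" if "N \<in> T" for N using that by (simp add: T_def)
  obtain M where M: "M \<in> T" and max: "\<And>J. \<lbrakk>J \<in> T; M \<subseteq> J\<rbrakk> \<Longrightarrow> J = M"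
    by (rule noetherian_maximal[OF noetherian_ring ne], erule Tid, rule that)
  have Mid: "ideal M R" "I \<subseteq> M" and MS: "\<And>y. y \<in> M \<Longrightarrow> y \<notin> S"
    using M by (auto simp: T_def)
  interpret M: ideal M R by (rule Mid(1))
  have one: "\<one> \<in> S" using SI[OF one_in_compl_prime[OF P], of 0] by simp
  have meets: "\<exists>i\<in>M. \<exists>r\<in>carrier R. \<exists>s\<in>carrier R - P. \<exists>n::nat. i \<oplus> r \<otimes> a = s \<otimes> x [^] n"
    if a: "a \<in> carrier R" "a \<notin> M" for a
  proof -
    note ax = subset_add_principal[OF Mid(1) a(1)]
    have "M <+>\<^bsub>R\<^esub> PIdl a \<noteq> M" using ax(3) a(2) by auto
    then have "M <+>\<^bsub>R\<^esub> PIdl a \<notin> T" using max ax(2) by auto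
    then obtain y where y: "y \<in> M <+>\<^bsub>R\<^esub> PIdl a" "y \<in> S"
      using ax(1,2) Mid(2) by (auto simp: T_def)
    obtain i r where ir: "i \<in> M" "r \<in> carrier R" "y = i \<oplus> r \<otimes> a"
      using y(1) by (rule genideal_insert_mem[OF Mid(1) a(1)])
    obtain s n where "s \<in> carrier R - P" "y = s \<otimes> x [^] (n::nat)" using y(2) by (auto simp: S_def)
    with ir show ?thesis by metis
  qed
  have "primeideal M R"
  proof (rule primeidealI)
    show "carrier R \<noteq> M" using one MS by auto
    fix a b assume ab: "a \<in> carrier R" "b \<in> carrier R" "a \<otimes> b \<in> M"
    show "a \<in> M \<or> b \<in> M"
    proof (rule ccontr)
      assume "\<not> ?thesis"
      then obtain i r s n j t u m where
        1: "i \<in> M" "r \<in> carrier R" "s \<in> carrier R - P" "i \<oplus> r \<otimes> a = s \<otimes> x [^] (n::nat)" and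
        2: "j \<in> M" "t \<in> carrier R" "u \<in> carrier R - P" "j \<oplus> t \<otimes> b = u \<otimes> x [^] (m::nat)"
        using meets[OF ab(1)] meets[OF ab(2)] by blast
      have c: "i \<in> carrier R" "j \<in> carrier R" "s \<in> carrier R" "u \<in> carrier R"
        using 1 2 M.Icarr by auto
      have "(s \<otimes> u) \<otimes> x [^] (n + m) = (s \<otimes> x [^] n) \<otimes> (u \<otimes> x [^] m)"
        using c xc by (simp add: nat_pow_mult[symmetric] m_ac)
      also have "\<dots> = i \<otimes> (j \<oplus> t \<otimes> b) \<oplus> ((r \<otimes> a) \<otimes> j \<oplus> (r \<otimes> t) \<otimes> (a \<otimes> b))"
        unfolding 1(4)[symmetric] 2(4)[symmetric]
        using c 1(2) 2(2) ab by (simp add: l_distr r_distr m_ac a_ac)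
      also have "\<dots> \<in> M"
        using c 1(2) 2(2) ab by (intro M.a_closed M.I_r_closed[OF 1(1)] M.I_l_closed[OF 2(1)]
            M.I_l_closed[OF ab(3)] a_closed m_closed)
      finally show False using MS SI[OF compl_prime_mult_closed[OF P 1(3) 2(3)]] by blast
    qed
  qed (use Mid is_cring in auto)
  moreover have "M \<noteq> {\<zero>}" using I Mid(2) additive_subgroup.zero_closed[OF ideal.axioms(1)[OF I(1)]] by blast
  moreover have "M \<subseteq> P"
  proof
    fix y assume y: "y \<in> M"
    then have "y \<in> carrier R" by (rule M.Icarr)
    then show "y \<in> P" using SI[of y 0] MS[OF y] by auto
  qed
  ultimately have "M = P" using primes_incomparable P by blast
  moreover have "x \<in> S" using SI[OF one_in_compl_prime[OF P], of 1] xc by simp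
  ultimately show False using MS x by blast
qed

text \<open>A prime ideal over L contains P, hence equals P, and so cannot contain s. Therefore 1 =
  l + r s with l in L, and y = l y + r (s y).\<close>

lemma locally_nilpotent_cancel:
  assumes P: "primeideal P R" "P \<noteq> {\<zero>}" and L: "ideal L R" "\<And>x. x \<in> P \<Longrightarrow> \<exists>n::nat. x [^] n \<in> L"
    and s: "s \<in> carrier R - P" and y: "y \<in> carrier R" "s \<otimes> y \<in> L"
  shows "y \<in> L"
proof -
  interpret L: ideal L R by (rule L(1))
  have sc: "s \<in> carrier R" using s by blast
  note ax = subset_add_principal[OF L(1) sc]
  have "L <+>\<^bsub>R\<^esub> PIdl s = carrier R"
  proof (rule ccontr)
    assume "L <+>\<^bsub>R\<^esub> PIdl s \<noteq> carrier R"
    then obtain M where M: "primeideal M R" "L <+>\<^bsub>R\<^esub> PIdl s \<subseteq> M"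
      using proper_ideal_in_primeideal[OF noetherian_ring ax(1)] by blast
    have "P \<subseteq> M"
    proof
      fix x assume x: "x \<in> P"
      then obtain n where "x [^] (n::nat) \<in> L" using L(2) by blast
      then show "x \<in> M"
        using primeideal_pow_mem[OF M(1), of x n] x M(2) ax(2)
          ideal.Icarr[OF primeideal.axioms(1)[OF P(1)]] by blast
    qed
    then have "P = M" using primes_incomparable P M(1) by blast
    then show False using M(2) ax(3) s by blast
  qed
  then have "\<one> \<in> L <+>\<^bsub>R\<^esub> PIdl s" by simp
  then obtain l r where lr: "l \<in> L" "r \<in> carrier R" "\<one> = l \<oplus> r \<otimes> s"
    by (rule genideal_insert_mem[OF L(1) sc])
  have lc: "l \<in> carrier R" using lr(1) by (rule L.Icarr)
  have "y = (l \<oplus> r \<otimes> s) \<otimes> y" unfolding lr(3)[symmetric] using y(1) by simp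
  also have "\<dots> = l \<otimes> y \<oplus> r \<otimes> (s \<otimes> y)" using lc lr(2) sc y(1) by (simp add: l_distr m_assoc)
  also have "\<dots> \<in> L" using L.I_r_closed[OF lr(1) y(1)] L.I_l_closed[OF y(2) lr(2)] by (rule L.a_closed)
  finally show ?thesis .
qed

text \<open>In dimension one the condition on products is automatic for such Q: a factor outside P
  is cancelled by \<open>locally_nilpotent_cancel\<close>.\<close>

lemma primary_at_iff:
  assumes P: "primeideal P R" "P \<noteq> {\<zero>}"
  shows "primary_ideal Q R \<and> ideal_radical R Q = P \<longleftrightarrow>
    ideal Q R \<and> Q \<subseteq> P \<and> (\<forall>x\<in>P. \<exists>n::nat. x [^] n \<in> Q)"
proof (intro iffI; elim conjE)
  interpret P: primeideal P R by (rule P(1))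
  {
    assume Q: "primary_ideal Q R" "ideal_radical R Q = P"
    have id: "ideal Q R" using Q(1) by (simp add: primary_ideal_def)
    have "x \<in> P" if "x \<in> Q" for x
    proof -
      have xc: "x \<in> carrier R" using that by (rule ideal.Icarr[OF id])
      then have "x [^] (1::nat) \<in> Q" using that by simp
      then show ?thesis using xc Q(2) unfolding ideal_radical_def by blast
    qed
    then show "ideal Q R \<and> Q \<subseteq> P \<and> (\<forall>x\<in>P. \<exists>n::nat. x [^] n \<in> Q)"
      using id Q(2) by (auto simp: ideal_radical_def)
  }
  {
    assume Q: "ideal Q R" "Q \<subseteq> P" "\<forall>x\<in>P. \<exists>n::nat. x [^] n \<in> Q"
    have rad: "ideal_radical R Q = P"
    proof (intro equalityI subsetI)
      fix x assume "x \<in> ideal_radical R Q"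
      then show "x \<in> P"
        using primeideal_pow_mem[OF P(1)] Q(2) unfolding ideal_radical_def by blast
    qed (use Q(3) P.Icarr in \<open>auto simp: ideal_radical_def\<close>)
    have "a \<in> Q" if "a \<in> carrier R" "b \<in> carrier R" "a \<otimes> b \<in> Q" "b \<notin> P" for a b
      using locally_nilpotent_cancel[OF P Q(1), of b a] that Q(3) m_comm[of a b] by auto
    then show "primary_ideal Q R \<and> ideal_radical R Q = P"
      using Q P.I_notcarr P.Icarr rad unfolding primary_ideal_def by blast
  }
qed

text \<open>The P-primary component is split off. Let Q be the saturation and J = (I : Q). As Q is
  finitely generated, J contains an element outside P, whereas Q contains a power of each element of
  P. Hence Q and J are comaximal, and Q J, being their intersection, contains I.\<close>

lemma factor_off_saturation:
  assumes P: "primeideal P R" and I: "ideal I R" "I \<noteq> {\<zero>}" "I \<subseteq> P"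
  obtains J where "ideal J R" "I = saturation R P I \<cdot> J" "\<not> J \<subseteq> P"
proof -
  interpret P: primeideal P R by (rule P)
  define Q where "Q = saturation R P I"
  have Q: "ideal Q R" "I \<subseteq> Q" "Q \<subseteq> P"
    unfolding Q_def using saturation_ideal[OF P I(1)] subset_saturation[OF P I(1)]
      saturation_subset_prime[OF P I(3)] by auto
  have P0: "P \<noteq> {\<zero>}" using I additive_subgroup.zero_closed[OF ideal.axioms(1)[OF I(1)]] by blast
  have Qc: "Q \<subseteq> carrier R" using ideal.Icarr[OF Q(1)] by blast
  define J where "J = {y \<in> carrier R. \<forall>x\<in>Q. y \<otimes> x \<in> I}"
  have J: "ideal J R" unfolding J_def by (rule ideal_colon_is_ideal[OF I(1) Qc])
  have QJ: "Q \<cdot> J \<subseteq> I"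
  proof (rule ideal_prod_minimal[OF I(1)])
    fix i j assume "i \<in> Q" "j \<in> J"
    then have "j \<otimes> i \<in> I" "i \<otimes> j = j \<otimes> i" using Qc by (auto simp: J_def m_comm)
    then show "i \<otimes> j \<in> I" by simp
  qed
  obtain s where s: "s \<in> carrier R - P" "\<And>y. y \<in> Q \<Longrightarrow> s \<otimes> y \<in> I"
    using saturation_finite[OF P noetherian_ring I(1) Q(1)] unfolding Q_def by blast
  have sJ: "s \<in> J" using s by (simp add: J_def)
  have IJ: "I \<subseteq> J"
    using ideal.Icarr[OF I(1)] ideal.I_r_closed[OF I(1)] Qc by (auto simp: J_def)
  have "Q <+>\<^bsub>R\<^esub> J = carrier R"
  proof (rule ccontr)
    assume ne: "Q <+>\<^bsub>R\<^esub> J \<noteq> carrier R"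
    obtain M where M: "primeideal M R" "Q <+>\<^bsub>R\<^esub> J \<subseteq> M"
      using proper_ideal_in_primeideal[OF noetherian_ring add_ideals[OF Q(1) J] ne] by blast
    have sub: "Q \<subseteq> M" "J \<subseteq> M"
    proof -
      have z: "\<zero> \<in> Q" "\<zero> \<in> J"
        using Q(1) J by (simp_all add: additive_subgroup.zero_closed ideal.axioms(1))
      have "x \<in> Q <+>\<^bsub>R\<^esub> J" if "x \<in> Q" for x
        using that z Qc unfolding set_add_def' by force
      then show "Q \<subseteq> M" using M(2) by blast
      have "x \<in> Q <+>\<^bsub>R\<^esub> J" if "x \<in> J" for x
        using that z ideal.Icarr[OF J that] unfolding set_add_def' by force
      then show "J \<subseteq> M" using M(2) by blast
    qed
    have "P \<subseteq> M"
    proof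
      fix x assume x: "x \<in> P"
      then obtain n where "x [^] (n::nat) \<in> Q"
        using nilpotent_mod_saturation[OF P I(1,2)] unfolding Q_def by blast
      then show "x \<in> M" using primeideal_pow_mem[OF M(1)] sub(1) P.Icarr[OF x] by blast
    qed
    then have "P = M" using primes_incomparable P P0 M(1) by blast
    then show False using sub(2) sJ s(1) by blast
  qed
  then have "Q \<cdot> J = Q \<inter> J" by (rule ideal_prod_eq_inter[OF Q(1) J])
  then have "I = Q \<cdot> J" using QJ Q(2) IJ by blast
  then show thesis using that[of J] J sJ s(1) unfolding Q_def by blast
qed

section \<open>Atoms of the ideal monoid in dimension one\<close>

lemma atom_idealD:
  assumes "Q \<in> atoms (ideal_monoid R)"
  shows "ideal Q R" "Q \<noteq> {\<zero>}" "Q \<noteq> carrier R"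
    "\<And>I J. \<lbrakk>ideal I R; ideal J R; Q = I \<cdot> J\<rbrakk> \<Longrightarrow> I = carrier R \<or> J = carrier R"
proof -
  show Q: "ideal Q R" "Q \<noteq> {\<zero>}" "Q \<noteq> carrier R" using assms by (auto simp: atoms_def)
  fix I J assume IJ: "ideal I R" "ideal J R" "Q = I \<cdot> J"
  have "I \<noteq> {\<zero>}"
    using IJ Q(2) ideal_prod_zero[OF IJ(2)] ideal_prod_commute[OF IJ(1,2)] by auto
  moreover have "J \<noteq> {\<zero>}" using IJ Q(2) ideal_prod_zero[OF IJ(1)] by auto
  ultimately show "I = carrier R \<or> J = carrier R" using IJ assms by (auto simp: atoms_def)
qed

text \<open>When the saturation at P is split off from Q, the other factor must be R because the
  saturation lies in P. So Q is its own saturation.\<close>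

lemma atom_is_primary:
  assumes Q: "Q \<in> atoms (ideal_monoid R)" and P: "primeideal P R" "Q \<subseteq> P"
  shows "P \<noteq> {\<zero>}" "primary_ideal Q R \<and> ideal_radical R Q = P"
proof -
  interpret P: primeideal P R by (rule P(1))
  note Qd = atom_idealD[OF Q]
  show P0: "P \<noteq> {\<zero>}"
    using Qd(1,2) P(2) additive_subgroup.zero_closed[OF ideal.axioms(1)[OF Qd(1)]] by blast
  obtain J where J: "ideal J R" "Q = saturation R P Q \<cdot> J" "\<not> J \<subseteq> P"
    by (rule factor_off_saturation[OF P(1) Qd(1,2) P(2)])
  have sat: "ideal (saturation R P Q) R" "saturation R P Q \<subseteq> P"
    using saturation_ideal[OF P(1) Qd(1)] saturation_subset_prime[OF P(1,2)] by auto
  have "saturation R P Q \<noteq> carrier R" using sat(2) P.I_notcarr P.Icarr by blast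
  then have "J = carrier R" using Qd(4)[OF sat(1) J(1,2)] by blast
  then have "Q = saturation R P Q" using J(2) ideal_prod_one[OF sat(1)] by simp
  then show "primary_ideal Q R \<and> ideal_radical R Q = P"
    using primary_at_iff[OF P(1) P0] nilpotent_mod_saturation[OF P(1) Qd(1,2)] Qd(1) P(2) by auto
qed

lemma atom_subset_prime:
  assumes "Q \<in> atoms (ideal_monoid R)"
  obtains P where "primeideal P R" "Q \<subseteq> P"
  using proper_ideal_in_primeideal[OF noetherian_ring atom_idealD(1,3)[OF assms]] by blast

lemma ideal_list_prod_subset_prime:
  assumes "set as \<subseteq> atoms (ideal_monoid R)" "primeideal P R" "foldr (\<cdot>) as (carrier R) \<subseteq> P"
  shows "\<exists>Q\<in>set as. Q \<subseteq> P"
proof -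
  have "ideal (foldr (\<cdot>) as (carrier R)) R \<and> (foldr (\<cdot>) as (carrier R) \<subseteq> P \<longrightarrow> (\<exists>Q\<in>set as. Q \<subseteq> P))"
    using assms(1)
  proof (induction as)
    case Nil
    then show ?case
      using oneideal primeideal.I_notcarr[OF assms(2)] ideal.Icarr[OF primeideal.axioms(1)[OF assms(2)]]
      by auto
  next
    case (Cons a as)
    then have a: "ideal a R" and IH: "ideal (foldr (\<cdot>) as (carrier R)) R"
      "foldr (\<cdot>) as (carrier R) \<subseteq> P \<longrightarrow> (\<exists>Q\<in>set as. Q \<subseteq> P)"
      using atom_idealD(1) by auto
    show ?case
      using primeideal_prod_subset[OF assms(2) a IH(1)] IH(2) ideal_prod_is_ideal[OF a IH(1)] by auto
  qed
  then show ?thesis using assms(3) by blast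
qed

text \<open>Every such prime is the radical of some atom in one fixed factorization of I.\<close>

lemma finite_primes_over:
  assumes "ideal I R" "I \<noteq> {\<zero>}"
  shows "finite {P. primeideal P R \<and> I \<subseteq> P}"
proof -
  obtain as where as: "set as \<subseteq> atoms (ideal_monoid R)" "foldr (\<cdot>) as (carrier R) = I"
    using ideal_is_prod_of_atoms[OF assms] by blast
  have "{P. primeideal P R \<and> I \<subseteq> P} \<subseteq> ideal_radical R ` set as"
  proof
    fix P assume "P \<in> {P. primeideal P R \<and> I \<subseteq> P}"
    then have P: "primeideal P R" "I \<subseteq> P" by auto
    then obtain Q where Q: "Q \<in> set as" "Q \<subseteq> P"
      using ideal_list_prod_subset_prime[OF as(1)] as(2) by blast
    then have "ideal_radical R Q = P" using atom_is_primary[of Q P] P(1) as(1) by blast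
    then show "P \<in> ideal_radical R ` set as" using Q(1) by blast
  qed
  then show ?thesis by (rule finite_subset) simp
qed

text \<open>I' is a^-1 J I, that is P^-1 I, described without fractions.\<close>

lemma invertible_ideal_divides:
  assumes a: "a \<in> carrier R" "a \<noteq> \<zero>" and P: "ideal P R" and J: "ideal J R" and PJ: "P \<cdot> J = PIdl a"
    and I: "ideal I R" "I \<subseteq> P"
  obtains I' where "ideal I' R" "I = P \<cdot> I'"
proof -
  note JI = ideal_prod_is_ideal[OF J I(1)]
  define I' where "I' = {y \<in> carrier R. \<forall>x\<in>{a}. y \<otimes> x \<in> J \<cdot> I}"
  have I': "ideal I' R" unfolding I'_def by (rule ideal_colon_is_ideal[OF JI]) (use a in simp)
  have "(PIdl a) \<cdot> I' = J \<cdot> I"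
    unfolding principal_ideal_prod[OF a(1) I']
  proof (intro equalityI subsetI)
    fix x assume "x \<in> (\<lambda>x. a \<otimes> x) ` I'"
    then show "x \<in> J \<cdot> I" using a(1) by (auto simp: I'_def m_comm)
  next
    fix x assume x: "x \<in> J \<cdot> I"
    have "J \<cdot> I \<subseteq> PIdl a"
      using ideal_prod_mono[OF J P order_refl I(2)] ideal_prod_commute[OF J P] PJ by simp
    then obtain r where r: "r \<in> carrier R" "x = r \<otimes> a" using x by (auto simp: cgenideal_def)
    then have "r \<in> I'" using x by (simp add: I'_def)
    then show "x \<in> (\<lambda>x. a \<otimes> x) ` I'" using r a(1) m_comm by blast
  qed
  then have "(PIdl a) \<cdot> (P \<cdot> I') = P \<cdot> (J \<cdot> I)"
    using ideal_prod_assoc[OF cgenideal_ideal[OF a(1)] P I'] ideal_prod_assoc[OF P cgenideal_ideal[OF a(1)] I']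
      ideal_prod_commute[OF cgenideal_ideal[OF a(1)] P] by simp
  also have "\<dots> = (PIdl a) \<cdot> I" using ideal_prod_assoc[OF P J I(1)] PJ by simp
  finally have "P \<cdot> I' = I"
    by (rule principal_ideal_prod_cancel[OF a ideal_prod_is_ideal[OF P I'] I(1)])
  then show thesis using that I' by blast
qed

lemma invertible_ideal_cancel:
  assumes a: "a \<in> carrier R" "a \<noteq> \<zero>" and P: "ideal P R" and J: "ideal J R" and PJ: "P \<cdot> J = PIdl a"
    and I: "ideal I R" "ideal I' R" "P \<cdot> I = P \<cdot> I'"
  shows "I = I'"
proof (rule principal_ideal_prod_cancel[OF a I(1,2)])
  have "(PIdl a) \<cdot> A = J \<cdot> (P \<cdot> A)" if "ideal A R" for A
    using ideal_prod_assoc[OF J P that] PJ ideal_prod_commute[OF P J] by simp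
  then show "(PIdl a) \<cdot> I = (PIdl a) \<cdot> I'" using I by simp
qed

theorem structure_theorem_if_almost_all_primes_invertible:
  assumes fin: "finite \<P>"
    and finQ: "\<And>P. P \<in> \<P> \<Longrightarrow> finite {Q \<in> atoms (ideal_monoid R). primary_ideal Q R \<and> ideal_radical R Q = P}"
    and inv: "\<And>P. \<lbrakk>primeideal P R; P \<noteq> {\<zero>}; P \<notin> \<P>\<rbrakk> \<Longrightarrow>
      \<exists>a J. a \<in> carrier R \<and> a \<noteq> \<zero> \<and> ideal J R \<and> P \<cdot> J = PIdl a"
  shows "structure_theorem_for_unions (system_of_lengths (ideal_monoid R))"
proof -
  let ?H = "ideal_monoid R"
  interpret H: reduced_atomic_monoid ?H by (rule reduced_atomic_ideal_monoid)
  define A where "A = (\<Union>P\<in>\<P>. {Q \<in> atoms ?H. primary_ideal Q R \<and> ideal_radical R Q = P})"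
  define B where "B = atoms ?H - A"
  \<comment> \<open>An atom outside A lies in an invertible prime P, which therefore divides it;
    being an atom, it equals P.\<close>
  have B: "primeideal b R \<and> (\<exists>a J. a \<in> carrier R \<and> a \<noteq> \<zero> \<and> ideal J R \<and> b \<cdot> J = PIdl a)"
    if b: "b \<in> B" for b
  proof -
    have at: "b \<in> atoms ?H" using b by (simp add: B_def)
    obtain P where P: "primeideal P R" "b \<subseteq> P" by (rule atom_subset_prime[OF at])
    note prim = atom_is_primary[OF at P]
    have "P \<notin> \<P>" using prim(2) b at by (auto simp: A_def B_def)
    then obtain a J where aJ: "a \<in> carrier R" "a \<noteq> \<zero>" "ideal J R" "P \<cdot> J = PIdl a"
      using inv[OF P(1) prim(1)] by blast
    have Pid: "ideal P R" by (rule primeideal.axioms(1)[OF P(1)])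
    obtain I' where I': "ideal I' R" "b = P \<cdot> I'"
      by (rule invertible_ideal_divides[OF aJ(1,2) Pid aJ(3,4) atom_idealD(1)[OF at] P(2)])
    have "P \<noteq> carrier R" using primeideal.I_notcarr[OF P(1)] by blast
    then have "I' = carrier R" using atom_idealD(4)[OF at Pid I'] by blast
    then have "b = P" using I'(2) ideal_prod_one[OF Pid] by simp
    then show ?thesis using P(1) aJ by blast
  qed
  show ?thesis
  proof (rule H.structure_theorem_if_almost_all_atoms_prime[of A B])
    show "atoms ?H = A \<union> B" "A \<inter> B = {}" by (auto simp: A_def B_def)
    show "finite A" unfolding A_def using fin finQ by blast
    show "atoms ?H \<noteq> {}"
    proof -
      obtain P where P: "primeideal P R" "P \<noteq> {\<zero>}" using ex_nonzero_prime by blast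
      obtain as where as: "set as \<subseteq> atoms ?H" "foldr (\<cdot>) as (carrier R) = P"
        using ideal_is_prod_of_atoms[OF primeideal.axioms(1)[OF P(1)] P(2)] by blast
      then show ?thesis using ideal_list_prod_subset_prime[OF as(1) P(1)] by auto
    qed
  next
    fix b x y assume *: "b \<in> B" "x \<in> carrier ?H" "y \<in> carrier ?H" "b \<otimes>\<^bsub>?H\<^esub> x = b \<otimes>\<^bsub>?H\<^esub> y"
    obtain a J where aJ: "primeideal b R" "a \<in> carrier R" "a \<noteq> \<zero>" "ideal J R" "b \<cdot> J = PIdl a"
      using B[OF *(1)] by blast
    show "x = y"
      using invertible_ideal_cancel[OF aJ(2,3) primeideal.axioms(1)[OF aJ(1)] aJ(4,5), of x y] * by simp
  next
    fix b x y c assume *: "b \<in> B" "x \<in> carrier ?H" "y \<in> carrier ?H" "c \<in> carrier ?H"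
      "x \<otimes>\<^bsub>?H\<^esub> y = b \<otimes>\<^bsub>?H\<^esub> c"
    obtain a J where aJ: "primeideal b R" "a \<in> carrier R" "a \<noteq> \<zero>" "ideal J R" "b \<cdot> J = PIdl a"
      using B[OF *(1)] by blast
    have bid: "ideal b R" by (rule primeideal.axioms(1)[OF aJ(1)])
    have "x \<cdot> y \<subseteq> b" using * ideal_prod_inter[OF bid, of c] by auto
    then have "x \<subseteq> b \<or> y \<subseteq> b" using primeideal_prod_subset[OF aJ(1), of x y] * by simp
    moreover have "\<exists>c'\<in>carrier ?H. z = b \<otimes>\<^bsub>?H\<^esub> c'" if z: "z \<in> carrier ?H" "z \<subseteq> b" for z
    proof -
      have zid: "ideal z R" "z \<noteq> {\<zero>}" using z(1) by auto
      obtain c' where c': "ideal c' R" "z = b \<cdot> c'"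
        by (rule invertible_ideal_divides[OF aJ(2,3) bid aJ(4,5) zid(1) z(2)])
      moreover have "c' \<noteq> {\<zero>}" using c'(2) zid(2) ideal_prod_zero[OF bid] by auto
      ultimately show ?thesis by auto
    qed
    ultimately show "(\<exists>c'\<in>carrier ?H. x = b \<otimes>\<^bsub>?H\<^esub> c') \<or> (\<exists>c'\<in>carrier ?H. y = b \<otimes>\<^bsub>?H\<^esub> c')"
      using *(2,3) by blast
  qed
qed

section \<open>Cohen-Kaplansky domains\<close>

text \<open>Locally at \<open>P\<close> the atom \<open>Q\<close> is divisible by \<open>a\<close>, hence associated to it.\<close>

lemma atom_contains_if_locally_divisible:
  assumes P: "primeideal P R" and Q: "Q \<in> atoms (ideal_monoid R)" "Q \<subseteq> P"
    and a: "a \<in> P" "a \<noteq> \<zero>" and sub: "Q \<subseteq> saturation R P (PIdl a)"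
  shows "a \<in> Q"
proof -
  interpret P: primeideal P R by (rule P)
  note Qd = atom_idealD[OF Q(1)]
  have P0: "P \<noteq> {\<zero>}" by (rule atom_is_primary(1)[OF Q(1) P Q(2)])
  have Qnil: "\<exists>n::nat. x [^] n \<in> Q" if "x \<in> P" for x
    using atom_is_primary(2)[OF Q(1) P Q(2)] primary_at_iff[OF P P0] that by blast
  have ac: "a \<in> carrier R" using a(1) by (rule P.Icarr)
  have pid: "ideal (PIdl a) R" by (rule cgenideal_ideal[OF ac])
  have pid0: "PIdl a \<noteq> {\<zero>}" using cgenideal_self[OF ac] a(2) by auto
  \<comment> \<open>S is the ideal generated by a locally at P, contracted to R, and J below is (Q :
    a). Locally Q = a J; the equality Q = S J then holds in R because both sides contain a power of
    every element of P. As S is proper, J = R.\<close>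
  define S where "S = saturation R P (PIdl a)"
  have S: "ideal S R" unfolding S_def by (rule saturation_ideal[OF P pid])
  have SP: "S \<subseteq> P" unfolding S_def
    by (rule saturation_subset_prime[OF P]) (rule cgenideal_minimal[OF P.is_ideal a(1)])
  define J where "J = {y \<in> carrier R. \<forall>x\<in>{a}. y \<otimes> x \<in> Q}"
  have J: "ideal J R" unfolding J_def by (rule ideal_colon_is_ideal[OF Qd(1)]) (use ac in simp)
  have QJ: "Q \<subseteq> J" using ideal.I_r_closed[OF Qd(1)] ac ideal.Icarr[OF Qd(1)] by (auto simp: J_def)
  have "S \<cdot> J \<subseteq> Q"
  proof (rule ideal_prod_minimal[OF Qd(1)])
    fix y j assume yj: "y \<in> S" "j \<in> J"
    then obtain s r where s: "y \<in> carrier R" "s \<in> carrier R - P" "r \<in> carrier R" "s \<otimes> y = r \<otimes> a"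
      by (auto simp: S_def saturation_def cgenideal_def)
    have jc: "j \<in> carrier R" and ja: "j \<otimes> a \<in> Q" using yj by (auto simp: J_def)
    have "s \<otimes> (y \<otimes> j) = (s \<otimes> y) \<otimes> j" using s(1,2) jc by (simp add: m_assoc)
    also have "\<dots> = r \<otimes> (j \<otimes> a)" unfolding s(4) using s(3) ac jc by (simp add: m_ac)
    also have "\<dots> \<in> Q" using ja s(3) by (rule ideal.I_l_closed[OF Qd(1)])
    finally show "y \<otimes> j \<in> Q"
      using locally_nilpotent_cancel[OF P P0 Qd(1) Qnil s(2)] s(1) jc by simp
  qed
  moreover have "Q \<subseteq> S \<cdot> J"
  proof
    fix x assume x: "x \<in> Q"
    have xc: "x \<in> carrier R" using x by (rule ideal.Icarr[OF Qd(1)])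
    obtain s r where s: "s \<in> carrier R - P" "r \<in> carrier R" "s \<otimes> x = r \<otimes> a"
      using sub x by (auto simp: saturation_def cgenideal_def)
    have "r \<in> J" using s x ideal.I_l_closed[OF Qd(1) x] by (auto simp: J_def s(3)[symmetric])
    moreover have aS: "a \<in> S" unfolding S_def using subset_saturation[OF P pid] cgenideal_self[OF ac] by blast
    ultimately have "a \<otimes> r \<in> S \<cdot> J" by (intro ideal_prod.prod)
    then have sx: "s \<otimes> x \<in> S \<cdot> J" unfolding s(3) using m_comm[OF ac s(2)] by simp
    show "x \<in> S \<cdot> J"
    proof (rule locally_nilpotent_cancel[OF P P0 ideal_prod_is_ideal[OF S J] _ s(1) xc sx])
      fix p assume p: "p \<in> P"
      have pc: "p \<in> carrier R" using p by (rule P.Icarr)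
      obtain n where n: "p [^] (n::nat) \<in> S"
        using nilpotent_mod_saturation[OF P pid pid0 p] unfolding S_def by blast
      obtain m where m: "p [^] (m::nat) \<in> J" using Qnil[OF p] QJ by blast
      have "p [^] (n + m) \<in> S \<cdot> J"
        using ideal_prod.prod[OF n m, of R] pc by (simp add: nat_pow_mult)
      then show "\<exists>n::nat. p [^] n \<in> S \<cdot> J" by blast
    qed
  qed
  ultimately have "Q = S \<cdot> J" by blast
  moreover have "S \<noteq> carrier R" using SP P.I_notcarr P.Icarr by blast
  ultimately have "J = carrier R" using Qd(4)[OF S J] by blast
  then have "\<one> \<in> J" by simp
  then show ?thesis using ac by (simp add: J_def)
qed

text \<open>A long word contains either many copies of a or a long subword without a.\<close>

lemma long_monomials_in_ideal:
  assumes "finite A" "A \<subseteq> carrier R" and I: "ideal I R" and "\<And>a. a \<in> A \<Longrightarrow> \<exists>n::nat. a [^] n \<in> I"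
  shows "\<exists>N. \<forall>as. set as \<subseteq> A \<and> length as \<ge> N \<longrightarrow> foldr (\<otimes>) as \<one> \<in> I"
  using assms(1,2,4)
proof (induction A)
  case empty
  show ?case by (rule exI[of _ 1]) auto
next
  case (insert a A)
  obtain N where N: "\<And>as. \<lbrakk>set as \<subseteq> A; length as \<ge> N\<rbrakk> \<Longrightarrow> foldr (\<otimes>) as \<one> \<in> I"
    using insert by (metis insertI2 insert_subset)
  obtain n where n: "a [^] (n::nat) \<in> I" using insert.prems by blast
  have ac: "a \<in> carrier R" and Ac: "A \<subseteq> carrier R" using insert.prems by auto
  have closed: "foldr (\<otimes>) as \<one> \<in> carrier R" if "set as \<subseteq> carrier R" for as
    using that by (induction as) auto
  have split: "foldr (\<otimes>) as \<one> = a [^] length (filter ((=) a) as) \<otimes> foldr (\<otimes>) (filter (\<lambda>x. x \<noteq> a) as) \<one>"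
    if "set as \<subseteq> insert a A" for as
    using that
  proof (induction as)
    case (Cons b bs)
    have c: "foldr (\<otimes>) (filter (\<lambda>x. x \<noteq> a) bs) \<one> \<in> carrier R"
      by (rule closed) (use Cons.prems Ac in auto)
    have "b \<in> carrier R" using Cons.prems ac Ac by auto
    then show ?case using Cons c ac by (auto simp: m_ac)
  qed simp
  show ?case
  proof (intro exI[of _ "N + n"] allI impI; elim conjE)
    fix as assume as: "set as \<subseteq> insert a A" "N + n \<le> length as"
    define bs where "bs = filter (\<lambda>x. x \<noteq> a) as"
    define k where "k = length (filter ((=) a) as)"
    have bs: "set bs \<subseteq> A" using as(1) by (auto simp: bs_def)
    have len: "length as = k + length bs"
      unfolding k_def bs_def using sum_length_filter_compl[of "(=) a" as] by (simp add: eq_commute)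
    have eq: "foldr (\<otimes>) as \<one> = a [^] k \<otimes> foldr (\<otimes>) bs \<one>"
      unfolding k_def bs_def by (rule split[OF as(1)])
    have bc: "foldr (\<otimes>) bs \<one> \<in> carrier R" by (rule closed) (use bs Ac in auto)
    show "foldr (\<otimes>) as \<one> \<in> I"
    proof (cases "n \<le> k")
      case True
      then have "a [^] k = a [^] n \<otimes> a [^] (k - n)" using ac by (simp add: nat_pow_mult)
      then have "a [^] k \<in> I" using n ac ideal.I_r_closed[OF I] by simp
      then show ?thesis unfolding eq using bc by (rule ideal.I_r_closed[OF I])
    next
      case False
      then have "foldr (\<otimes>) bs \<one> \<in> I" using N[OF bs] len as(2) by simp
      then show ?thesis unfolding eq using ac by (intro ideal.I_l_closed[OF I]) auto
    qed
  qed
qed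

theorem cohen_kaplansky_finite_primary_atoms:
  assumes CK: "cohen_kaplansky_domain R" and P: "primeideal P R" "P \<noteq> {\<zero>}"
  shows "finite {Q \<in> atoms (ideal_monoid R). primary_ideal Q R \<and> ideal_radical R Q = P}"
proof -
  interpret P: primeideal P R by (rule P(1))
  define irr where "irr = {a \<in> carrier R. ring_irreducible a}"
  define r where "r = {(a, b). a \<in> irr \<and> b \<in> irr \<and> a \<sim> b}"
  have fact: "\<And>a. a \<in> carrier R - {\<zero>} - Units R \<Longrightarrow> \<exists>as. set as \<subseteq> irr \<and> foldr (\<otimes>) as \<one> = a"
    and fin: "finite (irr // r)"
    using CK unfolding cohen_kaplansky_domain_def Let_def irr_def r_def by blast+
  define A where "A = (\<lambda>C. SOME x. x \<in> C) ` (irr // r)"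
  have finA: "finite A" unfolding A_def using fin by (rule finite_imageI)
  have rep: "\<exists>b\<in>A. b \<in> irr \<and> a \<sim> b" if a: "a \<in> irr" for a
  proof -
    have "a \<sim> a" using a by (auto simp: irr_def)
    then have "a \<in> r `` {a}" using a by (auto simp: r_def)
    then have "(SOME x. x \<in> r `` {a}) \<in> r `` {a}" by (rule someI)
    moreover have "(SOME x. x \<in> r `` {a}) \<in> A" unfolding A_def using a by (intro imageI quotientI)
    ultimately show ?thesis by (auto simp: r_def)
  qed
  define A' where "A' = A \<inter> irr \<inter> P"
  have A': "finite A'" "A' \<subseteq> P" "A' \<subseteq> carrier R" "\<And>a. a \<in> A' \<Longrightarrow> a \<noteq> \<zero>"
    using finA by (auto simp: A'_def irr_def ring_irreducible_def)
  let ?m = "\<lambda>as. foldr (\<otimes>) as \<one>"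
  have mc: "?m as \<in> carrier R \<and> ?m as \<noteq> \<zero>" if "set as \<subseteq> A'" for as
    using that
  proof (induction as)
    case (Cons a as)
    then have "?m as \<in> carrier R" "?m as \<noteq> \<zero>" "a \<in> carrier R" "a \<noteq> \<zero>" using A'(3,4) by auto
    then show ?case using integral[of a "?m as"] by auto
  qed simp
  have unitP: "u \<in> carrier R - P" if "u \<in> Units R" for u
  proof -
    have "u \<notin> P"
    proof
      assume "u \<in> P"
      then have "inv u \<otimes> u \<in> P" using that by (intro P.I_l_closed) auto
      then show False using that one_in_compl_prime[OF P(1)] by simp
    qed
    then show ?thesis using that Units_closed by blast
  qed
  \<comment> \<open>Units and irreducibles outside P are collected in s, so that up to such a
    multiplier every non-zero element is a monomial in the finite set A'.\<close>
  have decomp_list: "\<exists>s as. s \<in> carrier R - P \<and> set as \<subseteq> A' \<and> ?m cs = s \<otimes> ?m as"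
    if "set cs \<subseteq> irr" for cs
    using that
  proof (induction cs)
    case Nil
    show ?case using one_in_compl_prime[OF P(1)] by (intro exI[of _ \<one>] exI[of _ "[]"]) simp
  next
    case (Cons c cs)
    then obtain s as where IH: "s \<in> carrier R - P" "set as \<subseteq> A'" "?m cs = s \<otimes> ?m as" by auto
    have c: "c \<in> irr" "c \<in> carrier R" using Cons.prems by (auto simp: irr_def)
    obtain b where b: "b \<in> A" "b \<in> irr" "c \<sim> b" using rep[OF c(1)] by blast
    have bc: "b \<in> carrier R" using b(2) by (simp add: irr_def)
    obtain u where u: "u \<in> Units R" "c = u \<otimes> b"
      using b(3) ring_associated_iff[OF c(2) bc] by blast
    have uc: "u \<in> carrier R" using u(1) by (rule Units_closed)
    have mas: "?m as \<in> carrier R" using mc[OF IH(2)] by blast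
    show ?case
    proof (cases "b \<in> P")
      case True
      have "?m (c # cs) = (u \<otimes> s) \<otimes> ?m (b # as)"
        using IH u(2) uc bc mas by (simp add: m_ac)
      moreover have "set (b # as) \<subseteq> A'" using True b IH(2) by (simp add: A'_def)
      ultimately show ?thesis using compl_prime_mult_closed[OF P(1) unitP[OF u(1)] IH(1)] by blast
    next
      case False
      have "?m (c # cs) = ((u \<otimes> b) \<otimes> s) \<otimes> ?m as"
        using IH u(2) uc bc mas by (simp add: m_ac)
      moreover have "(u \<otimes> b) \<otimes> s \<in> carrier R - P"
        using compl_prime_mult_closed[OF P(1)] unitP[OF u(1)] False bc IH(1) by blast
      ultimately show ?thesis using IH(2) by blast
    qed
  qed
  have decomp: "\<exists>s as. s \<in> carrier R - P \<and> set as \<subseteq> A' \<and> x = s \<otimes> ?m as"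
    if x: "x \<in> carrier R" "x \<noteq> \<zero>" for x
  proof (cases "x \<in> Units R")
    case True
    then show ?thesis using unitP[OF True] x by (intro exI[of _ x] exI[of _ "[]"]) simp
  next
    case False
    then obtain cs where cs: "set cs \<subseteq> irr" "?m cs = x" using fact[of x] x by blast
    show ?thesis using decomp_list[OF cs(1)] cs(2) by simp
  qed
  have fin_mon: "finite (?m ` {as. set as \<subseteq> A' \<and> length as \<le> N})" for N
    by (intro finite_imageI finite_lists_length_le A')
  define prim where "prim = {Q. ideal Q R \<and> Q \<subseteq> P \<and> (\<forall>x\<in>P. \<exists>n::nat. x [^] n \<in> Q)}"
  have cancel: "y \<in> Q" if "Q \<in> prim" "s \<in> carrier R - P" "y \<in> carrier R" "s \<otimes> y \<in> Q" for Q s y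
    using locally_nilpotent_cancel[OF P, of Q s y] that by (auto simp: prim_def)
  have long: "\<exists>N. \<forall>as. set as \<subseteq> A' \<and> length as \<ge> N \<longrightarrow> ?m as \<in> saturation R P (PIdl z)"
    if z: "z \<in> P" "z \<noteq> \<zero>" for z
  proof (rule long_monomials_in_ideal[OF A'(1,3)])
    have zc: "z \<in> carrier R" using z(1) by (rule P.Icarr)
    then show "ideal (saturation R P (PIdl z)) R" by (intro saturation_ideal[OF P(1)] cgenideal_ideal)
    have "PIdl z \<noteq> {\<zero>}" using cgenideal_self[OF zc] z(2) by auto
    then show "\<exists>n::nat. a [^] n \<in> saturation R P (PIdl z)" if "a \<in> A'" for a
      using that A'(2) by (intro nilpotent_mod_saturation[OF P(1) cgenideal_ideal[OF zc]]) auto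
  qed
  \<comment> \<open>Membership in a P-primary Q is decided by monomials. If z is in Q, the monomials
    of length at least N lie in Q anyway, being locally multiples of z; so Q is determined by the
    finitely many short ones that it contains.\<close>
  have fin_over: "finite {Q \<in> prim. z \<in> Q}" if z: "z \<noteq> \<zero>" for z
  proof (cases "z \<in> P")
    case True
    obtain N where N: "\<And>as. \<lbrakk>set as \<subseteq> A'; length as \<ge> N\<rbrakk> \<Longrightarrow> ?m as \<in> saturation R P (PIdl z)"
      using long[OF True z] by blast
    define F where "F = ?m ` {as. set as \<subseteq> A' \<and> length as \<le> N}"
    have sub: "Q \<subseteq> Q'" if Q: "Q \<in> prim" "z \<in> Q" "Q' \<in> prim" "z \<in> Q'" "Q \<inter> F = Q' \<inter> F" for Q Q'
    proof
      have id: "ideal Q R" "ideal Q' R" using Q by (auto simp: prim_def)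
      fix x assume x: "x \<in> Q"
      show "x \<in> Q'"
      proof (cases "x = \<zero>")
        case True
        then show ?thesis using additive_subgroup.zero_closed[OF ideal.axioms(1)[OF id(2)]] by simp
      next
        case False
        obtain s as where s: "s \<in> carrier R - P" "set as \<subseteq> A'" "x = s \<otimes> ?m as"
          using decomp[OF ideal.Icarr[OF id(1) x] False] by blast
        have m: "?m as \<in> carrier R" using mc[OF s(2)] by blast
        have "?m as \<in> Q'"
        proof (cases "length as \<le> N")
          case True
          then have "?m as \<in> F" using s(2) unfolding F_def by blast
          moreover have "?m as \<in> Q" using cancel[OF Q(1) s(1) m] x s(3) by simp
          ultimately show ?thesis using Q(5) by blast
        next
          case False
          then have "?m as \<in> saturation R P (PIdl z)" using N[OF s(2)] by simp
          then obtain t where t: "t \<in> carrier R - P" "t \<otimes> ?m as \<in> PIdl z"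
            by (auto simp: saturation_def)
          have "PIdl z \<subseteq> Q'" by (rule cgenideal_minimal[OF id(2) Q(4)])
          then show ?thesis using cancel[OF Q(3) t(1) m] t(2) by blast
        qed
        then show ?thesis unfolding s(3) using s(1) by (intro ideal.I_l_closed[OF id(2)]) auto
      qed
    qed
    have "inj_on (\<lambda>Q. Q \<inter> F) {Q \<in> prim. z \<in> Q}"
    proof (rule inj_onI)
      fix Q Q' assume "Q \<in> {Q \<in> prim. z \<in> Q}" "Q' \<in> {Q \<in> prim. z \<in> Q}" "Q \<inter> F = Q' \<inter> F"
      then show "Q = Q'" using sub[of Q Q'] sub[of Q' Q] by blast
    qed
    moreover have "finite ((\<lambda>Q. Q \<inter> F) ` {Q \<in> prim. z \<in> Q})"
      by (rule finite_subset[of _ "Pow F"]) (use fin_mon[of N] in \<open>auto simp: F_def\<close>)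
    ultimately show ?thesis by (rule finite_imageD[rotated])
  next
    case False
    then have "{Q \<in> prim. z \<in> Q} = {}" by (auto simp: prim_def)
    then show ?thesis by (simp only: finite.emptyI)
  qed
  obtain a where a: "a \<in> A'"
  proof -
    obtain x where x: "x \<in> P" "x \<noteq> \<zero>" using P(2) P.zero_closed by blast
    obtain s as where s: "s \<in> carrier R - P" "set as \<subseteq> A'" "x = s \<otimes> ?m as"
      using decomp[OF P.Icarr[OF x(1)] x(2)] by blast
    have "as \<noteq> []" using s x(1) by auto
    then show thesis using that s(2) by (cases as) auto
  qed
  have aP: "a \<in> P" "a \<noteq> \<zero>" "a \<in> carrier R" using a A' by auto
  obtain N where N: "\<And>as. \<lbrakk>set as \<subseteq> A'; length as \<ge> N\<rbrakk> \<Longrightarrow> ?m as \<in> saturation R P (PIdl a)"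
    using long[OF aP(1,2)] by blast
  \<comment> \<open>The bound is \<open>Suc N\<close> instead of N so that the one-letter monomial a
    is included even when N = 0. An atom without any of these monomials would be locally divisible
    by a and would therefore contain a.\<close>
  define F where "F = ?m ` {as. set as \<subseteq> A' \<and> length as \<le> Suc N}"
  have F: "z \<noteq> \<zero>" if "z \<in> F" for z using that mc by (auto simp: F_def)
  have "{Q \<in> atoms (ideal_monoid R). primary_ideal Q R \<and> ideal_radical R Q = P} \<subseteq>
      (\<Union>z\<in>F. {Q \<in> prim. z \<in> Q})"
  proof
    fix Q assume "Q \<in> {Q \<in> atoms (ideal_monoid R). primary_ideal Q R \<and> ideal_radical R Q = P}"
    then have Q: "Q \<in> atoms (ideal_monoid R)" and Qp: "Q \<in> prim"
      using primary_at_iff[OF P] by (auto simp: prim_def)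
    have QP: "Q \<subseteq> P" and Qid: "ideal Q R" using Qp by (auto simp: prim_def)
    have "\<exists>z\<in>F. z \<in> Q"
    proof (rule ccontr)
      assume no: "\<not> ?thesis"
      have "x \<in> saturation R P (PIdl a)" if x: "x \<in> Q" for x
      proof (cases "x = \<zero>")
        case True
        then show ?thesis
          using additive_subgroup.zero_closed[OF ideal.axioms(1)[OF
              saturation_ideal[OF P(1) cgenideal_ideal[OF aP(3)]]]] by simp
      next
        case False
        obtain s as where s: "s \<in> carrier R - P" "set as \<subseteq> A'" "x = s \<otimes> ?m as"
          using decomp[OF ideal.Icarr[OF Qid x] False] by blast
        have m: "?m as \<in> carrier R" using mc[OF s(2)] by blast
        have "?m as \<in> Q" using cancel[OF Qp s(1) m] x s(3) by simp
        then have "?m as \<notin> F" using no by blast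
        then have "length as \<ge> N" using s(2) by (force simp: F_def)
        then have "?m as \<in> saturation R P (PIdl a)" by (rule N[OF s(2)])
        then show ?thesis unfolding s(3) using s(1)
          by (intro ideal.I_l_closed[OF saturation_ideal[OF P(1) cgenideal_ideal[OF aP(3)]]]) auto
      qed
      then have "a \<in> Q"
        by (intro atom_contains_if_locally_divisible[OF P(1) Q QP aP(1,2)]) blast
      moreover have "a \<in> F" unfolding F_def using a aP by (intro image_eqI[of _ _ "[a]"]) auto
      ultimately show False using no by blast
    qed
    then show "Q \<in> (\<Union>z\<in>F. {Q \<in> prim. z \<in> Q})" using Qp by blast
  qed
  moreover have "finite (\<Union>z\<in>F. {Q \<in> prim. z \<in> Q})"
  proof (rule finite_UN_I)
    show "finite F" unfolding F_def by (rule fin_mon)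
  qed (use fin_over F in blast)
  ultimately show ?thesis by (rule finite_subset)
qed

end

section \<open>The conductor\<close>

context ring
begin

lemma eval_Cons: "eval (a # p) x = a \<otimes> x [^] length p \<oplus> eval p x"
  by simp

lemma eval_closed:
  assumes "set p \<subseteq> carrier R" "x \<in> carrier R"
  shows "eval p x \<in> carrier R"
  using assms(1) by (induction p) (use assms(2) in \<open>auto simp: eval_Cons simp del: eval.simps(2)\<close>)

lemma eval_map_uminus:
  assumes "set p \<subseteq> carrier R" "x \<in> carrier R"
  shows "eval (map (\<lambda>a. \<ominus> a) p) x = \<ominus> eval p x"
  using assms(1)
proof (induction p)
  case (Cons a p)
  then show ?case
    using assms(2) eval_closed[of p x] by (simp add: eval_Cons l_minus minus_add del: eval.simps(2))
qed simp

lemma eval_map2_add: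
  assumes "length p = length q" "set p \<subseteq> carrier R" "set q \<subseteq> carrier R" "x \<in> carrier R"
  shows "eval (map2 (\<oplus>) p q) x = eval p x \<oplus> eval q x"
  using assms(1-3)
proof (induction p q rule: list_induct2)
  case (Cons a p b q)
  then show ?case
    using assms(4) eval_closed[of p x] eval_closed[of q x]
    by (simp add: eval_Cons l_distr a_ac del: eval.simps(2))
qed simp

lemma eval_map_mult:
  assumes "set p \<subseteq> carrier R" "x \<in> carrier R" "r \<in> carrier R"
  shows "eval (map (\<lambda>a. r \<otimes> a) p) x = r \<otimes> eval p x"
  using assms(1)
proof (induction p)
  case (Cons a p)
  then show ?case
    using assms(2,3) eval_closed[of p x]
    by (simp add: eval_Cons r_distr m_assoc del: eval.simps(2))
qed (use assms(3) in simp)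

end

text \<open>The list q may have leading zeros: it is the coefficient lists of a fixed length, not
  the normalized polynomials, that form the modules used to prove integrality.\<close>

lemma (in domain) integral_closureI:
  assumes R: "subring S R" and x: "x \<in> carrier R" and q: "set q \<subseteq> S" "x [^] length q = eval q x"
  shows "x \<in> integral_closure R S"
proof -
  let ?p = "\<one> # map (\<lambda>a. \<ominus> a) q"
  have qc: "set q \<subseteq> carrier R" using q(1) subringE(1)[OF R] by blast
  have "eval ?p x = x [^] length q \<oplus> \<ominus> eval q x"
    using x qc by (simp add: eval_Cons eval_map_uminus del: eval.simps(2))
  also have "\<dots> = \<zero>" unfolding q(2) using eval_closed[OF qc x] by (simp add: r_neg)
  finally have ev: "eval ?p x = \<zero>" .
  have "?p \<in> carrier (univ_poly R S)"
    using q(1) subringE(3,5)[OF R] one_not_zero by (auto simp: univ_poly_def polynomial_def)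
  then show ?thesis unfolding integral_closure_def using x ev
    by (intro CollectI conjI bexI[of _ ?p]) auto
qed

text \<open>The additive inverse is a description over the carrier, so the one of the subring has to
  be identified with the one of the ambient ring.\<close>

lemma (in ring) subring_minus:
  assumes S: "subring S R" and y: "y \<in> S"
  shows "\<ominus>\<^bsub>R\<lparr>carrier := S\<rparr>\<^esub> y = \<ominus> y"
proof -
  interpret S: ring "R\<lparr>carrier := S\<rparr>" by (rule subring_is_ring[OF S])
  have "\<ominus>\<^bsub>R\<lparr>carrier := S\<rparr>\<^esub> y \<oplus> y = \<zero>" "\<ominus>\<^bsub>R\<lparr>carrier := S\<rparr>\<^esub> y \<in> S"
    using S.l_neg[of y] S.a_inv_closed[of y] y by auto
  then show ?thesis using minus_equality[of "\<ominus>\<^bsub>R\<lparr>carrier := S\<rparr>\<^esub> y" y] y subringE(1)[OF S]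
    by (metis subsetD)
qed

locale one_dim_noetherian_in_quotient_field = field K for K (structure) +
  fixes R
  assumes quotient_field: "is_quotient_field K R"
    and noetherian: "noetherian_domain (K\<lparr>carrier := R\<rparr>)"
    and krull_dim: "krull_dim (K\<lparr>carrier := R\<rparr>) = 1"
    and fin_gen_closure: "fin_gen_submodule K R (integral_closure K R)"
begin

abbreviation A where "A \<equiv> K\<lparr>carrier := R\<rparr>"

sublocale A: one_dim_noetherian_domain A
  by (intro one_dim_noetherian_domain.intro noetherian one_dim_noetherian_domain_axioms.intro krull_dim)

lemma subring_R: "subring R K"
  using quotient_field by (simp add: is_quotient_field_def)

lemma R_subset: "R \<subseteq> carrier K"
  by (rule subringE(1)[OF subring_R])

lemma minus_A: "y \<in> R \<Longrightarrow> \<ominus>\<^bsub>A\<^esub> y = \<ominus> y"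
  by (rule subring_minus[OF subring_R])

lemma quotient_rep:
  assumes "x \<in> carrier K"
  obtains a b where "a \<in> R" "b \<in> R" "b \<noteq> \<zero>" "b \<otimes> x = a"
proof -
  obtain a b where ab: "a \<in> R" "b \<in> R" "b \<noteq> \<zero>" "x = a \<otimes> inv b"
    using quotient_field assms unfolding is_quotient_field_def by blast
  have c: "a \<in> carrier K" "b \<in> carrier K" "b \<in> Units K" using ab R_subset field_Units by auto
  then have "b \<otimes> x = a" unfolding ab(4) by (simp add: m_lcomm[of b a "inv b"])
  then show thesis using that ab by blast
qed

lemma ideal_A_subset: "ideal I A \<Longrightarrow> I \<subseteq> R"
  using ideal.Icarr by fastforce

text \<open>The modules L n = b (R + R x + ... + R x^(n-1)) lie in P, so they are ideals of R and
  their ascending chain becomes stationary. This expresses x^n by lower powers, without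
  determinants.\<close>

lemma integral_if_stabilizes_ideal:
  assumes x: "x \<in> carrier K" and P: "ideal P A" "P \<noteq> {\<zero>}" and stab: "\<And>p. p \<in> P \<Longrightarrow> x \<otimes> p \<in> P"
  shows "x \<in> integral_closure K R"
proof -
  obtain b where b: "b \<in> P" "b \<noteq> \<zero>"
    using P additive_subgroup.zero_closed[OF ideal.axioms(1)[OF P(1)]] by auto
  have PK: "P \<subseteq> carrier K" using ideal_A_subset[OF P(1)] R_subset by blast
  have bK: "b \<in> carrier K" using b(1) PK by blast
  have bx: "b \<otimes> x [^] (n::nat) \<in> P" for n
  proof (induction n)
    case (Suc n)
    have "b \<otimes> x [^] Suc n = x \<otimes> (b \<otimes> x [^] n)" using x bK by (simp add: m_ac)
    then show ?case using stab[OF Suc] by simp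
  qed (use b(1) bK in simp)
  define L where "L n = {b \<otimes> eval q x |q. set q \<subseteq> R \<and> length q = n}" for n
  have Lsub: "b \<otimes> eval q x \<in> P" if "set q \<subseteq> R" for q
    using that
  proof (induction q)
    case Nil
    then show ?case using additive_subgroup.zero_closed[OF ideal.axioms(1)[OF P(1)]] bK by simp
  next
    case (Cons a q)
    have a: "a \<in> R" "a \<in> carrier K" "set q \<subseteq> carrier K" using Cons.prems R_subset by auto
    have "b \<otimes> eval (a # q) x = a \<otimes> (b \<otimes> x [^] length q) \<oplus> b \<otimes> eval q x"
      using a x bK eval_closed[of q x] by (simp add: eval_Cons r_distr m_lcomm del: eval.simps(2))
    moreover have "a \<otimes> (b \<otimes> x [^] length q) \<in> P" using ideal.I_l_closed[OF P(1) bx] a(1) by simp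
    moreover have "b \<otimes> eval q x \<in> P" using Cons by simp
    ultimately show ?case using additive_subgroup.a_closed[OF ideal.axioms(1)[OF P(1)]] by simp
  qed
  have Lid: "ideal (L n) A" for n
  proof (rule idealI)
    show "ring A" by (rule A.ring_axioms)
    have LR: "L n \<subseteq> R" using Lsub ideal_A_subset[OF P(1)] by (auto simp: L_def)
    show "subgroup (L n) (add_monoid A)"
    proof (rule A.add.subgroupI)
      show "L n \<subseteq> carrier A" using LR by simp
      have "set (replicate n \<zero>) \<subseteq> R" using subringE(2)[OF subring_R] by auto
      then show "L n \<noteq> {}" unfolding L_def by (auto intro!: exI[of _ "replicate n \<zero>"])
    next
      fix y assume "y \<in> L n"
      then obtain q where q: "y = b \<otimes> eval q x" "set q \<subseteq> R" "length q = n" by (auto simp: L_def)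
      have qK: "set q \<subseteq> carrier K" using q(2) R_subset by blast
      have yR: "y \<in> R" using q Lsub ideal_A_subset[OF P(1)] by blast
      have "\<ominus>\<^bsub>A\<^esub> y = \<ominus> y" using yR by (rule minus_A)
      also have "\<dots> = b \<otimes> eval (map (\<lambda>a. \<ominus> a) q) x"
        using qK x bK eval_closed[OF qK x] by (simp add: q(1) eval_map_uminus r_minus)
      finally show "\<ominus>\<^bsub>A\<^esub> y \<in> L n"
        unfolding L_def using q subringE(5)[OF subring_R]
        by (intro CollectI exI[of _ "map (\<lambda>a. \<ominus> a) q"]) auto
    next
      fix y z assume "y \<in> L n" "z \<in> L n"
      then obtain q q' where q: "y = b \<otimes> eval q x" "set q \<subseteq> R" "length q = n"
        "z = b \<otimes> eval q' x" "set q' \<subseteq> R" "length q' = n" by (auto simp: L_def)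
      have qK: "set q \<subseteq> carrier K" "set q' \<subseteq> carrier K" using q(2,5) R_subset by auto
      have "y \<oplus> z = b \<otimes> eval (map2 (\<oplus>) q q') x"
        using qK x bK eval_closed[OF qK(1) x] eval_closed[OF qK(2) x] q(3,6)
        by (simp add: q(1,4) eval_map2_add r_distr)
      moreover have "set (map2 (\<oplus>) q q') \<subseteq> R"
      proof
        fix c assume "c \<in> set (map2 (\<oplus>) q q')"
        then obtain a a' where "(a, a') \<in> set (zip q q')" "c = a \<oplus> a'" by auto
        moreover from this have "a \<in> R" "a' \<in> R"
          using q(2,5) set_zip_leftD[of a a' q q'] set_zip_rightD[of a a' q q'] by auto
        ultimately show "c \<in> R" using subringE(7)[OF subring_R] by simp
      qed
      ultimately show "y \<oplus>\<^bsub>A\<^esub> z \<in> L n"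
        unfolding L_def using q(3,6) by (intro CollectI exI[of _ "map2 (\<oplus>) q q'"]) auto
    qed
    fix y r assume "y \<in> L n" and r: "r \<in> carrier A"
    then obtain q where q: "y = b \<otimes> eval q x" "set q \<subseteq> R" "length q = n" by (auto simp: L_def)
    have qK: "set q \<subseteq> carrier K" using q(2) R_subset by blast
    have rR: "r \<in> R" "r \<in> carrier K" using r R_subset by auto
    have "r \<otimes> y = b \<otimes> eval (map (\<lambda>a. r \<otimes> a) q) x"
      using qK x bK rR eval_closed[OF qK x] by (simp add: q(1) eval_map_mult m_lcomm)
    then show "r \<otimes>\<^bsub>A\<^esub> y \<in> L n"
      unfolding L_def using q rR subringE(6)[OF subring_R]
      by (intro CollectI exI[of _ "map (\<lambda>a. r \<otimes> a) q"]) auto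
    moreover have "y \<otimes>\<^bsub>A\<^esub> r = r \<otimes>\<^bsub>A\<^esub> y"
      using rR qK x bK eval_closed[OF qK x] by (simp add: q(1) m_comm)
    ultimately show "y \<otimes>\<^bsub>A\<^esub> r \<in> L n" by simp
  qed
  obtain M where M: "M \<in> range L" and max: "\<And>I. \<lbrakk>I \<in> range L; M \<subseteq> I\<rbrakk> \<Longrightarrow> I = M"
    by (rule A.noetherian_maximal[OF A.noetherian_ring, of "range L"]) (use Lid in auto)
  then obtain n where n: "M = L n" by blast
  have "L n \<subseteq> L (Suc n)"
  proof
    fix y assume "y \<in> L n"
    then obtain q where q: "y = b \<otimes> eval q x" "set q \<subseteq> R" "length q = n" by (auto simp: L_def)
    then have "y = b \<otimes> eval (\<zero> # q) x"
      using x R_subset eval_closed[of q x] by (simp add: eval_Cons subset_iff del: eval.simps(2))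
    then show "y \<in> L (Suc n)" unfolding L_def using q subringE(2)[OF subring_R]
      by (intro CollectI exI[of _ "\<zero> # q"]) simp
  qed
  then have eq: "L (Suc n) = L n" using max[of "L (Suc n)"] n by blast
  have z: "set (replicate n \<zero>) \<subseteq> carrier K" by auto
  have ev0: "eval (replicate k \<zero>) x = \<zero>" for k
    by (induction k) (use x in \<open>simp_all add: eval_Cons del: eval.simps(2)\<close>)
  have "eval (\<one> # replicate n \<zero>) x = x [^] n" using x by (simp add: eval_Cons ev0 del: eval.simps(2))
  moreover have "set (\<one> # replicate n \<zero>) \<subseteq> R" using subringE(2,3)[OF subring_R] by auto
  ultimately have "b \<otimes> x [^] n \<in> L (Suc n)"
    unfolding L_def by (intro CollectI exI[of _ "\<one> # replicate n \<zero>"]) auto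
  then obtain q where q: "b \<otimes> x [^] n = b \<otimes> eval q x" "set q \<subseteq> R" "length q = n"
    unfolding eq by (auto simp: L_def)
  have "set q \<subseteq> carrier K" using q(2) R_subset by blast
  then have "x [^] n = eval q x"
    using q(1) m_lcancel[OF b(2) bK] x eval_closed[of q x] by simp
  then show ?thesis using integral_closureI[OF subring_R x q(2)] q(3) by simp
qed

lemma integral_closure_subset: "integral_closure K R \<subseteq> carrier K"
  by (auto simp: integral_closure_def)

lemma conductor_ideal: "ideal (conductor K R) A"
proof (rule idealI)
  show "ring A" by (rule A.ring_axioms)
  note sE = subringE[OF subring_R]
  show "subgroup (conductor K R) (add_monoid A)"
  proof (rule A.add.subgroupI)
    show "conductor K R \<noteq> {}"
      using sE(2) integral_closure_subset by (auto simp: conductor_def subset_iff intro!: exI[of _ \<zero>])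
  next
    fix y assume y: "y \<in> conductor K R"
    then have yR: "y \<in> R" by (simp add: conductor_def)
    then have yK: "y \<in> carrier K" using R_subset by blast
    have "\<ominus>\<^bsub>A\<^esub> y = \<ominus> y" using yR by (rule minus_A)
    then show "\<ominus>\<^bsub>A\<^esub> y \<in> conductor K R"
      using y sE(5) integral_closure_subset yK by (auto simp: conductor_def l_minus subset_iff)
  next
    fix y z assume "y \<in> conductor K R" "z \<in> conductor K R"
    then show "y \<oplus>\<^bsub>A\<^esub> z \<in> conductor K R"
      using sE(7) integral_closure_subset R_subset by (auto simp: conductor_def l_distr subset_iff)
  qed (auto simp: conductor_def)
  fix y r assume y: "y \<in> conductor K R" and r: "r \<in> carrier A"
  have *: "r \<otimes> y \<in> conductor K R"
    using y r sE(6) integral_closure_subset R_subset by (auto simp: conductor_def m_assoc subset_iff)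
  then show "r \<otimes>\<^bsub>A\<^esub> y \<in> conductor K R" by simp
  have "y \<otimes> r = r \<otimes> y" using y r R_subset by (auto simp: conductor_def m_comm subset_iff)
  then show "y \<otimes>\<^bsub>A\<^esub> r \<in> conductor K R" using * by simp
qed

lemma common_denominator:
  assumes "set us \<subseteq> carrier K"
  shows "\<exists>d\<in>R. d \<noteq> \<zero> \<and> (\<forall>y\<in>Span R us. d \<otimes> y \<in> R)"
  using assms
proof (induction us)
  case Nil
  show ?case using subringE(2,3)[OF subring_R] by (intro bexI[of _ \<one>]) auto
next
  case (Cons u us)
  then obtain d where d: "d \<in> R" "d \<noteq> \<zero>" "\<And>y. y \<in> Span R us \<Longrightarrow> d \<otimes> y \<in> R" by auto
  obtain a b where ab: "a \<in> R" "b \<in> R" "b \<noteq> \<zero>" "b \<otimes> u = a"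
    by (rule quotient_rep[of u]) (use Cons.prems in auto)
  have c: "d \<in> carrier K" "b \<in> carrier K" using d ab R_subset by auto
  show ?case
  proof (intro bexI[of _ "b \<otimes> d"] conjI ballI)
    show "b \<otimes> d \<in> R" using ab d subringE(6)[OF subring_R] by blast
    show "b \<otimes> d \<noteq> \<zero>" using c ab(3) d(2) by (simp add: integral_iff)
    fix y assume "y \<in> Span R (u # us)"
    then obtain k v where kv: "k \<in> R" "v \<in> Span R us" "y = k \<otimes> u \<oplus> v"
      by (auto simp: line_extension_mem_iff)
    have "v \<in> carrier K" using kv(2) Span_in_carrier[OF R_subset] Cons.prems by auto
    moreover have "k \<in> carrier K" "u \<in> carrier K" using kv(1) R_subset Cons.prems by auto
    ultimately have "(b \<otimes> d) \<otimes> y = (d \<otimes> k) \<otimes> (b \<otimes> u) \<oplus> b \<otimes> (d \<otimes> v)"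
      using c unfolding kv(3) by (simp add: r_distr m_ac)
    moreover have "(d \<otimes> k) \<otimes> (b \<otimes> u) \<in> R" "b \<otimes> (d \<otimes> v) \<in> R"
      using ab d kv subringE(6)[OF subring_R] by auto
    ultimately show "(b \<otimes> d) \<otimes> y \<in> R" using subringE(7)[OF subring_R] by simp
  qed
qed

lemma conductor_nonzero: "conductor K R \<noteq> {\<zero>}"
proof -
  obtain us where us: "set us \<subseteq> carrier K" "integral_closure K R = Span R us"
    using fin_gen_closure by (auto simp: fin_gen_submodule_def)
  obtain d where "d \<in> R" "d \<noteq> \<zero>" "\<forall>y\<in>Span R us. d \<otimes> y \<in> R"
    using common_denominator[OF us(1)] by blast
  then have "d \<in> conductor K R" "d \<noteq> \<zero>" by (auto simp: conductor_def us(2))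
  then show ?thesis by blast
qed

section \<open>Invertibility of the primes off the conductor\<close>

lemma conductor_primes_eq:
  "conductor_primes K R = {P. primeideal P A \<and> P \<noteq> {\<zero>} \<and> conductor K R \<subseteq> P}"
  using A.height_one_primes_eq by (auto simp: conductor_primes_def)

text \<open>
  The socle element \<open>y\<close> of \<open>R\<close> modulo the contraction of \<open>a R\<^sub>P\<close> yields \<open>x = y / a\<close> with
  \<open>x P \<subseteq> R\<close> and \<open>x\<close> not in \<open>R\<^sub>P\<close>; were \<open>P\<close> not invertible, \<open>x\<close> would be integral, hence
  in \<open>R\<^sub>P\<close>, because \<open>P\<close> does not contain the conductor.
\<close>

lemma prime_off_conductor_invertible:
  assumes P: "primeideal P A" "P \<noteq> {\<zero>}" and off: "\<not> conductor K R \<subseteq> P"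
  shows "\<exists>a J. a \<in> carrier A \<and> a \<noteq> \<zero>\<^bsub>A\<^esub> \<and> ideal J A \<and> P \<cdot>\<^bsub>A\<^esub> J = PIdl\<^bsub>A\<^esub> a"
proof -
  interpret P: primeideal P A by (rule P(1))
  have PR: "P \<subseteq> R" by (rule ideal_A_subset[OF P.is_ideal])
  have R: "r \<in> carrier K" if "r \<in> R" for r using that R_subset by blast
  obtain a where a: "a \<in> P" "a \<noteq> \<zero>" using P(2) P.zero_closed by auto
  have aR: "a \<in> R" using a(1) PR by blast
  have pid: "ideal (PIdl\<^bsub>A\<^esub> a) A" by (rule A.cgenideal_ideal) (use aR in simp)
  have pid_mem: "z \<in> PIdl\<^bsub>A\<^esub> a \<longleftrightarrow> (\<exists>r\<in>R. z = r \<otimes> a)" for z by (auto simp: cgenideal_def)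
  have a_pid: "a \<in> PIdl\<^bsub>A\<^esub> a" using A.cgenideal_self[of a] aR by simp
  have pid0: "PIdl\<^bsub>A\<^esub> a \<noteq> {\<zero>\<^bsub>A\<^esub>}" using a_pid a(2) by auto
  define Q where "Q = saturation A P (PIdl\<^bsub>A\<^esub> a)"
  have Q: "ideal Q A" unfolding Q_def by (rule saturation_ideal[OF P(1) pid])
  have QP: "Q \<subseteq> P" unfolding Q_def
    by (rule saturation_subset_prime[OF P(1)]) (rule A.cgenideal_minimal[OF P.is_ideal a(1)])
  \<comment> \<open>\<open>col y\<close> is (Q : y), the annihilator of y modulo Q; a maximal one
    among those with y not in Q will be seen to contain P.\<close>
  define col where "col y = {z \<in> carrier A. \<forall>x\<in>{y}. z \<otimes>\<^bsub>A\<^esub> x \<in> Q}" for y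
  have col_mem: "z \<in> col y \<longleftrightarrow> z \<in> R \<and> z \<otimes> y \<in> Q" for z y by (simp add: col_def)
  have one: "\<one> \<in> R - Q" using one_in_compl_prime[OF P(1)] QP by auto
  have colid: "ideal (col y) A" if "y \<in> R" for y
    unfolding col_def by (rule A.ideal_colon_is_ideal[OF Q]) (use that in simp)
  obtain M where M: "M \<in> col ` (R - Q)" and max: "\<And>I. \<lbrakk>I \<in> col ` (R - Q); M \<subseteq> I\<rbrakk> \<Longrightarrow> I = M"
    by (rule A.noetherian_maximal[OF A.noetherian_ring, of "col ` (R - Q)"])
      (use one colid in auto)
  obtain y where y: "y \<in> R" "y \<notin> Q" "M = col y" using M by auto
  \<comment> \<open>If p y were not in Q, then (Q : p y) = (Q : y) by maximality. Hence p^n y in Q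
    would imply p^(n-1) y in Q, against the choice of the least such n.\<close>
  have socle: "p \<otimes> y \<in> Q" if p: "p \<in> P" for p
  proof (rule ccontr)
    assume neg: "p \<otimes> y \<notin> Q"
    have pR: "p \<in> R" using p PR by blast
    have py: "p \<otimes> y \<in> R" using pR y(1) subringE(6)[OF subring_R] by blast
    have pow: "p [^]\<^bsub>A\<^esub> (n::nat) = p [^] n" "p [^] n \<in> R" for n
    proof -
      show "p [^]\<^bsub>A\<^esub> n = p [^] n" by (induction n) auto
      show "p [^] n \<in> R" by (induction n) (use pR subringE(3,6)[OF subring_R] in auto)
    qed
    have "col y \<subseteq> col (p \<otimes> y)"
    proof
      fix z assume z: "z \<in> col y"
      then have "z \<otimes> (p \<otimes> y) = p \<otimes> (z \<otimes> y)" using R pR y(1) by (simp add: col_mem m_lcomm)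
      moreover have "p \<otimes> (z \<otimes> y) \<in> Q"
        using ideal.I_l_closed[OF Q, of "z \<otimes> y" p] z pR by (simp add: col_mem)
      ultimately show "z \<in> col (p \<otimes> y)" using z by (simp add: col_mem)
    qed
    then have eq: "col (p \<otimes> y) = col y" using max[of "col (p \<otimes> y)"] neg py y(3) by blast
    obtain n where "p [^]\<^bsub>A\<^esub> (n::nat) \<in> Q"
      using A.nilpotent_mod_saturation[OF P(1) pid pid0 p] unfolding Q_def by blast
    then have ex: "\<exists>n::nat. p [^] n \<otimes> y \<in> Q"
      using ideal.I_r_closed[OF Q, of "p [^] n" y] y(1) pow by auto
    define n where "n = (LEAST n::nat. p [^] n \<otimes> y \<in> Q)"
    have n: "p [^] n \<otimes> y \<in> Q" unfolding n_def using ex by (rule LeastI_ex)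
    show False
    proof (cases n)
      case 0
      then show False using n y R by simp
    next
      case (Suc m)
      have "p [^] m \<otimes> (p \<otimes> y) = p [^] n \<otimes> y" using Suc R[OF pR] R[OF y(1)] by (simp add: m_assoc)
      then have "p [^] m \<in> col (p \<otimes> y)" using n pow(2) by (simp add: col_mem)
      then have "p [^] m \<otimes> y \<in> Q" unfolding eq by (simp add: col_mem)
      then show False using not_less_Least[of m "\<lambda>n. p [^] n \<otimes> y \<in> Q"] Suc unfolding n_def by simp
    qed
  qed
  have Py: "ideal ((PIdl\<^bsub>A\<^esub> y) \<cdot>\<^bsub>A\<^esub> P) A"
    using A.ideal_prod_is_ideal[OF A.cgenideal_ideal P.is_ideal] y(1) by simp
  have Py_eq: "(PIdl\<^bsub>A\<^esub> y) \<cdot>\<^bsub>A\<^esub> P = (\<lambda>x. y \<otimes> x) ` P"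
    using A.principal_ideal_prod[OF _ P.is_ideal, of y] y(1) by simp
  have "(PIdl\<^bsub>A\<^esub> y) \<cdot>\<^bsub>A\<^esub> P \<subseteq> saturation A P (PIdl\<^bsub>A\<^esub> a)"
    unfolding Py_eq Q_def[symmetric] using socle R y(1) PR m_comm by auto
  then obtain s where s: "s \<in> carrier A - P" "\<And>z. z \<in> (\<lambda>x. y \<otimes> x) ` P \<Longrightarrow> s \<otimes>\<^bsub>A\<^esub> z \<in> PIdl\<^bsub>A\<^esub> a"
    using saturation_finite[OF P(1) A.noetherian_ring pid Py] unfolding Py_eq by blast
  have sR: "s \<in> R" using s(1) by simp
  \<comment> \<open>One s clears the denominators for all of P: w P lies in a R, whereas c w is not
    in a R for any c outside P.\<close>
  define w where "w = s \<otimes> y"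
  have wR: "w \<in> R" unfolding w_def using sR y(1) subringE(6)[OF subring_R] by blast
  have wP: "w \<otimes> p \<in> PIdl\<^bsub>A\<^esub> a" if "p \<in> P" for p
    using s(2)[of "y \<otimes> p"] that R sR y(1) PR by (auto simp: w_def m_assoc subset_iff)
  have w_notin: "c \<otimes> w \<notin> PIdl\<^bsub>A\<^esub> a" if c: "c \<in> R - P" for c
  proof
    assume "c \<otimes> w \<in> PIdl\<^bsub>A\<^esub> a"
    moreover have "c \<otimes> w = (c \<otimes> s) \<otimes> y" unfolding w_def using c sR y(1) R by (simp add: m_assoc)
    moreover have "c \<otimes> s \<in> carrier A - P" using compl_prime_mult_closed[OF P(1), of c s] c s(1) by simp
    ultimately have "y \<in> Q" using y(1) by (auto simp: Q_def saturation_def)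
    then show False using y(2) by blast
  qed
  \<comment> \<open>J is a P^-1, where P^-1 consists of the x with x P contained in R; it lies in R
    because a is in P.\<close>
  define J where "J = {z \<in> carrier A. \<forall>p\<in>P. z \<otimes>\<^bsub>A\<^esub> p \<in> PIdl\<^bsub>A\<^esub> a}"
  have J: "ideal J A" unfolding J_def by (rule A.ideal_colon_is_ideal[OF pid]) (use PR in simp)
  have wJ: "w \<in> J" using wP wR by (simp add: J_def)
  have aJ: "a \<in> J" using aR PR R m_comm by (auto simp: J_def pid_mem subset_iff)
  have "P \<cdot>\<^bsub>A\<^esub> J \<subseteq> PIdl\<^bsub>A\<^esub> a"
  proof (rule A.ideal_prod_minimal[OF pid])
    fix p z assume pz: "p \<in> P" "z \<in> J"
    then have "z \<otimes> p \<in> PIdl\<^bsub>A\<^esub> a" "p \<otimes> z = z \<otimes> p"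
      using PR R m_comm by (auto simp: J_def subset_iff)
    then show "p \<otimes>\<^bsub>A\<^esub> z \<in> PIdl\<^bsub>A\<^esub> a" by simp
  qed
  \<comment> \<open>The principal ideal of a is invertible with cofactor R, so it divides P J. The
    quotient I is P P^-1, and it remains to exclude that it is proper.\<close>
  then obtain I where I: "ideal I A" "P \<cdot>\<^bsub>A\<^esub> J = (PIdl\<^bsub>A\<^esub> a) \<cdot>\<^bsub>A\<^esub> I"
    using A.invertible_ideal_divides[OF _ _ pid A.oneideal A.ideal_prod_one[OF pid]
        A.ideal_prod_is_ideal[OF P.is_ideal J]] aR a(2) by auto
  have PJ_eq: "P \<cdot>\<^bsub>A\<^esub> J = (\<lambda>x. a \<otimes> x) ` I"
    unfolding I(2) using A.principal_ideal_prod[OF _ I(1), of a] aR by simp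
  have IR: "I \<subseteq> R" by (rule ideal_A_subset[OF I(1)])
  have in_I: "x \<in> I" if x: "x \<in> carrier K" "a \<otimes> x \<in> P \<cdot>\<^bsub>A\<^esub> J" for x
  proof -
    obtain i where "i \<in> I" "a \<otimes> x = a \<otimes> i" using x(2) unfolding PJ_eq by blast
    then show ?thesis using m_lcancel[OF a(2) R[OF aR] x(1), of i] IR R by auto
  qed
  have PI: "P \<subseteq> I"
  proof
    fix p assume p: "p \<in> P"
    then have "p \<otimes> a \<in> P \<cdot>\<^bsub>A\<^esub> J" using ideal_prod.prod[OF p aJ, of A] by simp
    then show "p \<in> I" using in_I p PR R aR m_comm by (auto simp: subset_iff)
  qed
  have "I = R"
  proof (rule ccontr)
    assume "I \<noteq> R"
    then obtain N where N: "primeideal N A" "I \<subseteq> N"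
      using A.proper_ideal_in_primeideal[OF A.noetherian_ring I(1)] by auto
    have "P = N" using A.primes_incomparable[OF P(1) _ N(1)] P(2) PI N(2) by auto
    then have IP: "I = P" using N(2) PI by blast
    \<comment> \<open>x lies in P^-1, so x P is contained in P P^-1 = I = P.\<close>
    define x where "x = w \<otimes> inv a"
    have aU: "a \<in> Units K" using a(2) aR R field_Units by auto
    have xK: "x \<in> carrier K" unfolding x_def using R[OF wR] aU by simp
    have ax: "a \<otimes> x = w" unfolding x_def using R[OF wR] R[OF aR] aU by (simp add: m_lcomm[of a w])
    have "x \<in> integral_closure K R"
    proof (rule integral_if_stabilizes_ideal[OF xK P.is_ideal P(2)])
      fix p assume p: "p \<in> P"
      have pK: "p \<in> carrier K" using p PR R by blast
      have "a \<otimes> (x \<otimes> p) = p \<otimes> w"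
        using ax xK pK R[OF aR] R[OF wR] m_assoc[of a x p] m_comm[of w p] by simp
      moreover have "p \<otimes> w \<in> P \<cdot>\<^bsub>A\<^esub> J" using ideal_prod.prod[OF p wJ, of A] by simp
      ultimately show "x \<otimes> p \<in> P" using in_I[of "x \<otimes> p"] xK pK IP by simp
    qed
    obtain c where c: "c \<in> conductor K R" "c \<notin> P" using off by blast
    then have cR: "c \<in> R" "c \<otimes> x \<in> R" using \<open>x \<in> integral_closure K R\<close> by (auto simp: conductor_def)
    have "c \<otimes> w = (c \<otimes> x) \<otimes> a"
      unfolding ax[symmetric] using R[OF cR(1)] xK R[OF aR] by (simp add: m_ac)
    then have "c \<otimes> w \<in> PIdl\<^bsub>A\<^esub> a" using cR(2) by (auto simp: pid_mem)
    then show False using w_notin[of c] c(2) cR(1) by blast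
  qed
  then have "P \<cdot>\<^bsub>A\<^esub> J = PIdl\<^bsub>A\<^esub> a" using I(2) A.ideal_prod_one[OF pid] by simp
  then show ?thesis using aR a(2) J by auto
qed

theorem structure_theorem_if_cond_C:
  assumes "cond_C K R"
  shows "structure_theorem_for_unions (system_of_lengths (ideal_monoid A))"
proof (rule A.structure_theorem_if_almost_all_primes_invertible[of "conductor_primes K R"])
  show "finite (conductor_primes K R)"
  proof (rule finite_subset)
    show "conductor_primes K R \<subseteq> {P. primeideal P A \<and> conductor K R \<subseteq> P}"
      by (auto simp: conductor_primes_eq)
    show "finite {P. primeideal P A \<and> conductor K R \<subseteq> P}"
      using A.finite_primes_over[OF conductor_ideal] conductor_nonzero by simp
  qed
  show "finite {Q \<in> atoms (ideal_monoid A). primary_ideal Q A \<and> ideal_radical A Q = P}"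
    if "P \<in> conductor_primes K R" for P
    using assms that by (auto simp: cond_C_def)
  show "\<exists>a J. a \<in> carrier A \<and> a \<noteq> \<zero>\<^bsub>A\<^esub> \<and> ideal J A \<and> P \<cdot>\<^bsub>A\<^esub> J = PIdl\<^bsub>A\<^esub> a"
    if "primeideal P A" "P \<noteq> {\<zero>\<^bsub>A\<^esub>}" "P \<notin> conductor_primes K R" for P
    using prime_off_conductor_invertible[of P] that by (simp add: conductor_primes_eq)
qed

theorem cond_C_if_cohen_kaplansky:
  assumes "cohen_kaplansky_domain A"
  shows "cond_C K R"
  unfolding cond_C_def using A.cohen_kaplansky_finite_primary_atoms[OF assms]
  by (auto simp: conductor_primes_eq)

end

section \<open>Norms and quadratic congruences\<close>

text \<open>
  For \<open>4 * n = D\<^sup>2 - D\<close> this is the norm of \<open>a + b \<omega>\<close>, where \<open>\<omega> = (D + \<surd>D) / 2\<close> is a root of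
  \<open>t\<^sup>2 - D t + n\<close>.
\<close>

definition quadratic_norm :: "int \<Rightarrow> int \<Rightarrow> int \<Rightarrow> int \<Rightarrow> int"
  where "quadratic_norm D n a b = a\<^sup>2 + a * b * D + b\<^sup>2 * n"

lemma quadratic_norm_mult:
  "quadratic_norm D n (a * a' - b * b' * n) (a * b' + a' * b + D * b * b') =
    quadratic_norm D n a b * quadratic_norm D n a' b'"
  unfolding quadratic_norm_def by (simp add: power2_eq_square algebra_simps)

lemma four_quadratic_norm:
  assumes "4 * n = D\<^sup>2 - D"
  shows "4 * quadratic_norm D n a b = (2 * a + b * D)\<^sup>2 - D * b\<^sup>2"
proof -
  have "4 * quadratic_norm D n a b = 4 * a\<^sup>2 + 4 * a * b * D + b\<^sup>2 * (4 * n)"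
    unfolding quadratic_norm_def by (simp add: power2_eq_square algebra_simps)
  then show ?thesis unfolding assms by (simp add: power2_eq_square algebra_simps)
qed

lemma square_mod_4_int: "(x::int)\<^sup>2 mod 4 = (if even x then 0 else 1)"
proof (cases "even x")
  case True
  then obtain y where "x = 2 * y" by blast
  then show ?thesis using True by (simp add: power2_eq_square)
next
  case False
  then obtain y where "x = 2 * y + 1" by (auto elim: oddE)
  then have "x\<^sup>2 = 1 + (y\<^sup>2 + y) * 4" by (simp add: power2_eq_square algebra_simps)
  then have "x\<^sup>2 mod 4 = 1" by presburger
  then show ?thesis using False by simp
qed

lemma squarefree_int_mod_4: "squarefree (d::int) \<Longrightarrow> d mod 4 \<noteq> 0"
proof
  assume d: "squarefree d" and "d mod 4 = 0"
  then have "2\<^sup>2 dvd d" by auto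
  then show False using d by (auto simp: squarefree_def dest: spec[of _ 2])
qed

lemma four_dvd_square_diff:
  fixes u s d :: int
  assumes "4 dvd u\<^sup>2 - d * s\<^sup>2" "d mod 4 = 2 \<or> d mod 4 = 3"
  shows "even u \<and> even s"
proof -
  have "(u\<^sup>2 - d * s\<^sup>2) mod 4 = 0" using assms(1) by auto
  then have eq: "((u\<^sup>2 mod 4) - ((d mod 4) * (s\<^sup>2 mod 4)) mod 4) mod 4 = 0"
    by (simp only: mod_diff_eq mod_mult_eq)
  have "even s"
  proof (rule ccontr)
    assume "odd s"
    then show False using eq assms(2) by (auto simp: square_mod_4_int split: if_splits)
  qed
  moreover from this have "even u" using eq by (auto simp: square_mod_4_int split: if_splits)
  ultimately show ?thesis by blast
qed

section \<open>Split and non-split primes in terms of norms and roots\<close>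

locale fundamental_discriminant =
  fixes d D n :: int
  assumes squarefree_d: "squarefree d" and D_def: "D = (if d mod 4 = 1 then d else 4 * d)"
    and n_def: "4 * n = D\<^sup>2 - D"
begin

abbreviation "N \<equiv> quadratic_norm D n"

lemma D_mod_4: "D mod 4 = 0 \<or> D mod 4 = 1"
  by (auto simp: D_def)

lemma not_square_dvd_D:
  assumes "Factorial_Ring.prime (p::nat)" "p \<noteq> 2"
  shows "\<not> (int p)\<^sup>2 dvd D"
proof
  assume dvd: "(int p)\<^sup>2 dvd D"
  have "odd p" using assms prime_odd_nat[of p] prime_ge_2_nat[OF assms(1)] by auto
  then have "coprime ((int p)\<^sup>2) 4"
    using coprime_power_left_iff coprime_power_right_iff[of "int p" 2 2] by simp
  then have "(int p)\<^sup>2 dvd d"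
    using dvd by (auto simp: D_def coprime_dvd_mult_right_iff split: if_splits)
  then have "int p dvd 1" using squarefree_d by (auto simp: squarefree_def)
  then show False using assms(1) by auto
qed

text \<open>With t = 2 a + b D one has 4 N = t^2 - D b^2. If p divided neither b nor D, then t / b
  would be a square root of D modulo p.\<close>

lemma odd_prime_nonsplit_dvd:
  assumes p: "Factorial_Ring.prime (p::nat)" "p \<noteq> 2" and ns: "kronecker_prime D p \<noteq> 1"
    and dvd: "int p dvd N a b"
  shows "int p dvd 2 * a + b * D" "int p dvd b \<or> int p dvd D"
proof -
  let ?t = "2 * a + b * D"
  have ip: "Factorial_Ring.prime (int p)" using p(1) by simp
  have eq: "[?t\<^sup>2 = D * b\<^sup>2] (mod int p)"
    using dvd four_quadratic_norm[OF n_def, of a b]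
    by (metis cong_iff_dvd_diff dvd_mult)
  show *: "int p dvd b \<or> int p dvd D"
  proof (rule ccontr)
    assume neg: "\<not> ?thesis"
    then have "coprime b (int p)" using ip by (metis coprime_commute prime_imp_coprime)
    then obtain c where c: "[b * c = 1] (mod int p)" using cong_solve_coprime_int by blast
    have "[(?t * c)\<^sup>2 = D * b\<^sup>2 * c\<^sup>2] (mod int p)"
      using cong_mult[OF eq cong_refl[of "c\<^sup>2"]] by (simp add: power_mult_distrib)
    also have "D * b\<^sup>2 * c\<^sup>2 = D * (b * c)\<^sup>2" by (simp add: power_mult_distrib mult.assoc)
    also have "[D * (b * c)\<^sup>2 = D * 1\<^sup>2] (mod int p)" by (intro cong_mult cong_pow c cong_refl)
    finally have "QuadRes (int p) D" unfolding QuadRes_def by auto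
    then have "Legendre D (int p) = 1" using neg by (simp add: Legendre_def cong_0_iff)
    then show False using ns p(2) by (simp add: kronecker_prime_def)
  qed
  then have "int p dvd D * b\<^sup>2" by (auto intro: dvd_mult2 dvd_mult simp: power2_eq_square)
  then have "int p dvd ?t\<^sup>2" using eq cong_dvd_iff by blast
  then show "int p dvd ?t" using ip prime_dvd_power by blast
qed

text \<open>The first case is 2 ramified; the second is 2 inert, where D is 5 modulo 8.\<close>

lemma two_nonsplit_cases:
  assumes "kronecker_prime D 2 \<noteq> 1"
  obtains "D = 4 * d" "d mod 4 = 2 \<or> d mod 4 = 3" | "odd D" "odd n"
proof (cases "d mod 4 = 1")
  case True
  then have D: "D = d" by (simp add: D_def)
  have "D mod 8 = 5"
    using assms True unfolding kronecker_prime_def D by (auto split: if_splits) presburger+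
  then obtain k where k: "D = 8 * k + 5" by (metis mult_div_mod_eq)
  have "4 * n = 4 * ((8 * k + 5) * (2 * k + 1))"
    unfolding n_def k by (simp add: power2_eq_square algebra_simps)
  then have "n = (8 * k + 5) * (2 * k + 1)" by simp
  then have "odd n" by simp
  moreover have "odd D" using k by simp
  ultimately show thesis using that(2) by blast
next
  case False
  then have "d mod 4 = 2 \<or> d mod 4 = 3" using squarefree_int_mod_4[OF squarefree_d] by presburger
  then show thesis using that(1) False by (simp add: D_def)
qed

lemma norm_eq_if_four_dvd:
  assumes "D = 4 * d"
  shows "N a b = (a + 2 * b * d)\<^sup>2 - d * b\<^sup>2"
proof -
  have "4 * N a b = (2 * a + b * D)\<^sup>2 - D * b\<^sup>2" by (rule four_quadratic_norm[OF n_def])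
  also have "\<dots> = 4 * ((a + 2 * b * d)\<^sup>2 - d * b\<^sup>2)"
    by (simp add: assms power2_eq_square algebra_simps)
  finally have "4 * N a b = 4 * ((a + 2 * b * d)\<^sup>2 - d * b\<^sup>2)" .
  then show ?thesis by simp
qed

lemma even_norm_if_odd:
  assumes "odd D" "odd n" "even (N a b)"
  shows "even a \<and> even b"
  using assms by (auto simp: quadratic_norm_def)

text \<open>2 a + b D is the trace. When only one prime lies above p, it is stable under
  conjugation; it contains the element together with its conjugate, hence also the trace.\<close>

lemma nonsplit_dvd_trace:
  assumes p: "Factorial_Ring.prime (p::nat)" and ns: "kronecker_prime D p \<noteq> 1"
    and dvd: "int p dvd N a b"
  shows "int p dvd 2 * a + b * D"
proof (cases "p = 2")
  case True
  have "kronecker_prime D 2 \<noteq> 1" using ns True by simp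
  then show ?thesis
  proof (cases rule: two_nonsplit_cases)
    case 1
    have "2 * a + b * D = 2 * (a + 2 * b * d)" unfolding 1(1) by (simp add: algebra_simps)
    then have "2 dvd 2 * a + b * D" by (rule dvdI)
    then show ?thesis unfolding True by simp
  next
    case 2
    have "even (N a b)" using dvd unfolding True by simp
    then have "even a \<and> even b" by (rule even_norm_if_odd[OF 2])
    then show ?thesis unfolding True by simp
  qed
next
  case False
  then show ?thesis using odd_prime_nonsplit_dvd(1)[OF p False ns dvd] by simp
qed

text \<open>If p is inert, the exponent of p in a norm is twice the exponent of p in the element; if
  p is ramified, two factors of the prime above p make up p. For odd p the computation rests on p^2
  dividing D b^2 but not D.\<close>

lemma nonsplit_square_dvd:
  assumes p: "Factorial_Ring.prime (p::nat)" and ns: "kronecker_prime D p \<noteq> 1"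
    and dvd: "(int p)\<^sup>2 dvd N a b"
  shows "int p dvd a \<and> int p dvd b"
proof (cases "p = 2")
  case True
  have dvd4: "4 dvd N a b" using dvd True by simp
  have "kronecker_prime D 2 \<noteq> 1" using ns True by simp
  then show ?thesis
  proof (cases rule: two_nonsplit_cases)
    case 1
    have "4 dvd (a + 2 * b * d)\<^sup>2 - d * b\<^sup>2"
      using dvd4 unfolding norm_eq_if_four_dvd[OF 1(1)] .
    then have "even (a + 2 * b * d) \<and> even b" by (rule four_dvd_square_diff[OF _ 1(2)])
    then show ?thesis unfolding True by simp
  next
    case 2
    have "even (N a b)" using dvd4 dvd_trans[of 2 4 "N a b"] by simp
    then have "even a \<and> even b" by (rule even_norm_if_odd[OF 2])
    then show ?thesis unfolding True by simp
  qed
next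
  case False
  let ?t = "2 * a + b * D"
  have ip: "Factorial_Ring.prime (int p)" using p(1) by simp
  have "int p dvd N a b" using dvd unfolding power2_eq_square by (rule dvd_mult_left)
  note t = odd_prime_nonsplit_dvd[OF p False ns this]
  have "(int p)\<^sup>2 dvd ?t\<^sup>2" using t(1) by simp
  moreover have "D * b\<^sup>2 = ?t\<^sup>2 - 4 * N a b" using four_quadratic_norm[OF n_def, of a b] by linarith
  ultimately have Db: "(int p)\<^sup>2 dvd D * b\<^sup>2" using dvd by (metis dvd_diff dvd_mult)
  have b: "int p dvd b"
  proof (rule ccontr)
    assume "\<not> int p dvd b"
    then have "coprime ((int p)\<^sup>2) (b\<^sup>2)" using ip by (simp add: prime_imp_coprime)
    then have "(int p)\<^sup>2 dvd D" using Db by (simp add: coprime_dvd_mult_left_iff)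
    then show False using not_square_dvd_D[OF p False] by blast
  qed
  have "int p dvd ?t - b * D" using t(1) b by (intro dvd_diff dvd_mult2)
  then have "int p dvd 2 * a" by simp
  moreover have "\<not> int p dvd 2"
  proof
    assume "int p dvd 2"
    then have "int p dvd int 2" by simp
    then have "p dvd 2" by (simp only: int_dvd_int_iff)
    then show False using False primes_dvd_imp_eq[OF p two_is_prime_nat] by simp
  qed
  ultimately have "int p dvd a" using ip prime_dvd_mult_iff by blast
  then show ?thesis using b by blast
qed

lemma nonsplit_power_dvd:
  assumes p: "Factorial_Ring.prime (p::nat)" and ns: "kronecker_prime D p \<noteq> 1"
    and dvd: "int p ^ (2 * k) dvd N a b"
  shows "int p ^ k dvd a \<and> int p ^ k dvd b"
  using dvd
proof (induction k arbitrary: a b)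
  case (Suc k)
  have p0: "int p \<noteq> 0" using p by auto
  have pow: "int p ^ (2 * Suc k) = (int p)\<^sup>2 * int p ^ (2 * k)" by (simp add: power2_eq_square)
  have "(int p)\<^sup>2 dvd N a b" using Suc.prems unfolding pow by (rule dvd_mult_left)
  then obtain a' b' where ab: "a = int p * a'" "b = int p * b'"
    using nonsplit_square_dvd[OF p ns] by blast
  have "N a b = (int p)\<^sup>2 * N a' b'"
    unfolding ab quadratic_norm_def by (simp add: power2_eq_square algebra_simps)
  then have "(int p)\<^sup>2 * int p ^ (2 * k) dvd (int p)\<^sup>2 * N a' b'"
    using Suc.prems unfolding pow by simp
  then have "int p ^ (2 * k) dvd N a' b'" using p0 by simp
  then show ?case using Suc.IH unfolding ab by simp
qed simp

text \<open>r is (D + y)/2 for a square root y of D modulo p, where (p + 1)/2 serves as the inverse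
  of 2. For p = 2, D is 1 modulo 8, n is even and 0 is a root. As 2 r - D is the derivative, the
  second conjunct says that the root is simple, which lifting requires.\<close>

lemma split_root:
  assumes p: "Factorial_Ring.prime (p::nat)" and split: "kronecker_prime D p = 1"
  shows "\<exists>r. int p dvd r\<^sup>2 - D * r + n \<and> \<not> int p dvd 2 * r - D"
proof (cases "p = 2")
  case True
  \<comment> \<open>The symbol is also 1 for the residue 7, which is excluded because D is 0 or 1
    modulo 4.\<close>
  have "D mod 8 = 1"
    using split D_mod_4 unfolding True kronecker_prime_def by (auto split: if_splits) presburger+
  then obtain k where k: "D = 8 * k + 1" by (metis mult_div_mod_eq)
  have "4 * n = 4 * ((8 * k + 1) * (2 * k))"
    unfolding n_def k by (simp add: power2_eq_square algebra_simps)
  then have "n = (8 * k + 1) * (2 * k)" by simp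
  then have "even n" by simp
  then show ?thesis using k True by (intro exI[of _ 0]) simp
next
  case False
  have ip: "Factorial_Ring.prime (int p)" using p(1) by simp
  have "Legendre D (int p) = 1" using split False by (simp add: kronecker_prime_def)
  then have "\<not> [D = 0] (mod int p)" "QuadRes (int p) D"
    by (auto simp: Legendre_def split: if_splits)
  then obtain y where y: "[y\<^sup>2 = D] (mod int p)" and D0: "\<not> int p dvd D"
    by (auto simp: QuadRes_def cong_0_iff)
  have "odd p" using p False prime_odd_nat[of p] prime_ge_2_nat[OF p] by auto
  then obtain h where h: "p + 1 = 2 * h" by (metis dvdE even_plus_one_iff)
  define r where "r = (D + y) * int h"
  have "2 * r = (D + y) * int (2 * h)" by (simp add: r_def)
  then have two_r: "2 * r - D = y + int p * (D + y)"
    unfolding h[symmetric] by (simp add: algebra_simps)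
  have py: "\<not> int p dvd y"
  proof
    assume "int p dvd y"
    then have "int p dvd y\<^sup>2" by (simp add: power2_eq_square)
    then show False using y D0 cong_dvd_iff by blast
  qed
  have "4 * (r\<^sup>2 - D * r + n) = (2 * r - D)\<^sup>2 - D"
    using n_def by (simp add: power2_eq_square algebra_simps)
  also have "\<dots> = (y\<^sup>2 - D) + int p * ((D + y) * (2 * y + int p * (D + y)))"
    unfolding two_r by (simp add: power2_eq_square algebra_simps)
  also have "int p dvd \<dots>" using y by (simp add: cong_iff_dvd_diff)
  finally have "int p dvd 4 * (r\<^sup>2 - D * r + n)" .
  moreover have "coprime (int p) 4"
    using \<open>odd p\<close> coprime_power_right_iff[of "int p" 2 2] by simp
  ultimately have "int p dvd r\<^sup>2 - D * r + n" using coprime_dvd_mult_right_iff by blast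
  moreover have "\<not> int p dvd 2 * r - D" 
    unfolding two_r using py dvd_add_left_iff[OF dvd_triv_left] by blast
  ultimately show ?thesis by blast
qed

text \<open>Hensel lifting: v inverts the derivative modulo p, and each Newton correction gains one
  power of p.\<close>

lemma split_root_mod_power:
  assumes p: "Factorial_Ring.prime (p::nat)" and split: "kronecker_prime D p = 1"
  shows "\<exists>r. int p ^ Suc k dvd r\<^sup>2 - D * r + n \<and> \<not> int p dvd 2 * r - D"
proof (induction k)
  case 0
  show ?case using split_root[OF assms] by simp
next
  case (Suc k)
  then obtain r where r: "int p ^ Suc k dvd r\<^sup>2 - D * r + n" "\<not> int p dvd 2 * r - D" by blast
  have ip: "Factorial_Ring.prime (int p)" using p(1) by simp
  obtain u where u: "r\<^sup>2 - D * r + n = int p ^ Suc k * u" using r(1) by blast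
  have "coprime (2 * r - D) (int p)" using ip r(2) by (metis coprime_commute prime_imp_coprime)
  then obtain v where v: "[(2 * r - D) * v = 1] (mod int p)" using cong_solve_coprime_int by blast
  define s where "s = r - int p ^ Suc k * (u * v)"
  have "s\<^sup>2 - D * s + n = (r\<^sup>2 - D * r + n) - (2 * r - D) * (int p ^ Suc k * (u * v))
      + (int p ^ Suc k * (u * v))\<^sup>2"
    unfolding s_def by (simp add: power2_eq_square algebra_simps)
  also have "\<dots> = int p ^ Suc k * (u * (1 - (2 * r - D) * v) + int p ^ Suc k * (u * v)\<^sup>2)"
    unfolding u by (simp add: power2_eq_square algebra_simps)
  finally have eq: "s\<^sup>2 - D * s + n =
      int p ^ Suc k * (u * (1 - (2 * r - D) * v) + int p ^ Suc k * (u * v)\<^sup>2)" .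
  have "int p dvd 1 - (2 * r - D) * v"
    using v by (simp add: cong_iff_dvd_diff dvd_diff_commute)
  then have "int p dvd u * (1 - (2 * r - D) * v) + int p ^ Suc k * (u * v)\<^sup>2" by simp
  then have "int p ^ Suc k * int p dvd s\<^sup>2 - D * s + n" unfolding eq by (intro mult_dvd_mono) auto
  moreover have "2 * s - D = (2 * r - D) - int p * (2 * int p ^ k * (u * v))"
    unfolding s_def by (simp add: algebra_simps)
  then have "\<not> int p dvd 2 * s - D"
    using r(2) by (metis dvd_diff_left_iff dvd_triv_left)
  ultimately show ?case by (intro exI[of _ s]) (simp add: mult.commute)
qed

end

text \<open>The integers are completely integrally closed: after division by the gcd, every power of
  the remaining factor a' of a divides c, which for \<bar>a'\<bar> \<ge> 2 fails by size at the
  exponent \<bar>c\<bar>.\<close>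

lemma dvd_if_powers_dvd:
  fixes a b c :: int
  assumes c: "c \<noteq> 0" and a: "a \<noteq> 0" and dvd: "\<And>k. a ^ k dvd c * b ^ k"
  shows "a dvd b"
proof -
  define g where "g = gcd a b"
  have g: "g \<noteq> 0" using a by (simp add: g_def)
  obtain a' b' where ab: "a = g * a'" "b = g * b'" "coprime a' b'"
    using gcd_coprime_exists[of a b] g unfolding g_def by (auto simp: mult.commute)
  have "a' ^ k dvd c" for k
  proof -
    have "g ^ k * a' ^ k dvd g ^ k * (c * b' ^ k)"
      using dvd[of k] unfolding ab by (simp add: power_mult_distrib mult_ac)
    then have "a' ^ k dvd c * b' ^ k" using g by simp
    then show ?thesis using ab(3) by (simp add: coprime_dvd_mult_left_iff)
  qed
  then have "\<bar>a'\<bar> ^ k \<le> \<bar>c\<bar>" for k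
    using c dvd_imp_le_int[of c "a' ^ k"] by (simp add: power_abs)
  then have le: "\<bar>a'\<bar> ^ nat \<bar>c\<bar> \<le> \<bar>c\<bar>" .
  have "\<not> \<bar>a'\<bar> \<ge> 2"
  proof
    assume "\<bar>a'\<bar> \<ge> 2"
    then have "2 ^ nat \<bar>c\<bar> \<le> \<bar>a'\<bar> ^ nat \<bar>c\<bar>" by (intro power_mono) auto
    moreover have "int (nat \<bar>c\<bar>) < 2 ^ nat \<bar>c\<bar>" by (rule of_nat_less_two_power)
    ultimately show False using le by simp
  qed
  then have "is_unit a'" using a ab(1) by auto
  then have "a' dvd b'" by (rule unit_imp_dvd)
  then show ?thesis unfolding ab(1,2) by (rule mult_dvd_mono[OF dvd_refl])
qed

lemma dvd_if_square_dvd_squarefree_mult: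
  fixes m y d :: int
  assumes d: "squarefree d" and m: "m \<noteq> 0" and dvd: "m\<^sup>2 dvd d * y\<^sup>2"
  shows "m dvd y"
proof -
  define g where "g = gcd m y"
  have g: "g \<noteq> 0" using m by (simp add: g_def)
  obtain a' b' where ab: "m = g * a'" "y = g * b'" "coprime a' b'"
    using gcd_coprime_exists[of m y] g unfolding g_def by (auto simp: mult.commute)
  have "g\<^sup>2 * a'\<^sup>2 dvd g\<^sup>2 * (d * b'\<^sup>2)"
    using dvd unfolding ab by (simp add: power_mult_distrib mult_ac)
  then have "a'\<^sup>2 dvd d * b'\<^sup>2" using g by simp
  then have "a'\<^sup>2 dvd d" using ab(3) by (simp add: coprime_dvd_mult_left_iff)
  then have "is_unit a'" using d by (auto simp: squarefree_def)
  then have "a' dvd b'" by (rule unit_imp_dvd)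
  then show ?thesis unfolding ab(1,2) by (rule mult_dvd_mono[OF dvd_refl])
qed

text \<open>A rational square class has only one squarefree representative; the definite description
  of the radicand depends on it.\<close>

lemma squarefree_times_square_unique:
  fixes d e m y :: int
  assumes d: "squarefree d" and e: "squarefree e" and m: "m \<noteq> 0" and eq: "m\<^sup>2 * e = y\<^sup>2 * d"
  shows "e = d"
proof -
  have y: "y \<noteq> 0"
  proof
    assume "y = 0"
    then have "e = 0" using eq m by simp
    then show False using e by simp
  qed
  have "m dvd y"
    by (rule dvd_if_square_dvd_squarefree_mult[OF d m]) (simp add: mult.commute[of d] eq[symmetric])
  moreover have "y dvd m"
    by (rule dvd_if_square_dvd_squarefree_mult[OF e y]) (simp add: mult.commute[of e] eq)
  ultimately have "\<bar>m\<bar> = \<bar>y\<bar>" by (rule zdvd_antisym_abs)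
  then have "m\<^sup>2 = y\<^sup>2" by (metis power2_abs)
  then show ?thesis using eq y by simp
qed

section \<open>Quadratic number fields\<close>

definition Z_embed :: "('a, 'b) ring_scheme \<Rightarrow> int \<Rightarrow> 'a"
  where "Z_embed K n = add_pow K n \<one>\<^bsub>K\<^esub>"

context cring
begin

lemma Z_embed_closed [simp]: "Z_embed R n \<in> carrier R"
  by (simp add: Z_embed_def)

lemma Z_embed_0 [simp]: "Z_embed R 0 = \<zero>"
  by (simp add: Z_embed_def add_pow_def int_pow_def2)

lemma Z_embed_1 [simp]: "Z_embed R 1 = \<one>"
  by (simp add: Z_embed_def)

lemma Z_embed_add: "Z_embed R (m + n) = Z_embed R m \<oplus> Z_embed R n"
  unfolding Z_embed_def by (simp add: add.int_pow_mult)

lemma Z_embed_minus: "Z_embed R (- n) = \<ominus> Z_embed R n"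
  unfolding Z_embed_def by (simp add: add.int_pow_neg)

lemma Z_embed_mult: "Z_embed R (m * n) = Z_embed R m \<otimes> Z_embed R n"
proof -
  have "Z_embed R m \<otimes> Z_embed R n = [m] \<cdot> ([n] \<cdot> \<one>)"
    unfolding Z_embed_def by (simp add: add_pow_ldistr_int)
  also have "\<dots> = [(n * m)] \<cdot> \<one>" by (simp add: add.int_pow_pow)
  finally show ?thesis by (simp add: Z_embed_def mult.commute)
qed

lemma Z_embed_of_nat: "Z_embed R (int n) = [n] \<cdot> \<one>"
  unfolding Z_embed_def by (simp add: add_pow_def int_pow_int)

lemma Z_embed_power: "Z_embed R (m ^ k) = Z_embed R m [^] (k::nat)"
  by (induction k) (simp_all add: Z_embed_mult m_comm)

lemma Z_embed_mem_subring:
  assumes "subring S R"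
  shows "Z_embed R n \<in> S"
proof -
  have "Z_embed R (int k) \<in> S" for k
    by (induction k) (simp_all add: Z_embed_add subringE(2,3,7)[OF assms])
  then show ?thesis using subringE(5)[OF assms] by (cases n rule: int_cases2) (auto simp: Z_embed_minus)
qed

end

lemma integers_in_eq: "integers_in K = range (Z_embed K)"
  by (simp add: integers_in_def Z_embed_def)

text \<open>w is a square root of d. Rational coefficients are avoided by clearing denominators in
  \<open>spanning\<close>, so that the later computations take place over the integers.\<close>

locale quadratic_field_root = field K for K (structure) +
  fixes w :: 'a and d :: int
  assumes w_closed: "w \<in> carrier K" and w_square: "w \<otimes> w = Z_embed K d"
    and squarefree_d: "squarefree d"
    and char_0: "\<And>n. Z_embed K n = \<zero> \<Longrightarrow> n = 0"
    and w_irrational: "w \<notin> prime_subfield K"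
    and spanning: "\<And>x. x \<in> carrier K \<Longrightarrow>
      \<exists>n p q. n \<noteq> 0 \<and> Z_embed K n \<otimes> x = Z_embed K p \<oplus> Z_embed K q \<otimes> w"

lemma (in field) prime_subfield_fraction:
  assumes char_0: "\<And>n. Z_embed R n = \<zero> \<Longrightarrow> n = 0" and x: "x \<in> prime_subfield R"
  shows "\<exists>a b. b \<noteq> 0 \<and> Z_embed R b \<otimes> x = Z_embed R a"
  using x unfolding prime_subfield_def
proof (induction rule: generate_field.induct)
  case one
  show ?case by (intro exI[of _ 1]) simp
next
  case (a_inv h)
  then obtain a b where ab: "b \<noteq> 0" "Z_embed R b \<otimes> h = Z_embed R a" by blast
  have "h \<in> carrier R" using a_inv generate_field_in_carrier[of "{}"] by simp
  then have "Z_embed R b \<otimes> (\<ominus> h) = Z_embed R (- a)" using ab(2) by (simp add: r_minus Z_embed_minus)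
  then show ?case using ab(1) by blast
next
  case (m_inv h)
  then obtain a b where ab: "b \<noteq> 0" "Z_embed R b \<otimes> h = Z_embed R a" by blast
  have h: "h \<in> carrier R" using m_inv generate_field_in_carrier[of "{}"] by simp
  then have hU: "h \<in> Units R" using m_inv.hyps(2) field_Units by blast
  have "Z_embed R b \<noteq> \<zero>" using ab(1) char_0 by blast
  then have "Z_embed R a \<noteq> \<zero>" unfolding ab(2)[symmetric] using h m_inv.hyps(2) by (simp add: integral_iff)
  then have "a \<noteq> 0" by auto
  moreover have "Z_embed R a \<otimes> inv h = Z_embed R b"
    unfolding ab(2)[symmetric] using h hU by (simp add: m_assoc)
  ultimately show ?case by blast
next
  case (eng_add h1 h2)
  then obtain a b a' b' where ab: "b \<noteq> 0" "Z_embed R b \<otimes> h1 = Z_embed R a"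
    "b' \<noteq> 0" "Z_embed R b' \<otimes> h2 = Z_embed R a'" by blast
  have h: "h1 \<in> carrier R" "h2 \<in> carrier R"
    using eng_add generate_field_in_carrier[of "{}"] by auto
  have "Z_embed R (b * b') \<otimes> (h1 \<oplus> h2) =
      Z_embed R b' \<otimes> (Z_embed R b \<otimes> h1) \<oplus> Z_embed R b \<otimes> (Z_embed R b' \<otimes> h2)"
    using h by (simp add: Z_embed_mult r_distr m_ac)
  also have "\<dots> = Z_embed R (b' * a + b * a')" unfolding ab by (simp add: Z_embed_mult Z_embed_add)
  finally show ?case using ab(1,3) by (intro exI[of _ "b' * a + b * a'"] exI[of _ "b * b'"]) simp
next
  case (eng_mult h1 h2)
  then obtain a b a' b' where ab: "b \<noteq> 0" "Z_embed R b \<otimes> h1 = Z_embed R a"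
    "b' \<noteq> 0" "Z_embed R b' \<otimes> h2 = Z_embed R a'" by blast
  have h: "h1 \<in> carrier R" "h2 \<in> carrier R"
    using eng_mult generate_field_in_carrier[of "{}"] by auto
  have "Z_embed R (b * b') \<otimes> (h1 \<otimes> h2) = (Z_embed R b \<otimes> h1) \<otimes> (Z_embed R b' \<otimes> h2)"
    using h by (simp add: Z_embed_mult m_ac)
  also have "\<dots> = Z_embed R (a * a')" unfolding ab by (simp add: Z_embed_mult)
  finally show ?case using ab(1,3) by (intro exI[of _ "a * a'"] exI[of _ "b * b'"]) simp
qed simp

lemma (in field) prime_subfield_fractionI:
  assumes "x \<in> carrier R" "Z_embed R b \<noteq> \<zero>" "Z_embed R b \<otimes> x = Z_embed R a"
  shows "x \<in> prime_subfield R"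
proof -
  have sf: "subfield (prime_subfield R) R"
    unfolding prime_subfield_def by (rule generate_field_is_subfield) simp
  have Z: "Z_embed R n \<in> prime_subfield R" for n
    by (rule Z_embed_mem_subring[OF subfieldE(1)[OF sf]])
  have U: "Z_embed R b \<in> Units R" using assms(2) field_Units by simp
  have "x = inv (Z_embed R b) \<otimes> (Z_embed R b \<otimes> x)"
    using assms(1) U by (simp add: m_assoc[symmetric])
  then have "x = inv (Z_embed R b) \<otimes> Z_embed R a" unfolding assms(3) .
  moreover have "inv (Z_embed R b) \<in> prime_subfield R"
    using subfield_m_inv(1)[OF sf, of "Z_embed R b"] Z assms(2) by simp
  ultimately show ?thesis using Z subringE(6)[OF subfieldE(1)[OF sf]] by simp
qed

text \<open>Let t be the quotient of two basis vectors. A relation n t^2 = p + q t becomes (2 n t -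
  q)^2 = 4 n p + q^2; with the right-hand side written as d k^2, d squarefree, w is (2 n t -
  q)/k.\<close>

lemma quadratic_field_root_exists:
  fixes K (structure)
  assumes "quadratic_number_field K"
  shows "\<exists>w d. quadratic_field_root K w d"
proof -
  interpret field K using assms by (simp add: quadratic_number_field_def)
  let ?\<iota> = "Z_embed K" and ?Q = "prime_subfield K"
  have char_0: "n = 0" if "?\<iota> n = \<zero>" for n
  proof (rule ccontr)
    assume "n \<noteq> 0"
    then have pos: "nat \<bar>n\<bar> > 0" by simp
    have "?\<iota> (int (nat \<bar>n\<bar>)) = \<zero>"
      using that Z_embed_minus[of n] by (cases "n \<ge> 0") auto
    then have "add_pow K (nat \<bar>n\<bar>) \<one> = \<zero>" unfolding Z_embed_of_nat .
    then show False using assms pos unfolding quadratic_number_field_def by blast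
  qed
  have sf: "subfield ?Q K" unfolding prime_subfield_def by (rule generate_field_is_subfield) simp
  have QK: "?Q \<subseteq> carrier K" by (rule subfieldE(3)[OF sf])
  have "dimension (Suc (Suc 0)) ?Q (carrier K)"
    using assms by (simp add: quadratic_number_field_def numeral_2_eq_2)
  then obtain v E where v: "v \<in> carrier K" "v \<notin> E" "dimension (Suc 0) ?Q E"
    "carrier K = line_extension ?Q v E"
    by (cases rule: dimension.cases) auto
  from v(3) obtain u where u: "u \<in> carrier K" "u \<noteq> \<zero>" "E = line_extension ?Q u {\<zero>}"
    by (cases rule: dimension.cases) (auto elim: dimension.cases)
  have uU: "u \<in> Units K" using u field_Units by blast
  define t where "t = v \<otimes> inv u"
  have tK: "t \<in> carrier K" using v(1) uU by (simp add: t_def)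
  have E_mem: "q \<otimes> u \<in> E" if "q \<in> ?Q" for q
    unfolding u(3) line_extension_mem_iff using that QK u(1) by (intro bexI[of _ q] bexI[of _ "\<zero>"]) auto
  have t_irr: "t \<notin> ?Q"
  proof
    assume "t \<in> ?Q"
    then have "t \<otimes> u \<in> E" by (rule E_mem)
    moreover have "t \<otimes> u = v" using v(1) u(1) uU by (simp add: t_def m_assoc)
    ultimately show False using v(2) by simp
  qed
  have span_Q: "\<exists>q1\<in>?Q. \<exists>q2\<in>?Q. x = q1 \<otimes> t \<oplus> q2" if x: "x \<in> carrier K" for x
  proof -
    have "x \<otimes> u \<in> line_extension ?Q v E" using x u(1) v(4) by auto
    then obtain q1 q2 where q: "q1 \<in> ?Q" "q2 \<in> ?Q" "x \<otimes> u = q1 \<otimes> v \<oplus> (q2 \<otimes> u \<oplus> \<zero>)"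
      unfolding u(3) by (auto simp: line_extension_mem_iff)
    have qK: "q1 \<in> carrier K" "q2 \<in> carrier K" using q QK by auto
    have "x = (x \<otimes> u) \<otimes> inv u" using x u(1) uU by (simp add: m_assoc)
    also have "\<dots> = q1 \<otimes> t \<oplus> q2"
      unfolding q(3) t_def using qK v(1) u(1) uU by (simp add: l_distr m_assoc)
    finally show ?thesis using q by blast
  qed
  have span_Z: "\<exists>n p q. n \<noteq> 0 \<and> ?\<iota> n \<otimes> x = ?\<iota> p \<oplus> ?\<iota> q \<otimes> t"
    if x: "x \<in> carrier K" for x
  proof -
    obtain q1 q2 where q: "q1 \<in> ?Q" "q2 \<in> ?Q" "x = q1 \<otimes> t \<oplus> q2" using span_Q[OF x] by blast
    have qK: "q1 \<in> carrier K" "q2 \<in> carrier K" using q QK by auto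
    obtain a b where ab: "b \<noteq> 0" "?\<iota> b \<otimes> q1 = ?\<iota> a"
      using prime_subfield_fraction[OF char_0 q(1)] by blast
    obtain a' b' where ab': "b' \<noteq> 0" "?\<iota> b' \<otimes> q2 = ?\<iota> a'"
      using prime_subfield_fraction[OF char_0 q(2)] by blast
    have "?\<iota> (b * b') \<otimes> x =
        ?\<iota> b \<otimes> (?\<iota> b' \<otimes> q2) \<oplus> (?\<iota> b' \<otimes> (?\<iota> b \<otimes> q1)) \<otimes> t"
      unfolding q(3) using qK tK by (simp add: Z_embed_mult r_distr m_ac a_ac)
    also have "\<dots> = ?\<iota> (b * a') \<oplus> ?\<iota> (b' * a) \<otimes> t"
      unfolding ab(2) ab'(2) by (simp add: Z_embed_mult)
    finally show ?thesis using ab(1) ab'(1) by (intro exI[of _ "b * b'"] exI) auto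
  qed
  obtain n p q where npq: "n \<noteq> 0" "?\<iota> n \<otimes> (t \<otimes> t) = ?\<iota> p \<oplus> ?\<iota> q \<otimes> t"
    using span_Z[of "t \<otimes> t"] tK by auto
  define h where "h = ?\<iota> (2 * n) \<otimes> t \<oplus> ?\<iota> (- q)"
  have hK: "h \<in> carrier K" using tK by (simp add: h_def)
  define m where "m = 4 * n * p + q * q"
  have hh: "h \<otimes> h = ?\<iota> m"
  proof -
    have e1: "h \<otimes> h = (?\<iota> (2 * n) \<otimes> ?\<iota> (2 * n)) \<otimes> (t \<otimes> t) \<oplus>
        ((?\<iota> (2 * n) \<otimes> ?\<iota> (- q)) \<otimes> t \<oplus> (?\<iota> (2 * n) \<otimes> ?\<iota> (- q)) \<otimes> t
        \<oplus> ?\<iota> (- q) \<otimes> ?\<iota> (- q))"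
      unfolding h_def using tK Z_embed_closed[of "2 * n"] Z_embed_closed[of "- q"]
      by (simp add: l_distr r_distr m_ac a_ac)
    have e2: "(?\<iota> (2 * n) \<otimes> ?\<iota> (2 * n)) \<otimes> (t \<otimes> t) =
        ?\<iota> (4 * n * p) \<oplus> ?\<iota> (4 * n * q) \<otimes> t"
    proof -
      have "?\<iota> (2 * n) \<otimes> ?\<iota> (2 * n) = ?\<iota> (4 * n) \<otimes> ?\<iota> n"
        by (simp add: Z_embed_mult[symmetric] mult.assoc)
      then have "(?\<iota> (2 * n) \<otimes> ?\<iota> (2 * n)) \<otimes> (t \<otimes> t) =
          ?\<iota> (4 * n) \<otimes> (?\<iota> n \<otimes> (t \<otimes> t))" using tK by (simp add: m_assoc)
      then show ?thesis
        unfolding npq(2) using tK by (simp add: Z_embed_mult[of "4 * n"] r_distr m_assoc)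
    qed
    have e3: "(?\<iota> (2 * n) \<otimes> ?\<iota> (- q)) \<otimes> t \<oplus> (?\<iota> (2 * n) \<otimes> ?\<iota> (- q)) \<otimes> t =
        ?\<iota> (- (4 * n * q)) \<otimes> t"
    proof -
      have "?\<iota> (- (4 * n * q)) = ?\<iota> (2 * n * (- q) + 2 * n * (- q))" by (simp add: mult.assoc)
      also have "\<dots> = ?\<iota> (2 * n) \<otimes> ?\<iota> (- q) \<oplus> ?\<iota> (2 * n) \<otimes> ?\<iota> (- q)"
        unfolding Z_embed_add Z_embed_mult[of "2 * n"] ..
      finally show ?thesis using tK by (simp add: l_distr)
    qed
    have e4: "?\<iota> (- q) \<otimes> ?\<iota> (- q) = ?\<iota> (q * q)" by (simp add: Z_embed_mult[symmetric])
    have "h \<otimes> h = (?\<iota> (4 * n * p) \<oplus> ?\<iota> (4 * n * q) \<otimes> t) \<oplus>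
        (\<ominus> (?\<iota> (4 * n * q) \<otimes> t) \<oplus> ?\<iota> (q * q))"
      unfolding e1 e2 e3 e4 Z_embed_minus[of "4 * n * q"] using tK by (simp add: l_minus)
    also have "\<dots> = ?\<iota> (4 * n * p) \<oplus> ?\<iota> (q * q)"
      using tK by (simp add: a_assoc r_neg1 r_neg2)
    finally show ?thesis by (simp add: m_def Z_embed_add)
  qed
  have "?\<iota> (2 * n) \<noteq> \<zero>" using char_0 npq(1) by force
  have h_irr: "h \<notin> ?Q"
  proof
    assume "h \<in> ?Q"
    then obtain a b where ab: "b \<noteq> 0" "?\<iota> b \<otimes> h = ?\<iota> a" using prime_subfield_fraction[OF char_0] by blast
    have "?\<iota> b \<otimes> h = ?\<iota> (b * (2 * n)) \<otimes> t \<oplus> ?\<iota> (b * (- q))"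
      unfolding h_def Z_embed_mult[of b] using tK by (simp add: r_distr m_assoc)
    then have "?\<iota> (b * (2 * n)) \<otimes> t = ?\<iota> a \<oplus> \<ominus> ?\<iota> (b * (- q))"
      unfolding ab(2) using tK by (simp add: a_assoc r_neg)
    then have "?\<iota> (b * (2 * n)) \<otimes> t = ?\<iota> (a + b * q)" by (simp add: Z_embed_add Z_embed_minus)
    moreover have "?\<iota> (b * (2 * n)) \<noteq> \<zero>" using char_0 ab(1) npq(1) by force
    ultimately show False using t_irr prime_subfield_fractionI[OF tK] by blast
  qed
  have "m \<noteq> 0"
  proof
    assume "m = 0"
    then have "h = \<zero>" using hh hK by (simp add: integral_iff)
    then show False using h_irr subringE(2)[OF subfieldE(1)[OF sf]] by simp
  qed
  define k d where "k = square_part m" and "d = squarefree_part m"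
  have mk: "m = d * k\<^sup>2" unfolding k_def d_def by (rule squarefree_decompose)
  have k0: "k \<noteq> 0" using \<open>m \<noteq> 0\<close> mk by auto
  then have \<iota>k: "?\<iota> k \<noteq> \<zero>" using char_0 by blast
  then have kU: "?\<iota> k \<in> Units K" using field_Units by simp
  define w where "w = h \<otimes> inv (?\<iota> k)"
  have wK: "w \<in> carrier K" using hK kU by (simp add: w_def)
  have kw: "?\<iota> k \<otimes> w = h"
    unfolding w_def using hK kU by (simp add: m_lcomm[of "?\<iota> k" h])
  have ww: "w \<otimes> w = ?\<iota> d"
  proof -
    have "?\<iota> (k * k) \<otimes> (w \<otimes> w) = h \<otimes> h"
      unfolding kw[symmetric] using wK by (simp add: Z_embed_mult m_ac)
    also have "\<dots> = ?\<iota> (k * k) \<otimes> ?\<iota> d"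
      unfolding hh mk by (simp add: Z_embed_mult[symmetric] power2_eq_square mult_ac)
    finally show ?thesis
      using m_lcancel[of "?\<iota> (k * k)" "w \<otimes> w" "?\<iota> d"] wK char_0[of "k * k"] k0 by auto
  qed
  have w_irr: "w \<notin> ?Q"
  proof
    assume "w \<in> ?Q"
    then have "?\<iota> k \<otimes> w \<in> ?Q"
      using subringE(6)[OF subfieldE(1)[OF sf]] Z_embed_mem_subring[OF subfieldE(1)[OF sf]] by blast
    then show False unfolding kw using h_irr by blast
  qed
  have span_w: "\<exists>n p q. n \<noteq> 0 \<and> ?\<iota> n \<otimes> x = ?\<iota> p \<oplus> ?\<iota> q \<otimes> w"
    if x: "x \<in> carrier K" for x
  proof -
    obtain n' p' q' where npq': "n' \<noteq> 0" "?\<iota> n' \<otimes> x = ?\<iota> p' \<oplus> ?\<iota> q' \<otimes> t"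
      using span_Z[OF x] by blast
    have nt: "?\<iota> (2 * n) \<otimes> t = ?\<iota> k \<otimes> w \<oplus> ?\<iota> q"
      unfolding kw h_def Z_embed_minus using tK by (simp add: a_assoc l_neg)
    have "?\<iota> (2 * n * n') \<otimes> x = ?\<iota> (2 * n) \<otimes> (?\<iota> n' \<otimes> x)"
      using x by (simp add: Z_embed_mult[of "2 * n"] m_assoc)
    also have "\<dots> = ?\<iota> (2 * n) \<otimes> ?\<iota> p' \<oplus> ?\<iota> q' \<otimes> (?\<iota> (2 * n) \<otimes> t)"
      unfolding npq'(2) using tK by (simp add: r_distr m_lcomm)
    also have "\<dots> = (?\<iota> (2 * n) \<otimes> ?\<iota> p' \<oplus> ?\<iota> q' \<otimes> ?\<iota> q) \<oplus> (?\<iota> q' \<otimes> ?\<iota> k) \<otimes> w"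
      unfolding nt using wK Z_embed_closed[of "2 * n"] by (simp add: r_distr m_assoc a_ac)
    also have "\<dots> = ?\<iota> (2 * n * p' + q' * q) \<oplus> ?\<iota> (q' * k) \<otimes> w"
      by (simp add: Z_embed_add Z_embed_mult[of "2 * n"] Z_embed_mult[of q'])
    finally show ?thesis using npq(1) npq'(1) by (intro exI[of _ "2 * n * n'"] exI) auto
  qed
  have "quadratic_field_root K w d"
  proof
    show "squarefree d" by (simp add: d_def squarefree_squarefree_part \<open>m \<noteq> 0\<close>)
  qed (use wK ww char_0 w_irr span_w in auto)
  then show ?thesis by blast
qed

section \<open>Coordinates with respect to 1 and the square root of d\<close>

context quadratic_field_root
begin

abbreviation embed_int ("\<iota>") where "\<iota> \<equiv> Z_embed K"

definition coord :: "int \<Rightarrow> int \<Rightarrow> 'a"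
  where "coord p q = \<iota> p \<oplus> \<iota> q \<otimes> w"

lemma coord_closed [simp]: "coord p q \<in> carrier K"
  using w_closed by (simp add: coord_def)

lemma coord_add: "coord p q \<oplus> coord p' q' = coord (p + p') (q + q')"
  using w_closed by (simp add: coord_def Z_embed_add l_distr a_ac)

lemma coord_int: "\<iota> n = coord n 0"
  using w_closed by (simp add: coord_def)

lemma coord_mult: "coord p q \<otimes> coord p' q' = coord (p * p' + d * q * q') (p * q' + p' * q)"
proof -
  have "coord p q \<otimes> coord p' q' = (\<iota> p \<otimes> \<iota> p' \<oplus> (\<iota> q \<otimes> \<iota> q') \<otimes> (w \<otimes> w)) \<oplus>
      (\<iota> p \<otimes> \<iota> q' \<oplus> \<iota> p' \<otimes> \<iota> q) \<otimes> w"
    using w_closed by (simp add: coord_def l_distr r_distr m_ac a_ac)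
  also have "\<dots> = coord (p * p' + d * q * q') (p * q' + p' * q)"
    unfolding w_square coord_def by (simp add: Z_embed_mult[symmetric] Z_embed_add[symmetric] mult_ac)
  finally show ?thesis .
qed

lemma coord_scale: "\<iota> n \<otimes> coord p q = coord (n * p) (n * q)"
  unfolding coord_int coord_mult by simp

lemma coord_minus: "\<ominus> coord p q = coord (- p) (- q)"
proof -
  have "coord (- p) (- q) \<oplus> coord p q = coord 0 0" unfolding coord_add by simp
  then have "coord (- p) (- q) \<oplus> coord p q = \<zero>" by (simp add: coord_int[symmetric])
  then show ?thesis by (intro minus_equality) auto
qed

lemma coord_eq_zeroD: "coord p q = \<zero> \<Longrightarrow> p = 0 \<and> q = 0"
proof -
  assume z: "coord p q = \<zero>"
  have q: "q = 0"
  proof (rule ccontr)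
    assume "q \<noteq> 0"
    then have "\<iota> q \<noteq> \<zero>" using char_0 by blast
    moreover have "\<iota> q \<otimes> w = \<iota> (- p)"
      using z w_closed minus_equality[of "\<iota> q \<otimes> w" "\<iota> p"]
      by (simp add: coord_def Z_embed_minus a_comm[of "\<iota> p"])
    ultimately show False using w_irrational prime_subfield_fractionI[OF w_closed] by blast
  qed
  then have "\<iota> p = \<zero>" using z by (simp add: coord_int[symmetric])
  then show ?thesis using q char_0 by blast
qed

lemma coord_inject: "coord p q = coord p' q' \<longleftrightarrow> p = p' \<and> q = q'"
proof
  assume eq: "coord p q = coord p' q'"
  have "coord (p - p') (q - q') = coord p q \<oplus> \<ominus> coord p' q'" by (simp add: coord_minus coord_add)
  also have "\<dots> = \<zero>" unfolding eq by (simp add: r_neg)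
  finally show "p = p' \<and> q = q'" using coord_eq_zeroD by fastforce
qed simp

lemma coord_power_norm:
  "\<exists>p' q'. coord p q [^] (k::nat) = coord p' q' \<and> p'\<^sup>2 - d * q'\<^sup>2 = (p\<^sup>2 - d * q\<^sup>2) ^ k"
proof (induction k)
  case 0
  show ?case by (intro exI[of _ 1] exI[of _ 0]) (simp add: coord_int[symmetric])
next
  case (Suc k)
  then obtain p' q' where *: "coord p q [^] k = coord p' q'"
    "p'\<^sup>2 - d * q'\<^sup>2 = (p\<^sup>2 - d * q\<^sup>2) ^ k" by blast
  have "(p' * p + d * q' * q)\<^sup>2 - d * (p' * q + p * q')\<^sup>2 = (p'\<^sup>2 - d * q'\<^sup>2) * (p\<^sup>2 - d * q\<^sup>2)"
    by (simp add: power2_eq_square algebra_simps)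
  then show ?case using *
    by (intro exI[of _ "p' * p + d * q' * q"] exI[of _ "p' * q + p * q'"])
      (simp add: coord_mult mult.commute)
qed

lemma d_not_one: "d \<noteq> 1"
proof
  assume "d = 1"
  then have "coord 1 1 \<otimes> coord (- 1) 1 = coord 0 0" by (simp add: coord_mult)
  then have "coord 1 1 \<otimes> coord (- 1) 1 = \<zero>" by (simp add: coord_int[symmetric])
  then have "coord 1 1 = \<zero> \<or> coord (- 1) 1 = \<zero>" by (simp add: integral_iff)
  then show False using coord_eq_zeroD by fastforce
qed

text \<open>If z^2 = e and n z = p + q w, comparison of coordinates gives p q = 0. Then e is either
  d times a rational square, hence d, or a rational square, hence 1.\<close>

lemma quadratic_radicand_eq: "quadratic_radicand K = d"
  unfolding quadratic_radicand_def
proof (rule the_equality)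
  show "squarefree d \<and> d \<noteq> 1 \<and> (\<exists>w\<in>carrier K. w \<otimes> w = add_pow K d \<one>)"
    using squarefree_d d_not_one w_closed w_square by (auto simp: Z_embed_def)
  fix e :: int
  assume "squarefree e \<and> e \<noteq> 1 \<and> (\<exists>w\<in>carrier K. w \<otimes> w = add_pow K e \<one>)"
  then obtain z where e: "squarefree e" "e \<noteq> 1" and z: "z \<in> carrier K" "z \<otimes> z = \<iota> e"
    by (auto simp: Z_embed_def)
  obtain n p q where n: "n \<noteq> 0" "\<iota> n \<otimes> z = coord p q"
    using spanning[OF z(1)] by (auto simp: coord_def)
  have "coord (n\<^sup>2 * e) 0 = (\<iota> n \<otimes> \<iota> n) \<otimes> (z \<otimes> z)"
    unfolding z(2) coord_int coord_mult by (simp add: power2_eq_square)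
  also have "\<dots> = coord p q \<otimes> coord p q" unfolding n(2)[symmetric] using z(1) by (simp add: m_ac)
  also have "\<dots> = coord (p\<^sup>2 + d * q\<^sup>2) (2 * p * q)"
    unfolding coord_mult by (simp add: power2_eq_square mult.assoc)
  finally have eq: "n\<^sup>2 * e = p\<^sup>2 + d * q\<^sup>2" "p = 0 \<or> q = 0" by (auto simp: coord_inject)
  from eq(2) show "e = d"
  proof
    assume "p = 0"
    then show ?thesis
      using squarefree_times_square_unique[OF squarefree_d e(1) n(1), of q] eq(1) by (simp add: mult.commute)
  next
    assume "q = 0"
    then have "e = 1"
      using squarefree_times_square_unique[OF squarefree_1 e(1) n(1), of p] eq(1) by simp
    then show ?thesis using e(2) by blast
  qed
qed

section \<open>Discriminant and integral basis\<close>

definition disc where "disc = (if d mod 4 = 1 then d else 4 * d)"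

text \<open>The factor by which w becomes a square root of the discriminant.\<close>

definition disc_sqrt where "disc_sqrt = (if d mod 4 = 1 then 1 else (2::int))"

definition nrm where "nrm = (disc\<^sup>2 - disc) div 4"

lemma disc_eq: "quadratic_discriminant K = disc"
  by (simp add: quadratic_discriminant_def quadratic_radicand_eq disc_def)

lemma disc_sqrt_square: "disc = disc_sqrt\<^sup>2 * d"
  by (simp add: disc_def disc_sqrt_def)

lemma four_nrm: "4 * nrm = disc\<^sup>2 - disc"
proof -
  have "disc mod 4 = 0 \<or> disc mod 4 = 1" by (auto simp: disc_def)
  then obtain k where "disc = 4 * k \<or> disc = 4 * k + 1" by (metis mult_div_mod_eq add.right_neutral)
  then have "4 dvd disc\<^sup>2 - disc" by (auto simp: power2_eq_square algebra_simps)
  then show ?thesis by (simp add: nrm_def)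
qed

sublocale fundamental_discriminant d disc nrm
  by unfold_locales (use squarefree_d four_nrm in \<open>auto simp: disc_def\<close>)

text \<open>This is (D + sqrt D)/2, which together with 1 is an integral basis for both forms of the
  discriminant.\<close>

definition omega where "omega = coord disc disc_sqrt \<otimes> inv (\<iota> 2)"

definition elt :: "int \<Rightarrow> int \<Rightarrow> 'a"
  where "elt a b = \<iota> a \<oplus> \<iota> b \<otimes> omega"

lemma two_unit: "\<iota> 2 \<in> Units K"
  using char_0[of 2] field_Units by auto

lemma omega_closed: "omega \<in> carrier K"
  using two_unit by (simp add: omega_def)

lemma elt_closed [simp]: "elt a b \<in> carrier K"
  using omega_closed by (simp add: elt_def)

lemma two_elt: "\<iota> 2 \<otimes> elt a b = coord (2 * a + b * disc) (b * disc_sqrt)"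
proof -
  have "\<iota> 2 \<otimes> omega = coord disc disc_sqrt"
    unfolding omega_def using two_unit by (simp add: m_lcomm[of "\<iota> 2" "coord disc disc_sqrt"])
  then have "\<iota> 2 \<otimes> elt a b = \<iota> 2 \<otimes> \<iota> a \<oplus> \<iota> b \<otimes> coord disc disc_sqrt"
    unfolding elt_def using omega_closed by (simp add: r_distr m_lcomm[of "\<iota> 2" "\<iota> b"])
  then show ?thesis unfolding coord_scale coord_int coord_mult coord_add by simp
qed

lemma elt_eqI:
  assumes "n \<noteq> 0" "x \<in> carrier K" "y \<in> carrier K" "\<iota> n \<otimes> x = \<iota> n \<otimes> y"
  shows "x = y"
  using m_lcancel[of "\<iota> n" x y] assms char_0 by auto

lemma elt_int: "\<iota> a = elt a 0"
  using omega_closed by (simp add: elt_def)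

lemma elt_add: "elt a b \<oplus> elt a' b' = elt (a + a') (b + b')"
  using omega_closed by (simp add: elt_def Z_embed_add l_distr a_ac)

lemma elt_mult: "elt a b \<otimes> elt a' b' = elt (a * a' - b * b' * nrm) (a * b' + a' * b + disc * b * b')"
proof (rule elt_eqI[of 4])
  have "\<iota> 4 \<otimes> (elt a b \<otimes> elt a' b') = (\<iota> 2 \<otimes> elt a b) \<otimes> (\<iota> 2 \<otimes> elt a' b')"
    using Z_embed_mult[of 2 2] by (simp add: m_ac)
  also have "\<dots> = coord ((2 * a + b * disc) * (2 * a' + b' * disc) + d * (b * disc_sqrt) * (b' * disc_sqrt))
      ((2 * a + b * disc) * (b' * disc_sqrt) + (2 * a' + b' * disc) * (b * disc_sqrt))"
    unfolding two_elt coord_mult ..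
  also have "\<dots> = coord (2 * (2 * (a * a' - b * b' * nrm) + (a * b' + a' * b + disc * b * b') * disc))
      (2 * ((a * b' + a' * b + disc * b * b') * disc_sqrt))"
  proof -
    have 1: "d * (b * disc_sqrt) * (b' * disc_sqrt) = b * b' * disc"
      unfolding disc_sqrt_square by (simp add: power2_eq_square)
    have 2: "4 * (b * b' * nrm) = b * b' * (disc\<^sup>2 - disc)" unfolding four_nrm[symmetric] by simp
    show ?thesis
      unfolding coord_inject 1 using 2 by (simp add: power2_eq_square algebra_simps)
  qed
  also have "\<dots> = \<iota> 2 \<otimes> (\<iota> 2 \<otimes> elt (a * a' - b * b' * nrm) (a * b' + a' * b + disc * b * b'))"
    unfolding two_elt coord_scale ..
  also have "\<dots> = \<iota> 4 \<otimes> elt (a * a' - b * b' * nrm) (a * b' + a' * b + disc * b * b')"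
    using Z_embed_mult[of 2 2] by (simp add: m_assoc)
  finally show "\<iota> 4 \<otimes> (elt a b \<otimes> elt a' b') =
      \<iota> 4 \<otimes> elt (a * a' - b * b' * nrm) (a * b' + a' * b + disc * b * b')" .
qed auto

lemma elt_scale: "\<iota> n \<otimes> elt a b = elt (n * a) (n * b)"
  unfolding elt_int elt_mult by simp

lemma elt_minus: "\<ominus> elt a b = elt (- a) (- b)"
proof -
  have "elt (- a) (- b) \<oplus> elt a b = \<zero>" by (simp add: elt_add elt_int[symmetric])
  then show ?thesis by (intro minus_equality) auto
qed

lemma elt_inject: "elt a b = elt a' b' \<longleftrightarrow> a = a' \<and> b = b'"
proof
  assume "elt a b = elt a' b'"
  then have "coord (2 * a + b * disc) (b * disc_sqrt) = coord (2 * a' + b' * disc) (b' * disc_sqrt)"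
    by (metis two_elt)
  then show "a = a' \<and> b = b'"
    unfolding coord_inject by (auto simp: disc_sqrt_def split: if_splits)
qed simp

lemma elt_zero: "\<zero> = elt 0 0" and elt_one: "\<one> = elt 1 0"
  by (simp_all add: elt_int[symmetric])

text \<open>The conjugate of omega is D - omega.\<close>

lemma elt_conj: "elt a b \<otimes> elt (a + b * disc) (- b) = \<iota> (N a b)"
  unfolding elt_mult elt_int quadratic_norm_def by (simp add: power2_eq_square algebra_simps)

text \<open>This concerns (t + s w)/2 with integral norm. If d is not 1 modulo 4, the congruence
  forces t and s to be even; otherwise it forces t - s d to be even, which is what the basis 1,
  omega needs.\<close>

lemma elt_of_coord:
  assumes "4 dvd t\<^sup>2 - d * s\<^sup>2"
  shows "\<exists>a b. \<iota> 2 \<otimes> elt a b = coord t s"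
proof (cases "d mod 4 = 1")
  case True
  have "even (t\<^sup>2 - d * s\<^sup>2)" using assms by (rule dvd_trans[rotated]) simp
  moreover have "odd d" using True by presburger
  ultimately have "even (t - s * d)" by auto
  then obtain a where "t - s * d = 2 * a" by blast
  then have "\<iota> 2 \<otimes> elt a s = coord t s"
    unfolding two_elt coord_inject using True by (simp add: disc_def disc_sqrt_def)
  then show ?thesis by blast
next
  case False
  then have "d mod 4 = 2 \<or> d mod 4 = 3" using squarefree_int_mod_4[OF squarefree_d] by presburger
  then have "even t \<and> even s" by (rule four_dvd_square_diff[OF assms])
  then obtain t' s' where ts: "t = 2 * t'" "s = 2 * s'" by blast
  have "\<iota> 2 \<otimes> elt (t' - 2 * d * s') s' = coord t s"
    unfolding two_elt coord_inject ts using False by (simp add: disc_def disc_sqrt_def)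
  then show ?thesis by blast
qed

text \<open>
  An element all of whose powers have a common denominator has integral norm, and so does
  \<open>x + 1\<close>; the difference of the two norms is \<open>1\<close> plus the trace of \<open>x\<close>.
\<close>

definition bounded_denominator :: "'a \<Rightarrow> bool"
  where "bounded_denominator x \<longleftrightarrow> (\<exists>D. D \<noteq> 0 \<and> (\<forall>k::nat. \<exists>p q. \<iota> D \<otimes> x [^] k = coord p q))"

text \<open>The norm of D x^k is the integer D^2 N(x)^k for every k, so N(x) is an integer by
  \<open>dvd_if_powers_dvd\<close>.\<close>

lemma bounded_denominator_norm:
  assumes x: "x \<in> carrier K" and bd: "bounded_denominator x" and n: "n \<noteq> 0" "\<iota> n \<otimes> x = coord p q"
  shows "n\<^sup>2 dvd p\<^sup>2 - d * q\<^sup>2"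
proof -
  obtain D where D: "D \<noteq> 0" "\<And>k::nat. \<exists>p q. \<iota> D \<otimes> x [^] k = coord p q"
    using bd unfolding bounded_denominator_def by blast
  have "(n\<^sup>2) ^ k dvd D\<^sup>2 * (p\<^sup>2 - d * q\<^sup>2) ^ k" for k
  proof -
    obtain r s where rs: "\<iota> D \<otimes> x [^] k = coord r s" using D(2) by blast
    obtain p' q' where pq: "coord p q [^] k = coord p' q'" "p'\<^sup>2 - d * q'\<^sup>2 = (p\<^sup>2 - d * q\<^sup>2) ^ k"
      using coord_power_norm by blast
    have "coord (D * p') (D * q') = \<iota> D \<otimes> (\<iota> n \<otimes> x) [^] k"
      unfolding n(2) pq(1) coord_scale ..
    also have "\<dots> = \<iota> (n ^ k) \<otimes> (\<iota> D \<otimes> x [^] k)"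
      using x by (simp add: nat_pow_distrib Z_embed_power m_lcomm)
    also have "\<dots> = coord (n ^ k * r) (n ^ k * s)" unfolding rs coord_scale ..
    finally have "D * p' = n ^ k * r" "D * q' = n ^ k * s" by (auto simp: coord_inject)
    moreover have "D\<^sup>2 * (p\<^sup>2 - d * q\<^sup>2) ^ k = (D * p')\<^sup>2 - d * (D * q')\<^sup>2"
      unfolding pq(2)[symmetric] by (simp add: power2_eq_square algebra_simps)
    ultimately have "D\<^sup>2 * (p\<^sup>2 - d * q\<^sup>2) ^ k = (n\<^sup>2) ^ k * (r\<^sup>2 - d * s\<^sup>2)"
      by (simp add: power_mult_distrib power2_eq_square algebra_simps flip: power_mult_distrib)
    then show ?thesis by simp
  qed
  then show ?thesis using D(1) n(1) by (intro dvd_if_powers_dvd[of "D\<^sup>2" "n\<^sup>2"]) auto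
qed

text \<open>The denominator of x serves for all (x + 1)^j x^k, by induction on j.\<close>

lemma bounded_denominator_add_one:
  assumes x: "x \<in> carrier K" and bd: "bounded_denominator x"
  shows "bounded_denominator (x \<oplus> \<one>)"
proof -
  obtain D where D: "D \<noteq> 0" "\<And>k::nat. \<exists>p q. \<iota> D \<otimes> x [^] k = coord p q"
    using bd unfolding bounded_denominator_def by blast
  have "\<exists>p q. \<iota> D \<otimes> ((x \<oplus> \<one>) [^] j \<otimes> x [^] k) = coord p q" for j k :: nat
  proof (induction j arbitrary: k)
    case 0
    then show ?case using D(2) x by simp
  next
    case (Suc j)
    have "\<iota> D \<otimes> ((x \<oplus> \<one>) [^] Suc j \<otimes> x [^] k) =
        \<iota> D \<otimes> ((x \<oplus> \<one>) [^] j \<otimes> x [^] Suc k) \<oplus> \<iota> D \<otimes> ((x \<oplus> \<one>) [^] j \<otimes> x [^] k)"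
      using x by (simp add: l_distr r_distr m_ac)
    then show ?case using Suc[of "Suc k"] Suc[of k] coord_add by metis
  qed
  from this[of _ 0] have "\<exists>p q. \<iota> D \<otimes> (x \<oplus> \<one>) [^] j = coord p q" for j :: nat using x by simp
  then show ?thesis unfolding bounded_denominator_def using D(1) by blast
qed

lemma bounded_denominator_imp_elt:
  assumes x: "x \<in> carrier K" and bd: "bounded_denominator x"
  shows "\<exists>a b. x = elt a b"
proof -
  obtain m p q where m: "m \<noteq> 0" "\<iota> m \<otimes> x = coord p q"
    using spanning[OF x] by (auto simp: coord_def)
  have norm: "m\<^sup>2 dvd p\<^sup>2 - d * q\<^sup>2" by (rule bounded_denominator_norm[OF x bd m])
  have "\<iota> m \<otimes> (x \<oplus> \<one>) = coord (p + m) q"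
    using m(2) x coord_add[of p q m 0] by (simp add: r_distr coord_int[symmetric])
  then have "m\<^sup>2 dvd (p + m)\<^sup>2 - d * q\<^sup>2"
    using bounded_denominator_norm[OF _ bounded_denominator_add_one[OF x bd] m(1)] x by simp
  then have "m\<^sup>2 dvd ((p + m)\<^sup>2 - d * q\<^sup>2) - (p\<^sup>2 - d * q\<^sup>2) - m\<^sup>2" by (rule dvd_diff[OF dvd_diff[OF _ norm] dvd_refl])
  also have "((p + m)\<^sup>2 - d * q\<^sup>2) - (p\<^sup>2 - d * q\<^sup>2) - m\<^sup>2 = m * (2 * p)"
    by (simp add: power2_eq_square algebra_simps)
  finally have "m * m dvd m * (2 * p)" unfolding power2_eq_square .
  then have "m dvd 2 * p" using m(1) dvd_times_left_cancel_iff by blast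
  then obtain t where t: "2 * p = m * t" by blast
  obtain u where u: "p\<^sup>2 - d * q\<^sup>2 = m\<^sup>2 * u" using norm by blast
  \<comment> \<open>With t the trace and u the norm of x, t^2 - 4 u equals d (2 q / m)^2. As d is
    squarefree, 2 q / m is an integer s, and x = (t + s w)/2.\<close>
  have "d * (2 * q)\<^sup>2 = (2 * p)\<^sup>2 - 4 * (p\<^sup>2 - d * q\<^sup>2)" by (simp add: power2_eq_square algebra_simps)
  also have "\<dots> = m\<^sup>2 * (t\<^sup>2 - 4 * u)" unfolding t u by (simp add: power2_eq_square algebra_simps)
  finally have eq: "d * (2 * q)\<^sup>2 = m\<^sup>2 * (t\<^sup>2 - 4 * u)" .
  then have "m dvd 2 * q"
    by (intro dvd_if_square_dvd_squarefree_mult[OF squarefree_d m(1)]) (simp only: eq dvd_triv_left)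
  then obtain s where s: "2 * q = m * s" by blast
  have "m\<^sup>2 * (d * s\<^sup>2) = m\<^sup>2 * (t\<^sup>2 - 4 * u)"
    using eq unfolding s by (simp add: power2_eq_square mult_ac)
  then have "d * s\<^sup>2 = t\<^sup>2 - 4 * u" using m(1) mult_left_cancel[of "m\<^sup>2"] by simp
  then have "t\<^sup>2 - d * s\<^sup>2 = 4 * u" by linarith
  then obtain a b where ab: "\<iota> 2 \<otimes> elt a b = coord t s" using elt_of_coord[of t s] by auto
  have "\<iota> (2 * m) \<otimes> x = \<iota> 2 \<otimes> (\<iota> m \<otimes> x)" using x by (simp add: Z_embed_mult m_assoc)
  also have "\<dots> = \<iota> m \<otimes> (\<iota> 2 \<otimes> elt a b)"
    unfolding m(2) ab coord_scale by (simp add: t s)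
  also have "\<dots> = \<iota> (2 * m) \<otimes> elt a b" by (simp add: Z_embed_mult m_ac)
  finally have eq: "\<iota> (2 * m) \<otimes> x = \<iota> (2 * m) \<otimes> elt a b" .
  have "x = elt a b" by (rule elt_eqI[OF _ x elt_closed eq]) (simp add: m(1))
  then show ?thesis by blast
qed

lemma common_denominator_Span:
  assumes "set us \<subseteq> carrier K"
  shows "\<exists>D. D \<noteq> 0 \<and> (\<forall>y\<in>Span (range \<iota>) us. \<exists>p q. \<iota> D \<otimes> y = coord p q)"
  using assms
proof (induction us)
  case Nil
  show ?case by (intro exI[of _ 1]) (auto intro!: exI[of _ 0] simp: coord_int[symmetric])
next
  case (Cons u us)
  then obtain D where D: "D \<noteq> 0" "\<And>y. y \<in> Span (range \<iota>) us \<Longrightarrow> \<exists>p q. \<iota> D \<otimes> y = coord p q" by auto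
  have uK: "u \<in> carrier K" using Cons.prems by simp
  obtain m p q where m: "m \<noteq> 0" "\<iota> m \<otimes> u = coord p q"
    using spanning[OF uK] by (auto simp: coord_def)
  have "\<exists>p q. \<iota> (D * m) \<otimes> y = coord p q" if "y \<in> Span (range \<iota>) (u # us)" for y
  proof -
    have "\<exists>z\<in>range \<iota>. \<exists>v\<in>Span (range \<iota>) us. y = z \<otimes> u \<oplus> v"
      using that unfolding Span.simps foldr.simps o_apply line_extension_mem_iff .
    then obtain k v where kv: "v \<in> Span (range \<iota>) us" "y = \<iota> k \<otimes> u \<oplus> v" by blast
    obtain p' q' where pq': "\<iota> D \<otimes> v = coord p' q'" using D(2) kv(1) by blast
    have "range \<iota> \<subseteq> carrier K" by auto
    then have vK: "v \<in> carrier K" using kv(1) Span_in_carrier[of "range \<iota>" us] Cons.prems by auto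
    have "\<iota> (D * m) \<otimes> y = \<iota> (D * k) \<otimes> (\<iota> m \<otimes> u) \<oplus> \<iota> m \<otimes> (\<iota> D \<otimes> v)"
      unfolding kv(2) using uK vK by (simp add: Z_embed_mult r_distr m_ac)
    also have "\<dots> = coord (D * k * p + m * p') (D * k * q + m * q')"
      unfolding m(2) pq' coord_scale coord_add ..
    finally show ?thesis by blast
  qed
  then show ?case using D(1) m(1) by (intro exI[of _ "D * m"]) auto
qed

end

lemma (in domain) eval_append_zero:
  assumes "set p \<subseteq> carrier R" "x \<in> carrier R"
  shows "eval (p @ [\<zero>]) x = eval p x \<otimes> x"
  using assms(1)
proof (induction p)
  case (Cons a p)
  then show ?case
    using assms(2) eval_closed[of p x] by (simp add: eval_Cons l_distr m_assoc del: eval.simps(2))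
qed (use assms(2) in simp)

text \<open>The span of 1, x, ..., x^(m-1) is stable under multiplication by x: shifting a
  coefficient list pushes out its leading coefficient a, and a x^m is rewritten by the integral
  equation.\<close>

lemma (in domain) integral_powers_spanned:
  assumes S: "subring S R" and x: "x \<in> integral_closure R S"
  shows "\<exists>m. \<forall>k::nat. \<exists>q. set q \<subseteq> S \<and> length q = m \<and> x [^] k = eval q x"
proof -
  have SR: "S \<subseteq> carrier R" by (rule subringE(1)[OF S])
  obtain p where p: "p \<in> carrier (univ_poly R S)" "p \<noteq> []" "hd p = \<one>" "eval p x = \<zero>"
    and xR: "x \<in> carrier R"
    using x by (auto simp: integral_closure_def)
  obtain r where r: "p = \<one> # r" using p(2,3) by (cases p) auto
  have rS: "set r \<subseteq> S" using p(1) r by (auto simp: univ_poly_def polynomial_def)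
  then have rR: "set r \<subseteq> carrier R" using SR by blast
  define m where "m = length r"
  define r' where "r' = map (\<lambda>a. \<ominus> a) r"
  have r': "set r' \<subseteq> S" "length r' = m" "set r' \<subseteq> carrier R"
    using rS subringE(5)[OF S] rR by (auto simp: r'_def m_def)
  have xm: "x [^] m = eval r' x"
  proof -
    have "x [^] m \<oplus> eval r x = \<zero>" using p(4) xR by (simp add: r eval_Cons m_def del: eval.simps(2))
    then have "\<ominus> eval r x = x [^] m" using xR eval_closed[OF rR xR] by (intro minus_equality) auto
    then show ?thesis unfolding r'_def using eval_map_uminus[OF rR xR] by simp
  qed
  have "m \<noteq> 0"
  proof
    assume "m = 0"
    then show False using xm r'(2) by simp
  qed
  have "\<exists>q. set q \<subseteq> S \<and> length q = m \<and> x [^] k = eval q x" for k :: nat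
  proof (induction k)
    case 0
    obtain m' where m': "m = Suc m'" using \<open>m \<noteq> 0\<close> not0_implies_Suc by blast
    have "eval (replicate j \<zero> @ [\<one>]) x = \<one>" for j
      by (induction j) (use xR in \<open>simp_all add: eval_Cons del: eval.simps(2)\<close>)
    then show ?case using m' subringE(2,3)[OF S]
      by (intro exI[of _ "replicate m' \<zero> @ [\<one>]"]) auto
  next
    case (Suc k)
    then obtain q where q: "set q \<subseteq> S" "length q = m" "x [^] k = eval q x" by blast
    obtain a q' where aq: "q = a # q'" using q(2) \<open>m \<noteq> 0\<close> by (cases q) auto
    have a: "a \<in> S" "a \<in> carrier R" "set q' \<subseteq> S" "set q' \<subseteq> carrier R" using q(1) SR aq by auto
    let ?s = "map2 (\<oplus>) (map (\<lambda>c. a \<otimes> c) r') (q' @ [\<zero>])"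
    have len: "length (q' @ [\<zero>]) = m" using q(2) aq by simp
    have 1: "set (map (\<lambda>c. a \<otimes> c) r') \<subseteq> S" using a(1) r'(1) subringE(6)[OF S] by auto
    have 2: "set (q' @ [\<zero>]) \<subseteq> S" using a(3) subringE(2)[OF S] by auto
    have "x [^] Suc k = a \<otimes> (x [^] length q' \<otimes> x) \<oplus> eval q' x \<otimes> x"
      using q(3) xR a eval_closed[OF a(4) xR]
      by (simp add: aq eval_Cons l_distr m_assoc del: eval.simps(2))
    also have "x [^] length q' \<otimes> x = eval r' x" using xm len xR by (simp flip: nat_pow_Suc)
    also have "a \<otimes> eval r' x \<oplus> eval q' x \<otimes> x = eval ?s x"
      using eval_map2_add[of "map (\<lambda>c. a \<otimes> c) r'" "q' @ [\<zero>]" x] 1 2 SR len r'(2,3) xR a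
      by (simp add: eval_map_mult eval_append_zero subset_trans)
    finally have "x [^] Suc k = eval ?s x" .
    moreover have "set ?s \<subseteq> S"
    proof
      fix c assume "c \<in> set ?s"
      then obtain u v where uv: "(u, v) \<in> set (zip (map (\<lambda>c. a \<otimes> c) r') (q' @ [\<zero>]))" "c = u \<oplus> v" by auto
      then have "u \<in> S" "v \<in> S" using 1 2 set_zip_leftD[OF uv(1)] set_zip_rightD[OF uv(1)] by blast+
      then show "c \<in> S" using uv(2) subringE(7)[OF S] by simp
    qed
    moreover have "length ?s = m" using len r'(2) by simp
    ultimately show ?case by blast
  qed
  then show ?thesis by blast
qed

section \<open>Orders in quadratic number fields\<close>

lemma (in domain) subring_primeidealI:
  assumes S: "subring S R" and P: "P \<subseteq> S" "\<zero> \<in> P"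
    and add: "\<And>x y. \<lbrakk>x \<in> P; y \<in> P\<rbrakk> \<Longrightarrow> x \<oplus> y \<in> P" and neg: "\<And>x. x \<in> P \<Longrightarrow> \<ominus> x \<in> P"
    and mult: "\<And>r x. \<lbrakk>r \<in> S; x \<in> P\<rbrakk> \<Longrightarrow> r \<otimes> x \<in> P" and one: "\<one> \<notin> P"
    and prime: "\<And>a b. \<lbrakk>a \<in> S; b \<in> S; a \<otimes> b \<in> P\<rbrakk> \<Longrightarrow> a \<in> P \<or> b \<in> P"
  shows "primeideal P (R\<lparr>carrier := S\<rparr>)"
proof -
  interpret S: "domain" "R\<lparr>carrier := S\<rparr>" by (rule subring_is_domain[OF S])
  have "ideal P (R\<lparr>carrier := S\<rparr>)"
  proof (rule idealI[OF S.ring_axioms])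
    show "subgroup P (add_monoid (R\<lparr>carrier := S\<rparr>))"
    proof (rule S.add.subgroupI)
      show "\<ominus>\<^bsub>R\<lparr>carrier := S\<rparr>\<^esub> x \<in> P" if "x \<in> P" for x
        using neg[OF that] subring_minus[OF S, of x] that P(1) by (simp add: subsetD)
    qed (use P add in auto)
    fix a x assume a: "a \<in> P" and x: "x \<in> carrier (R\<lparr>carrier := S\<rparr>)"
    then show "x \<otimes>\<^bsub>R\<lparr>carrier := S\<rparr>\<^esub> a \<in> P" using mult by simp
    moreover have "a \<otimes>\<^bsub>R\<lparr>carrier := S\<rparr>\<^esub> x = x \<otimes>\<^bsub>R\<lparr>carrier := S\<rparr>\<^esub> a"
      using a x P(1) by (intro S.m_comm) auto
    ultimately show "a \<otimes>\<^bsub>R\<lparr>carrier := S\<rparr>\<^esub> x \<in> P" by simp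
  qed
  then show ?thesis
  proof (rule primeidealI[OF _ S.is_cring])
    show "carrier (R\<lparr>carrier := S\<rparr>) \<noteq> P" using one subringE(3)[OF S] by auto
  qed (use prime in auto)
qed

locale quadratic_order = one_dim_noetherian_in_quotient_field K R + quadratic_field_root K w d
  for K (structure) and R w d +
  fixes f :: nat
  assumes order: "order_in K R" and f_pos: "f > 0"
    and conductor_f: "conductor K R = (\<lambda>x. add_pow K f x) ` integral_closure K R"
begin

lemma int_in_R: "\<iota> n \<in> R"
  by (rule Z_embed_mem_subring[OF subring_R])

lemma elt_integral: "elt a b \<in> integral_closure K R"
proof (rule integral_closureI[OF subring_R elt_closed])
  show "set [\<iota> (2 * a + b * disc), \<iota> (- N a b)] \<subseteq> R" using int_in_R by simp
  have "elt a b [^] (2::nat) = elt a b \<otimes> elt a b"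
    by (simp add: numeral_2_eq_2)
  also have "\<dots> = elt ((2 * a + b * disc) * a + (- N a b)) ((2 * a + b * disc) * b)"
    unfolding elt_mult elt_inject quadratic_norm_def by (simp add: power2_eq_square algebra_simps)
  also have "\<dots> = \<iota> (2 * a + b * disc) \<otimes> elt a b \<oplus> \<iota> (- N a b)"
    unfolding elt_scale elt_int elt_mult elt_add by simp
  finally have eq: "elt a b [^] (2::nat) = \<iota> (2 * a + b * disc) \<otimes> elt a b \<oplus> \<iota> (- N a b)" .
  have "eval [\<iota> (2 * a + b * disc), \<iota> (- N a b)] (elt a b) = \<iota> (2 * a + b * disc) \<otimes> elt a b \<oplus> \<iota> (- N a b)"
    by simp
  then show "elt a b [^] length [\<iota> (2 * a + b * disc), \<iota> (- N a b)] =
      eval [\<iota> (2 * a + b * disc), \<iota> (- N a b)] (elt a b)"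
    using eq by (simp add: numeral_2_eq_2)
qed

text \<open>R has a common denominator, being finitely generated over the integers, and so have the
  finitely many powers of x that span all the others over R; the product of the two works for every
  power.\<close>

lemma integral_bounded_denominator:
  assumes x: "x \<in> integral_closure K R"
  shows "bounded_denominator x"
proof -
  have xK: "x \<in> carrier K" using x integral_closure_subset by blast
  obtain m where m: "\<And>k::nat. \<exists>q. set q \<subseteq> R \<and> length q = m \<and> x [^] k = eval q x"
    using integral_powers_spanned[OF subring_R x] by blast
  obtain us where us: "set us \<subseteq> carrier K" "R = Span (range \<iota>) us"
    using order unfolding order_in_def fin_gen_submodule_def integers_in_eq by blast
  obtain D where D: "D \<noteq> 0" "\<And>y. y \<in> R \<Longrightarrow> \<exists>p q. \<iota> D \<otimes> y = coord p q"
    using common_denominator_Span[OF us(1)] us(2) by blast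
  have "\<exists>D'. D' \<noteq> 0 \<and> (\<forall>i<m. \<exists>p q. \<iota> D' \<otimes> x [^] i = coord p q)" for m :: nat
  proof (induction m)
    case 0
    show ?case by (intro exI[of _ 1]) simp
  next
    case (Suc m)
    then obtain D' where D': "D' \<noteq> 0" "\<And>i. i < m \<Longrightarrow> \<exists>p q. \<iota> D' \<otimes> x [^] i = coord p q" by blast
    obtain e p q where e: "e \<noteq> 0" "\<iota> e \<otimes> x [^] m = coord p q"
      using spanning[of "x [^] m"] xK by (auto simp: coord_def)
    have "\<exists>p q. \<iota> (D' * e) \<otimes> x [^] i = coord p q" if i: "i < Suc m" for i
    proof (cases "i = m")
      case True
      have "\<iota> (D' * e) \<otimes> x [^] i = \<iota> D' \<otimes> (\<iota> e \<otimes> x [^] m)"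
        using xK True by (simp add: Z_embed_mult m_assoc)
      then show ?thesis unfolding e(2) coord_scale by blast
    next
      case False
      then obtain p' q' where pq: "\<iota> D' \<otimes> x [^] i = coord p' q'" using D'(2)[of i] i by auto
      have "\<iota> (D' * e) \<otimes> x [^] i = \<iota> e \<otimes> (\<iota> D' \<otimes> x [^] i)"
        using xK by (simp add: Z_embed_mult m_ac)
      then show ?thesis unfolding pq coord_scale by blast
    qed
    then show ?case using D'(1) e(1) by (intro exI[of _ "D' * e"]) auto
  qed
  then obtain D' where D': "D' \<noteq> 0" "\<And>i. i < m \<Longrightarrow> \<exists>p q. \<iota> D' \<otimes> x [^] i = coord p q" by blast
  have ev: "\<exists>p' q'. \<iota> (D * D') \<otimes> eval q x = coord p' q'" if "set q \<subseteq> R" "length q \<le> m" for q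
    using that
  proof (induction q)
    case Nil
    show ?case by (intro exI[of _ 0]) (simp add: coord_int[symmetric])
  next
    case (Cons a q)
    have aK: "a \<in> carrier K" "set q \<subseteq> carrier K" using Cons.prems R_subset by auto
    obtain p1 q1 where 1: "\<iota> D \<otimes> a = coord p1 q1" using D(2)[of a] Cons.prems by auto
    obtain p2 q2 where 2: "\<iota> D' \<otimes> x [^] length q = coord p2 q2" using D'(2)[of "length q"] Cons.prems by auto
    obtain p3 q3 where 3: "\<iota> (D * D') \<otimes> eval q x = coord p3 q3" using Cons by auto
    have "\<iota> (D * D') \<otimes> eval (a # q) x =
        (\<iota> D \<otimes> a) \<otimes> (\<iota> D' \<otimes> x [^] length q) \<oplus> \<iota> (D * D') \<otimes> eval q x"
      using aK xK eval_closed[OF aK(2) xK]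
      by (simp add: eval_Cons Z_embed_mult r_distr m_ac del: eval.simps(2))
    then show ?case unfolding 1 2 3 coord_mult coord_add by blast
  qed
  have "\<exists>p q. \<iota> (D * D') \<otimes> x [^] k = coord p q" for k :: nat
  proof -
    obtain q where q: "set q \<subseteq> R" "length q = m" "x [^] k = eval q x" using m by blast
    show ?thesis unfolding q(3) using ev[OF q(1)] q(2) by simp
  qed
  then show ?thesis unfolding bounded_denominator_def using D(1) D'(1) by (intro exI[of _ "D * D'"]) auto
qed

lemma closure_iff: "x \<in> integral_closure K R \<longleftrightarrow> (\<exists>a b. x = elt a b)"
  using bounded_denominator_imp_elt[OF _ integral_bounded_denominator, of x]
    integral_closure_subset elt_integral by blast

lemma R_subset_closure: "R \<subseteq> integral_closure K R"
proof
  fix x assume x: "x \<in> R"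
  then have "x \<in> carrier K" using R_subset by blast
  then show "x \<in> integral_closure K R"
    using x by (intro integral_closureI[OF subring_R, of x "[x]"]) auto
qed

lemma conductor_iff: "x \<in> conductor K R \<longleftrightarrow> (\<exists>a b. x = elt (int f * a) (int f * b))"
proof -
  have pow: "add_pow K f (elt a b) = elt (int f * a) (int f * b)" for a b
    unfolding elt_scale[symmetric] Z_embed_of_nat by (simp add: add_pow_ldistr)
  have "x \<in> conductor K R \<longleftrightarrow> (\<exists>y. (\<exists>a b. y = elt a b) \<and> x = add_pow K f y)"
    unfolding conductor_f image_iff Bex_def closure_iff ..
  also have "\<dots> \<longleftrightarrow> (\<exists>a b. x = elt (int f * a) (int f * b))"
    unfolding pow[symmetric] by blast
  finally show ?thesis .
qed

text \<open>The b with b omega in R form a group g Z, and g divides f because f omega lies in the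
  conductor. Conversely g times the maximal order lies in R, so g lies in the conductor, which is f
  times the maximal order; hence f divides g.\<close>

lemma elt_in_R: "elt a b \<in> R \<longleftrightarrow> int f dvd b"
proof -
  have omega_iff: "elt a b \<in> R \<longleftrightarrow> elt 0 b \<in> R" for a b
  proof -
    have 1: "elt a b = \<iota> a \<oplus> elt 0 b" and 2: "elt 0 b = \<iota> (- a) \<oplus> elt a b"
      by (simp_all add: elt_int elt_add)
    show ?thesis using 1 2 int_in_R subringE(7)[OF subring_R] by metis
  qed
  define D where "D = {b. elt 0 b \<in> R}"
  have D_add: "b + b' \<in> D" if "b \<in> D" "b' \<in> D" for b b'
    using that subringE(7)[OF subring_R, of "elt 0 b" "elt 0 b'"] by (simp add: D_def elt_add)
  have D_neg: "- b \<in> D" if "b \<in> D" for b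
    using that subringE(5)[OF subring_R, of "elt 0 b"] by (simp add: D_def elt_minus)
  have fD: "int f \<in> D"
  proof -
    have "elt (int f * 0) (int f * 1) \<in> conductor K R" unfolding conductor_iff by blast
    then show ?thesis by (simp add: D_def conductor_def)
  qed
  obtain g where g: "g > 0" "int g \<in> D" "\<And>y. y \<in> D \<Longrightarrow> int g dvd y"
    using int_subgroup_generator[of D, OF D_add D_neg fD] f_pos by auto
  have D_mult: "b * int g \<in> D" for b
    using subringE(6)[OF subring_R int_in_R[of b], of "elt 0 (int g)"] g(2) by (simp add: D_def elt_scale)
  have "\<iota> (int g) \<in> conductor K R"
  proof -
    have "\<iota> (int g) \<otimes> elt a b \<in> R" for a b
      unfolding elt_scale omega_iff[of "int g * a" "int g * b"] using D_mult[of b]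
      by (simp add: D_def mult.commute)
    then show ?thesis unfolding conductor_def using int_in_R by (auto simp: closure_iff)
  qed
  then obtain a' b' where "\<iota> (int g) = elt (int f * a') (int f * b')" using conductor_iff by blast
  then have "int f dvd int g" by (simp add: elt_int elt_inject)
  moreover have "int g dvd int f" using g(3) fD by blast
  ultimately have fg: "g = f" by (simp add: dvd_antisym)
  have "b \<in> D \<longleftrightarrow> int f dvd b" for b
    using g(3) D_mult unfolding fg by (metis dvd_def mult.commute)
  then have "elt 0 b \<in> R \<longleftrightarrow> int f dvd b" unfolding D_def by blast
  then show ?thesis using omega_iff[of a b] by blast
qed

lemma R_elt:
  assumes "x \<in> R"
  obtains a b where "x = elt a b" "int f dvd b"
proof -
  have "x \<in> integral_closure K R" using assms R_subset_closure by blast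
  then obtain a b where ab: "x = elt a b" unfolding closure_iff by blast
  then have "int f dvd b" using assms elt_in_R by simp
  with ab show thesis by (rule that)
qed

lemma closure_subring: "subring (integral_closure K R) K"
proof (rule subringI)
  show "\<one> \<in> integral_closure K R" using closure_iff elt_one by blast
  show "\<ominus> x \<in> integral_closure K R" if "x \<in> integral_closure K R" for x
    using that elt_integral unfolding closure_iff by (auto simp: elt_minus)
  fix x y assume "x \<in> integral_closure K R" "y \<in> integral_closure K R"
  then obtain a b a' b' where "x = elt a b" "y = elt a' b'" unfolding closure_iff by blast
  then show "x \<otimes> y \<in> integral_closure K R" "x \<oplus> y \<in> integral_closure K R"
    using elt_integral by (simp_all add: elt_mult elt_add)
qed (rule integral_closure_subset)

section \<open>Primes containing the conductor\<close>

definition prime_over :: "nat \<Rightarrow> 'a set"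
  where "prime_over p = {elt a b |a b. int p dvd a \<and> int f dvd b}"

lemma elt_in_prime_over: "elt a b \<in> prime_over p \<longleftrightarrow> int p dvd a \<and> int f dvd b"
  by (auto simp: prime_over_def elt_inject)

lemma prime_over_is_prime:
  assumes p: "Factorial_Ring.prime p" "p dvd f"
  shows "primeideal (prime_over p) A"
proof (rule subring_primeidealI[OF subring_R])
  have ip: "Factorial_Ring.prime (int p)" "int p dvd int f" using p by auto
  show "prime_over p \<subseteq> R" by (auto simp: prime_over_def elt_in_R)
  show "\<zero> \<in> prime_over p" unfolding elt_zero elt_in_prime_over by simp
  show "x \<oplus> y \<in> prime_over p" if xy: "x \<in> prime_over p" "y \<in> prime_over p" for x y
  proof -
    obtain a b a' b' where "x = elt a b" "y = elt a' b'" "int p dvd a" "int f dvd b" "int p dvd a'" "int f dvd b'"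
      using xy by (auto simp: prime_over_def)
    then show ?thesis by (simp add: elt_add elt_in_prime_over)
  qed
  show "\<ominus> x \<in> prime_over p" if x: "x \<in> prime_over p" for x
  proof -
    obtain a b where "x = elt a b" "int p dvd a" "int f dvd b" using x by (auto simp: prime_over_def)
    then show ?thesis by (simp add: elt_minus elt_in_prime_over)
  qed
  have mult: "elt a b \<otimes> elt a' b' \<in> prime_over p \<longleftrightarrow> int p dvd a * a'" if "int f dvd b" "int f dvd b'" for a b a' b'
  proof -
    have "int p dvd b * b' * nrm" using ip(2) that(1) dvd_trans[of "int p" "int f" b] by (simp add: mult.assoc)
    then have "int p dvd a * a' - b * b' * nrm \<longleftrightarrow> int p dvd a * a'" by (metis dvd_diff_left_iff)
    moreover have "int f dvd a * b' + a' * b + disc * b * b'" using that by simp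
    ultimately show ?thesis unfolding elt_mult elt_in_prime_over by simp
  qed
  show "r \<otimes> x \<in> prime_over p" if rx: "r \<in> R" "x \<in> prime_over p" for r x
  proof -
    obtain a b where "r = elt a b" "int f dvd b" by (rule R_elt[OF rx(1)])
    moreover obtain a' b' where "x = elt a' b'" "int p dvd a'" "int f dvd b'"
      using rx(2) by (auto simp: prime_over_def)
    ultimately show ?thesis using mult by simp
  qed
  show "\<one> \<notin> prime_over p" unfolding elt_one elt_in_prime_over using ip(1) by auto
  show "x \<in> prime_over p \<or> y \<in> prime_over p" if xy: "x \<in> R" "y \<in> R" "x \<otimes> y \<in> prime_over p" for x y
  proof -
    obtain a b where 1: "x = elt a b" "int f dvd b" by (rule R_elt[OF xy(1)])
    obtain a' b' where 2: "y = elt a' b'" "int f dvd b'" by (rule R_elt[OF xy(2)])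
    have "int p dvd a * a'" using xy(3) mult[OF 1(2) 2(2)] 1(1) 2(1) by simp
    then have "int p dvd a \<or> int p dvd a'" using prime_dvd_mult_iff[OF ip(1)] by blast
    then show ?thesis using 1 2 by (simp add: elt_in_prime_over)
  qed
qed

lemma prime_over_nonzero: "prime_over p \<noteq> {\<zero>}"
proof -
  have "elt 0 (int f) \<in> prime_over p" by (simp add: elt_in_prime_over)
  moreover have "elt 0 (int f) \<noteq> \<zero>" unfolding elt_zero elt_inject using f_pos by simp
  ultimately show ?thesis by blast
qed

text \<open>If f divides b, then p divides b and (b omega)^2 is p times an element of R. So b omega
  lies in P, which gives one inclusion; equality follows from dimension one.\<close>

lemma primeideal_containing_prime:
  assumes p: "Factorial_Ring.prime p" "p dvd f" and P: "primeideal P A" "\<iota> (int p) \<in> P"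
  shows "P = prime_over p"
proof -
  interpret P: primeideal P A by (rule P(1))
  have pP: "\<iota> (int p) \<otimes> x \<in> P" if "x \<in> R" for x using P.I_r_closed[OF P(2), of x] that by simp
  have "prime_over p \<subseteq> P"
  proof
    fix x assume "x \<in> prime_over p"
    then obtain a b where x: "x = elt a b" "int p dvd a" "int f dvd b" by (auto simp: prime_over_def)
    obtain a' where a': "a = int p * a'" using x(2) by blast
    have "int p dvd b" using x(3) p(2) by (meson dvd_trans of_nat_dvd_iff)
    then obtain b' where b': "b = int p * b'" by blast
    have "elt 0 b \<otimes> elt 0 b = \<iota> (int p) \<otimes> elt (- (b' * b * nrm)) (disc * b' * b)"
      unfolding elt_mult elt_scale elt_inject by (simp add: b' algebra_simps)
    moreover have "elt (- (b' * b * nrm)) (disc * b' * b) \<in> R" using x(3) by (simp add: elt_in_R)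
    ultimately have "elt 0 b \<otimes> elt 0 b \<in> P" using pP by simp
    moreover have "elt 0 b \<in> R" using x(3) by (simp add: elt_in_R)
    ultimately have "elt 0 b \<in> P" using P.I_prime[of "elt 0 b" "elt 0 b"] by auto
    moreover have "\<iota> a \<in> P" using pP[OF int_in_R[of a']] by (simp add: a' Z_embed_mult)
    moreover have "x = \<iota> a \<oplus> elt 0 b" by (simp add: x(1) elt_int elt_add)
    ultimately show "x \<in> P" using P.a_closed[of "\<iota> a" "elt 0 b"] by simp
  qed
  then show ?thesis
    using A.primes_incomparable[OF prime_over_is_prime[OF p] _ P(1)] prime_over_nonzero[of p] by simp
qed

lemma prime_factor_in_primeideal:
  assumes P: "primeideal P A" and m: "m > 0" "\<iota> (int m) \<in> P"
  shows "\<exists>p. Factorial_Ring.prime p \<and> p dvd m \<and> \<iota> (int p) \<in> P"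
  using m
proof (induction m rule: less_induct)
  case (less m)
  interpret P: primeideal P A by (rule P)
  have "m \<noteq> 1" using less.prems(2) one_in_compl_prime[OF P] by auto
  then obtain p where p: "Factorial_Ring.prime p" "p dvd m" using prime_factor_nat by blast
  then obtain k where k: "m = p * k" by blast
  have "\<iota> (int p) \<otimes> \<iota> (int k) \<in> P" using less.prems(2) by (simp add: k Z_embed_mult)
  then consider "\<iota> (int p) \<in> P" | "\<iota> (int k) \<in> P"
    using P.I_prime[of "\<iota> (int p)" "\<iota> (int k)"] int_in_R by auto
  then show ?case
  proof cases
    case 2
    have "k < m" "k > 0" using k p(1) less.prems(1) prime_gt_1_nat[OF p(1)] by auto
    then show ?thesis using less.IH[of k] 2 k by (meson dvd_mult)
  qed (use p in blast)
qed

lemma conductor_primes_quadratic: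
  "conductor_primes K R = prime_over ` {p. Factorial_Ring.prime p \<and> p dvd f}"
proof (intro equalityI subsetI)
  fix P assume "P \<in> conductor_primes K R"
  then have P: "primeideal P A" "conductor K R \<subseteq> P" by (auto simp: conductor_primes_eq)
  have "\<iota> (int f) \<in> conductor K R"
    unfolding conductor_iff elt_int by (intro exI[of _ 1] exI[of _ 0]) simp
  then have "\<iota> (int f) \<in> P" using P(2) by blast
  then obtain p where "Factorial_Ring.prime p" "p dvd f" "\<iota> (int p) \<in> P"
    using prime_factor_in_primeideal[OF P(1) f_pos] by blast
  then show "P \<in> prime_over ` {p. Factorial_Ring.prime p \<and> p dvd f}"
    using primeideal_containing_prime[of p P] P(1) by blast
next
  fix P assume "P \<in> prime_over ` {p. Factorial_Ring.prime p \<and> p dvd f}"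
  then obtain p where p: "P = prime_over p" "Factorial_Ring.prime p" "p dvd f" by blast
  have "conductor K R \<subseteq> prime_over p"
  proof
    fix x assume "x \<in> conductor K R"
    then obtain a b where "x = elt (int f * a) (int f * b)" using conductor_iff by blast
    moreover have "int p dvd int f" using p(3) by simp
    ultimately show "x \<in> prime_over p" by (simp add: elt_in_prime_over)
  qed
  then show "P \<in> conductor_primes K R"
    using p(1) prime_over_is_prime[OF p(2,3)] prime_over_nonzero[of p] by (simp add: conductor_primes_eq)
qed

end

section \<open>Splitting of primes and the conditions\<close>

text \<open>In a factorization of a principal ideal this provides the cofactor that makes each
  factor invertible.\<close>

lemma (in noetherian_domain) ideal_list_prod_factor:
  assumes "set as \<subseteq> atoms (ideal_monoid R)" "Q \<in> set as"
  shows "\<exists>J. ideal J R \<and> foldr (\<cdot>) as (carrier R) = Q \<cdot> J"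
proof -
  have "ideal (foldr (\<cdot>) as (carrier R)) R \<and>
      (\<forall>Q\<in>set as. \<exists>J. ideal J R \<and> foldr (\<cdot>) as (carrier R) = Q \<cdot> J)"
    using assms(1)
  proof (induction as)
    case Nil
    show ?case using oneideal by simp
  next
    case (Cons a as)
    have a: "ideal a R" using Cons.prems by (simp add: atoms_def)
    have IH: "ideal (foldr (\<cdot>) as (carrier R)) R"
      "\<And>Q. Q \<in> set as \<Longrightarrow> \<exists>J. ideal J R \<and> foldr (\<cdot>) as (carrier R) = Q \<cdot> J"
      using Cons by auto
    have "\<exists>J. ideal J R \<and> a \<cdot> foldr (\<cdot>) as (carrier R) = Q \<cdot> J" if Q: "Q \<in> set (a # as)" for Q
    proof (cases "Q = a")
      case True
      then show ?thesis using IH(1) by blast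
    next
      case False
      then obtain J where J: "ideal J R" "foldr (\<cdot>) as (carrier R) = Q \<cdot> J" using IH(2) Q by auto
      have Qid: "ideal Q R" using Q Cons.prems by (auto simp: atoms_def)
      have "a \<cdot> (Q \<cdot> J) = Q \<cdot> (a \<cdot> J)"
        using ideal_prod_assoc[OF a Qid J(1)] ideal_prod_assoc[OF Qid a J(1)]
          ideal_prod_commute[OF a Qid] by simp
      then show ?thesis using J ideal_prod_is_ideal[OF a J(1)] by auto
    qed
    then show ?case using ideal_prod_is_ideal[OF a IH(1)] by simp
  qed
  then show ?thesis using assms(2) by blast
qed

context one_dim_noetherian_in_quotient_field
begin

text \<open>z^-1 J is contained in (R : Q), and Q z^-1 J = R.\<close>

lemma invertible_idealI:
  assumes Q: "ideal Q A" and z: "z \<in> R" "z \<noteq> \<zero>" and QJ: "Q \<cdot>\<^bsub>A\<^esub> J = PIdl\<^bsub>A\<^esub> z" and J: "ideal J A"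
  shows "invertible_ideal K R Q"
proof -
  let ?Q' = "{x \<in> carrier K. \<forall>y\<in>Q. x \<otimes> y \<in> R}"
  have QR: "Q \<subseteq> R" and JR: "J \<subseteq> R" using ideal_A_subset Q J by auto
  have zK: "z \<in> carrier K" using z(1) R_subset by blast
  have zU: "z \<in> Units K" using z zK field_Units by blast
  have inv_mem: "inv z \<otimes> t \<in> ideal_prod K Q ?Q'" if "t \<in> Q \<cdot>\<^bsub>A\<^esub> J" for t
    using that
  proof induction
    case (prod i j)
    have c: "i \<in> carrier K" "j \<in> carrier K" using prod QR JR R_subset by auto
    have "(inv z \<otimes> j) \<otimes> y \<in> R" if y: "y \<in> Q" for y
    proof -
      have yc: "y \<in> carrier K" using y QR R_subset by auto
      have "y \<otimes> j \<in> PIdl\<^bsub>A\<^esub> z" using ideal_prod.prod[OF y prod(2), of A] QJ by simp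
      then obtain r where r: "r \<in> R" "y \<otimes> j = r \<otimes> z" by (auto simp: cgenideal_def)
      have rc: "r \<in> carrier K" using r(1) R_subset by blast
      have "(inv z \<otimes> j) \<otimes> y = inv z \<otimes> (y \<otimes> j)" using c yc zU by (simp add: m_ac)
      also have "\<dots> = r" unfolding r(2) using rc zU zK by (simp add: m_lcomm[of "inv z" r z])
      finally show ?thesis using r(1) by simp
    qed
    then have "inv z \<otimes> j \<in> ?Q'" using c zU by simp
    then have "i \<otimes> (inv z \<otimes> j) \<in> ideal_prod K Q ?Q'" by (rule ideal_prod.prod[OF prod(1)])
    then show ?case using c zU by (simp add: m_lcomm)
  next
    case (sum s1 s2)
    have "Q \<cdot>\<^bsub>A\<^esub> J \<subseteq> R" using A.ideal_prod_in_carrier[OF Q J] by simp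
    then have c: "s1 \<in> carrier K" "s2 \<in> carrier K" using sum.hyps R_subset by auto
    show ?case using ideal_prod.sum[OF sum.IH] c zU by (simp add: r_distr)
  qed
  have "ideal_prod K Q ?Q' = R"
  proof (intro equalityI subsetI)
    fix s assume "s \<in> ideal_prod K Q ?Q'"
    then show "s \<in> R"
    proof induction
      case (prod i j)
      then have "i \<otimes> j = j \<otimes> i" using QR R_subset by (auto simp: subset_iff m_comm)
      then show ?case using prod by auto
    next
      case (sum s1 s2)
      then show ?case using subringE(7)[OF subring_R] by simp
    qed
  next
    fix u assume u: "u \<in> R"
    then have "u \<otimes> z \<in> Q \<cdot>\<^bsub>A\<^esub> J" unfolding QJ by (auto simp: cgenideal_def)
    then have "inv z \<otimes> (u \<otimes> z) \<in> ideal_prod K Q ?Q'" by (rule inv_mem)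
    moreover have "inv z \<otimes> (u \<otimes> z) = u" using u R_subset zU zK by (simp add: m_lcomm[of "inv z" u z] subset_iff)
    ultimately show "u \<in> ideal_prod K Q ?Q'" by simp
  qed
  then show ?thesis using Q by (simp add: invertible_ideal_def)
qed

end

section \<open>Finiteness at non-split primes\<close>

context quadratic_order
begin

abbreviation O\<^sub>K where "O\<^sub>K \<equiv> K\<lparr>carrier := integral_closure K R\<rparr>"

text \<open>Such an ideal is determined by those of its elements whose coordinates in the basis 1, f
  omega lie between 0 and c - 1.\<close>

lemma finite_ideals_containing_int:
  assumes c: "c > 0"
  shows "finite {Q. ideal Q A \<and> \<iota> c \<in> Q}"
proof -
  define g where "g Q = {(a, b). a \<in> {0..<c} \<and> b \<in> {0..<c} \<and> elt a (int f * b) \<in> Q}" for Q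
  have sub: "Q \<subseteq> Q'" if Q: "ideal Q A" "\<iota> c \<in> Q" "ideal Q' A" "\<iota> c \<in> Q'" "g Q = g Q'" for Q Q'
  proof
    fix x assume x: "x \<in> Q"
    then have "x \<in> R" using ideal_A_subset[OF Q(1)] by blast
    then obtain a b' where ab': "x = elt a b'" "int f dvd b'" by (rule R_elt)
    then obtain b where ab: "x = elt a (int f * b)" by blast
    define u v where "u = elt (a div c) (int f * (b div c))" and "v = elt (a mod c) (int f * (b mod c))"
    have uR: "u \<in> R" by (simp add: u_def elt_in_R)
    have vR: "v \<in> R" by (simp add: v_def elt_in_R)
    have xuv: "x = \<iota> c \<otimes> u \<oplus> v"
    proof -
      have "int f * b = c * (int f * (b div c)) + int f * (b mod c)"
        using mult_div_mod_eq[of c b] by (metis distrib_left mult.left_commute)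
      then show ?thesis unfolding ab u_def v_def elt_scale elt_add elt_inject by simp
    qed
    have cu: "\<iota> c \<otimes> u \<in> I" if "ideal I A" "\<iota> c \<in> I" for I
      using ideal.I_r_closed[OF that, of u] uR by simp
    have "v = \<ominus> (\<iota> c \<otimes> u) \<oplus> x"
      unfolding xuv using uR vR R_subset by (simp add: r_neg1 subset_iff)
    moreover have "\<ominus> (\<iota> c \<otimes> u) \<in> Q"
      using additive_subgroup.a_inv_closed[OF ideal.axioms(1)[OF Q(1)] cu[OF Q(1,2)]]
        minus_A[of "\<iota> c \<otimes> u"] cu[OF Q(1,2)] ideal_A_subset[OF Q(1)] by auto
    ultimately have "v \<in> Q"
      using additive_subgroup.a_closed[OF ideal.axioms(1)[OF Q(1)], of "\<ominus> (\<iota> c \<otimes> u)" x] x by simp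
    then have "(a mod c, b mod c) \<in> g Q" using c by (simp add: g_def v_def)
    then have "v \<in> Q'" unfolding Q(5) by (simp add: g_def v_def)
    then show "x \<in> Q'"
      using additive_subgroup.a_closed[OF ideal.axioms(1)[OF Q(3)] cu[OF Q(3,4)], of v] xuv by simp
  qed
  have "inj_on g {Q. ideal Q A \<and> \<iota> c \<in> Q}"
  proof (rule inj_onI)
    fix Q Q' assume "Q \<in> {Q. ideal Q A \<and> \<iota> c \<in> Q}" "Q' \<in> {Q. ideal Q A \<and> \<iota> c \<in> Q}" "g Q = g Q'"
    then show "Q = Q'" using sub[of Q Q'] sub[of Q' Q] by blast
  qed
  moreover have "finite (g ` {Q. ideal Q A \<and> \<iota> c \<in> Q})"
    by (rule finite_subset[of _ "Pow ({0..<c} \<times> {0..<c})"]) (auto simp: g_def)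
  ultimately show ?thesis by (rule finite_imageD[rotated])
qed

text \<open>
  An element of \<open>Q\<close> not locally divisible by \<open>p\<close> is not divisible by \<open>p\<^sup>e\<^sup>+\<^sup>1\<close> in the maximal order,
  so that, \<open>p\<close> being non-split, the \<open>p\<close>-part of its norm, which lies in \<open>Q\<close>, is bounded.
\<close>

lemma nonsplit_power_in_atom:
  assumes p: "Factorial_Ring.prime p" "p dvd f" and ns: "kronecker_prime disc p \<noteq> 1"
    and Q: "Q \<in> atoms (ideal_monoid A)" "primary_ideal Q A" "ideal_radical A Q = prime_over p"
  shows "\<iota> (int p ^ (2 * multiplicity p f + 2)) \<in> Q"
proof -
  let ?P = "prime_over p"
  define e where "e = multiplicity p f"
  have P: "primeideal ?P A" "?P \<noteq> {\<zero>\<^bsub>A\<^esub>}" using prime_over_is_prime[OF p] prime_over_nonzero by simp_all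
  have Qprim: "ideal Q A" "Q \<subseteq> ?P" "\<And>x. x \<in> ?P \<Longrightarrow> \<exists>n::nat. x [^]\<^bsub>A\<^esub> n \<in> Q"
    using A.primary_at_iff[OF P, of Q] Q(2,3) by auto
  have QR: "Q \<subseteq> R" by (rule ideal_A_subset[OF Qprim(1)])
  have power_mem: "\<iota> (int p ^ k) \<in> Q" if "\<iota> (int p ^ j) \<in> Q" "j \<le> k" for j k
  proof -
    have "int p ^ k = int p ^ (k - j) * int p ^ j" using that(2) by (simp flip: power_add)
    then have "\<iota> (int p ^ k) = \<iota> (int p ^ (k - j)) \<otimes> \<iota> (int p ^ j)" by (simp only: Z_embed_mult)
    then show ?thesis using ideal.I_l_closed[OF Qprim(1) that(1)] int_in_R by simp
  qed
  have p0: "p \<noteq> 0" "\<not> is_unit p" using p(1) by auto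
  obtain f' where f': "f = p ^ e * f'" "\<not> p dvd f'"
  proof -
    have "f \<noteq> 0" using f_pos by simp
    from multiplicity_decompose'[OF this p0(2)] show thesis using that unfolding e_def by blast
  qed
  show ?thesis
  proof (cases "Q \<subseteq> saturation A ?P (PIdl\<^bsub>A\<^esub> (\<iota> (int p)))")
    case True
    have "\<iota> (int p) \<in> ?P" "\<iota> (int p) \<noteq> \<zero>"
      using p0 char_0[of "int p"] by (auto simp: elt_int elt_in_prime_over)
    then have "\<iota> (int p ^ 1) \<in> Q"
      using A.atom_contains_if_locally_divisible[OF P(1) Q(1) Qprim(2) _ _ True] by simp
    then show ?thesis by (rule power_mem) simp
  next
    case False
    then obtain x where x: "x \<in> Q" "x \<notin> saturation A ?P (PIdl\<^bsub>A\<^esub> (\<iota> (int p)))" by blast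
    have "x \<in> R" using x(1) QR by blast
    then obtain a b where ab: "x = elt a b" "int f dvd b" by (rule R_elt)
    \<comment> \<open>f' is the part of f prime to p and lies outside P. If p^(e+1) divided both
      coordinates of x, then f' x would be p times the element f (a' + b' omega) of R, and x would
      be locally divisible by p.\<close>
    have ndvd: "\<not> (int p ^ Suc e dvd a \<and> int p ^ Suc e dvd b)"
    proof
      assume "int p ^ Suc e dvd a \<and> int p ^ Suc e dvd b"
      then obtain a' b' where a': "a = int p ^ Suc e * a'" and b': "b = int p ^ Suc e * b'" by blast
      have "\<iota> (int f') \<otimes> x = elt (int f * a') (int f * b') \<otimes> \<iota> (int p)"
        unfolding ab(1) elt_scale elt_int[of "int p"] elt_mult a' b' f'(1)
        by (simp add: elt_inject mult_ac)
      moreover have "elt (int f * a') (int f * b') \<in> R" by (simp add: elt_in_R)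
      ultimately have "\<iota> (int f') \<otimes> x \<in> PIdl\<^bsub>A\<^esub> (\<iota> (int p))" by (auto simp: cgenideal_def)
      moreover have "\<iota> (int f') \<in> carrier A - ?P"
        using f'(2) int_in_R by (simp add: elt_int elt_in_prime_over)
      ultimately have "x \<in> saturation A ?P (PIdl\<^bsub>A\<^esub> (\<iota> (int p)))"
        using \<open>x \<in> R\<close> by (auto simp: saturation_def)
      then show False using x(2) by blast
    qed
    have nN: "\<not> int p ^ (2 * Suc e) dvd N a b"
      using nonsplit_power_dvd[OF p(1) ns] ndvd by blast
    then have N0: "N a b \<noteq> 0" by auto
    have ip: "\<not> is_unit (int p)" using p0 by simp
    define j where "j = multiplicity (int p) (N a b)"
    obtain m where m: "N a b = int p ^ j * m" "\<not> int p dvd m"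
      using multiplicity_decompose'[OF N0 ip] p0 unfolding j_def by auto
    have "j < 2 * Suc e"
    proof (rule ccontr)
      assume "\<not> ?thesis"
      then have "int p ^ (2 * Suc e) dvd int p ^ j" by (intro le_imp_power_dvd) simp
      then show False using nN m(1) by (metis dvd_mult2)
    qed
    have "elt (a + b * disc) (- b) \<in> R" using ab(2) by (simp add: elt_in_R)
    then have "\<iota> (N a b) \<in> Q"
      using ideal.I_r_closed[OF Qprim(1) x(1), of "elt (a + b * disc) (- b)"] elt_conj[of a b]
      by (simp add: ab(1))
    \<comment> \<open>m is prime to p, lies outside P and can be cancelled. What remains is p^j with
      j < 2 (e + 1), the origin of the exponent in the statement.\<close>
    then have mQ: "\<iota> m \<otimes> \<iota> (int p ^ j) \<in> Q" unfolding m(1) Z_embed_mult by (simp add: m_comm)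
    have mP: "\<iota> m \<in> carrier A - ?P" using m(2) int_in_R by (simp add: elt_int elt_in_prime_over)
    have "\<iota> (int p ^ j) \<in> Q"
      by (rule A.locally_nilpotent_cancel[OF P Qprim(1) _ mP]) (use Qprim(3) int_in_R mQ in auto)
    then show ?thesis by (rule power_mem) (use \<open>j < 2 * Suc e\<close> in \<open>simp add: e_def\<close>)
  qed
qed

theorem cond_C_if_cond_C3:
  assumes "cond_C3 K f"
  shows "cond_C K R"
  unfolding cond_C_def conductor_primes_quadratic
proof (intro ballI)
  fix P assume "P \<in> prime_over ` {p. Factorial_Ring.prime p \<and> p dvd f}"
  then obtain p where p: "P = prime_over p" "Factorial_Ring.prime p" "p dvd f" by blast
  have ns: "kronecker_prime disc p \<noteq> 1" using assms p(2,3) by (simp add: cond_C3_def disc_eq)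
  let ?c = "int p ^ (2 * multiplicity p f + 2)"
  have "{Q \<in> atoms (ideal_monoid A). primary_ideal Q A \<and> ideal_radical A Q = P} \<subseteq>
      {Q. ideal Q A \<and> \<iota> ?c \<in> Q}"
    using nonsplit_power_in_atom[OF p(2,3) ns] A.atom_idealD(1) p(1) by blast
  moreover have "?c > 0" using p(2) by (simp add: prime_gt_0_nat)
  ultimately show "finite {Q \<in> atoms (ideal_monoid A). primary_ideal Q A \<and> ideal_radical A Q = P}"
    using finite_subset finite_ideals_containing_int by blast
qed

lemma cond_C1_if_cond_C:
  assumes "cond_C K R"
  shows "cond_C1 K R"
  unfolding cond_C1_def
proof
  fix P assume "P \<in> conductor_primes K R"
  then have "finite {Q \<in> atoms (ideal_monoid A). primary_ideal Q A \<and> ideal_radical A Q = P}"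
    using assms unfolding cond_C_def by blast
  then show "finite {Q \<in> atoms (ideal_monoid A). invertible_ideal K R Q \<and>
      primary_ideal Q A \<and> ideal_radical A Q = P}"
    by (rule finite_subset[rotated]) blast
qed

text \<open>The prime is the set of elements whose norm is divisible by p; it is closed under
  addition because the trace of x times the conjugate of y is then divisible by p. Any prime M above
  P contains the norms of its elements, and contains x when p divides N(x), since x^2 = Tr(x) x -
  N(x) is a multiple of p.\<close>

lemma nonsplit_prime_above:
  assumes p: "Factorial_Ring.prime p" "p dvd f" and ns: "kronecker_prime disc p \<noteq> 1"
  shows "\<exists>!P'. primeideal P' O\<^sub>K \<and> P' \<inter> R = prime_over p"
proof -
  have ip: "Factorial_Ring.prime (int p)" "int p dvd int f" using p by auto
  define P' where "P' = {elt a b |a b. int p dvd N a b}"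
  have mem: "elt a b \<in> P' \<longleftrightarrow> int p dvd N a b" for a b by (auto simp: P'_def elt_inject)
  have N_mult: "elt a b \<otimes> elt a' b' \<in> P' \<longleftrightarrow> int p dvd N a b * N a' b'" for a b a' b'
    unfolding elt_mult mem quadratic_norm_mult ..
  have prime: "primeideal P' O\<^sub>K"
  proof (rule subring_primeidealI[OF closure_subring])
    show "P' \<subseteq> integral_closure K R" unfolding P'_def using elt_integral by blast
    show "\<zero> \<in> P'" unfolding elt_zero mem by (simp add: quadratic_norm_def)
    show "x \<oplus> y \<in> P'" if xy: "x \<in> P'" "y \<in> P'" for x y
    proof -
      obtain a b a' b' where *: "x = elt a b" "int p dvd N a b" "y = elt a' b'" "int p dvd N a' b'"
        using xy by (auto simp: P'_def)
      \<comment> \<open>\<open>?A\<close> and \<open>?B\<close> are the coordinates of x times the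
        conjugate of y, whose trace is the mixed term in the norm of x + y.\<close>
      let ?A = "a * (a' + b' * disc) - b * (- b') * nrm"
      let ?B = "a * (- b') + (a' + b' * disc) * b + disc * b * (- b')"
      have "N ?A ?B = N a b * N (a' + b' * disc) (- b')" by (rule quadratic_norm_mult)
      then have "int p dvd N ?A ?B" using *(2) by simp
      then have "int p dvd 2 * ?A + ?B * disc" by (rule nonsplit_dvd_trace[OF p(1) ns])
      moreover have "N (a + a') (b + b') = N a b + N a' b' + (2 * ?A + ?B * disc)"
        unfolding quadratic_norm_def by (simp add: power2_eq_square algebra_simps)
      ultimately show ?thesis using *(2,4) unfolding *(1,3) elt_add mem by simp
    qed
    show "\<ominus> x \<in> P'" if "x \<in> P'" for x
      using that by (auto simp: P'_def elt_minus elt_inject quadratic_norm_def)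
    show "r \<otimes> x \<in> P'" if rx: "r \<in> integral_closure K R" "x \<in> P'" for r x
    proof -
      obtain a b where "r = elt a b" using rx(1) closure_iff by blast
      moreover obtain a' b' where "x = elt a' b'" "int p dvd N a' b'" using rx(2) by (auto simp: P'_def)
      ultimately show ?thesis using N_mult by simp
    qed
    show "\<one> \<notin> P'" unfolding elt_one mem using prime_gt_1_nat[OF p(1)] by (simp add: quadratic_norm_def)
    show "x \<in> P' \<or> y \<in> P'"
      if xy: "x \<in> integral_closure K R" "y \<in> integral_closure K R" "x \<otimes> y \<in> P'" for x y
    proof -
      obtain a b a' b' where *: "x = elt a b" "y = elt a' b'" using xy closure_iff by blast
      then have "int p dvd N a b * N a' b'" using xy(3) N_mult by simp
      then show ?thesis using prime_dvd_mult_iff[OF ip(1)] unfolding * mem by blast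
    qed
  qed
  have contr: "P' \<inter> R = prime_over p"
  proof -
    have "elt a b \<in> P' \<inter> R \<longleftrightarrow> elt a b \<in> prime_over p" for a b
    proof (cases "int f dvd b")
      case True
      then have "int p dvd b" using ip(2) dvd_trans by blast
      then have "int p dvd a * b * disc + b\<^sup>2 * nrm" by (simp add: power2_eq_square mult.assoc)
      then have "int p dvd N a b \<longleftrightarrow> int p dvd a\<^sup>2"
        unfolding quadratic_norm_def add.assoc by (rule dvd_add_left_iff)
      then show ?thesis
        using True prime_dvd_power_iff[OF ip(1), of 2 a] by (simp add: mem elt_in_R elt_in_prime_over)
    qed (simp add: elt_in_R elt_in_prime_over)
    moreover have "\<exists>a b. x = elt a b" if "x \<in> P' \<inter> R \<or> x \<in> prime_over p" for x
      using that unfolding P'_def prime_over_def by blast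
    ultimately show ?thesis by blast
  qed
  show ?thesis
  proof (intro ex1I[of _ P'] conjI prime contr; elim conjE)
    fix M assume M: "primeideal M O\<^sub>K" "M \<inter> R = prime_over p"
    interpret M: primeideal M O\<^sub>K by (rule M(1))
    have pM: "\<iota> (int p) \<in> M"
    proof -
      have "\<iota> (int p) \<in> prime_over p" by (simp add: elt_int elt_in_prime_over)
      then show ?thesis using M(2) by blast
    qed
    show "M = P'"
    proof (intro equalityI subsetI)
      fix x assume x: "x \<in> M"
      then have "x \<in> integral_closure K R" using M.Icarr by fastforce
      then obtain a b where ab: "x = elt a b" using closure_iff by blast
      have "x \<otimes> elt (a + b * disc) (- b) \<in> M"
        using M.I_r_closed[OF x, of "elt (a + b * disc) (- b)"] elt_integral by simp
      then have "\<iota> (N a b) \<in> M" unfolding ab elt_conj .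
      then have "elt (N a b) 0 \<in> prime_over p" using M(2) int_in_R[of "N a b"] elt_int by auto
      then show "x \<in> P'" unfolding ab mem by (simp add: elt_in_prime_over)
    next
      fix x assume "x \<in> P'"
      then obtain a b where ab: "x = elt a b" "int p dvd N a b" by (auto simp: P'_def)
      obtain t where t: "2 * a + b * disc = int p * t" using nonsplit_dvd_trace[OF p(1) ns ab(2)] by blast
      obtain u where u: "N a b = int p * u" using ab(2) by blast
      have "x \<otimes> x = elt ((2 * a + b * disc) * a - N a b) ((2 * a + b * disc) * b)"
        unfolding ab(1) elt_mult elt_inject quadratic_norm_def by (simp add: power2_eq_square algebra_simps)
      also have "\<dots> = \<iota> (int p) \<otimes> elt (t * a - u) (t * b)"
        unfolding t u elt_scale elt_inject by (simp add: algebra_simps)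
      also have "\<dots> \<in> M" using M.I_r_closed[OF pM, of "elt (t * a - u) (t * b)"] elt_integral by simp
      finally show "x \<in> M" using M.I_prime[of x x] elt_integral by (simp add: ab(1))
    qed
  qed
qed

section \<open>Reduction modulo the roots and split primes\<close>

text \<open>For \<open>m\<close> dividing \<open>r\<^sup>2 - D r + n\<close>, the kernel of the ring homomorphism \<open>\<omega> \<mapsto> r\<close> to \<open>\<int>/m\<close>.\<close>

definition root_kernel :: "int \<Rightarrow> int \<Rightarrow> 'a set"
  where "root_kernel m r = {elt a b |a b. m dvd a + b * r}"

lemma elt_in_root_kernel: "elt a b \<in> root_kernel m r \<longleftrightarrow> m dvd a + b * r"
  by (auto simp: root_kernel_def elt_inject)

lemma elt_mult_in_root_kernel:
  assumes "m dvd r\<^sup>2 - disc * r + nrm"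
  shows "elt a b \<otimes> elt a' b' \<in> root_kernel m r \<longleftrightarrow> m dvd (a + b * r) * (a' + b' * r)"
proof -
  have "(a * a' - b * b' * nrm) + (a * b' + a' * b + disc * b * b') * r =
      (a + b * r) * (a' + b' * r) - b * b' * (r\<^sup>2 - disc * r + nrm)"
    by (simp add: power2_eq_square algebra_simps)
  moreover have "m dvd b * b' * (r\<^sup>2 - disc * r + nrm)" using assms by simp
  ultimately show ?thesis unfolding elt_mult elt_in_root_kernel by (metis dvd_diff_left_iff)
qed

lemma root_kernel_add:
  assumes "x \<in> root_kernel m r" "y \<in> root_kernel m r"
  shows "x \<oplus> y \<in> root_kernel m r"
proof -
  obtain a b a' b' where *: "x = elt a b" "m dvd a + b * r" "y = elt a' b'" "m dvd a' + b' * r"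
    using assms by (auto simp: root_kernel_def)
  have "m dvd (a + b * r) + (a' + b' * r)" using *(2,4) by (rule dvd_add)
  also have "(a + b * r) + (a' + b' * r) = (a + a') + (b + b') * r" by (simp add: algebra_simps)
  finally show ?thesis unfolding *(1,3) elt_add elt_in_root_kernel .
qed

lemma root_kernel_prime:
  assumes p: "Factorial_Ring.prime p" "p dvd f" and r: "int p dvd r\<^sup>2 - disc * r + nrm"
  shows "primeideal (root_kernel (int p) r) O\<^sub>K" "root_kernel (int p) r \<inter> R = prime_over p"
proof -
  have ip: "Factorial_Ring.prime (int p)" "int p dvd int f" using p by auto
  note mult_iff = elt_mult_in_root_kernel[OF r]
  let ?M = "root_kernel (int p) r"
  show "primeideal ?M O\<^sub>K"
  proof (rule subring_primeidealI[OF closure_subring])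
    show "?M \<subseteq> integral_closure K R" unfolding root_kernel_def using elt_integral by blast
    show "\<zero> \<in> ?M" unfolding elt_zero elt_in_root_kernel by simp
    show "\<ominus> x \<in> ?M" if x: "x \<in> ?M" for x
    proof -
      obtain a b where *: "x = elt a b" "int p dvd a + b * r" using x by (auto simp: root_kernel_def)
      have "- a + - b * r = - (a + b * r)" by simp
      then show ?thesis using *(2) unfolding *(1) elt_minus elt_in_root_kernel by (metis dvd_minus_iff)
    qed
    show "s \<otimes> x \<in> ?M" if sx: "s \<in> integral_closure K R" "x \<in> ?M" for s x
    proof -
      obtain a b where "s = elt a b" using sx(1) closure_iff by blast
      moreover obtain a' b' where "x = elt a' b'" "int p dvd a' + b' * r"
        using sx(2) by (auto simp: root_kernel_def)
      ultimately show ?thesis using mult_iff by simp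
    qed
    show "\<one> \<notin> ?M" unfolding elt_one elt_in_root_kernel using prime_gt_1_nat[OF p(1)] by simp
    show "x \<in> ?M \<or> y \<in> ?M"
      if xy: "x \<in> integral_closure K R" "y \<in> integral_closure K R" "x \<otimes> y \<in> ?M" for x y
    proof -
      obtain a b a' b' where *: "x = elt a b" "y = elt a' b'" using xy closure_iff by blast
      then have "int p dvd (a + b * r) * (a' + b' * r)" using xy(3) mult_iff by simp
      then show ?thesis using prime_dvd_mult_iff[OF ip(1)] unfolding * elt_in_root_kernel by blast
    qed
  qed (rule root_kernel_add)
  have "elt a b \<in> ?M \<inter> R \<longleftrightarrow> elt a b \<in> prime_over p" for a b
  proof (cases "int f dvd b")
    case True
    then have "int p dvd b" using ip(2) dvd_trans by blast
    then have "int p dvd b * r" by simp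
    then have "int p dvd a + b * r \<longleftrightarrow> int p dvd a" by (rule dvd_add_left_iff)
    then show ?thesis using True by (simp add: elt_in_root_kernel elt_in_R elt_in_prime_over)
  qed (simp add: elt_in_R elt_in_prime_over)
  moreover have "\<exists>a b. x = elt a b" if "x \<in> ?M \<inter> R \<or> x \<in> prime_over p" for x
    using that unfolding root_kernel_def prime_over_def by blast
  ultimately show "?M \<inter> R = prime_over p" by blast
qed

lemma conjugate_root: "(disc - r)\<^sup>2 - disc * (disc - r) + nrm = r\<^sup>2 - disc * r + nrm"
  by (simp add: power2_eq_square algebra_simps)

theorem cond_C2_iff_cond_C3: "cond_C2 K R \<longleftrightarrow> cond_C3 K f"
proof
  assume C3: "cond_C3 K f"
  show "cond_C2 K R"
    unfolding cond_C2_def conductor_primes_quadratic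
    using nonsplit_prime_above C3 by (auto simp: cond_C3_def disc_eq)
next
  assume C2: "cond_C2 K R"
  show "cond_C3 K f"
    unfolding cond_C3_def disc_eq
  proof (intro allI impI notI; elim conjE)
    fix p assume p: "Factorial_Ring.prime p" "p dvd f" and split: "kronecker_prime disc p = 1"
    obtain r where r: "int p dvd r\<^sup>2 - disc * r + nrm" "\<not> int p dvd 2 * r - disc"
      using split_root[OF p(1) split] by blast
    have r': "int p dvd (disc - r)\<^sup>2 - disc * (disc - r) + nrm" unfolding conjugate_root by (rule r(1))
    have "\<exists>!P'. primeideal P' O\<^sub>K \<and> P' \<inter> R = prime_over p"
      using C2 p unfolding cond_C2_def conductor_primes_quadratic by blast
    then have "root_kernel (int p) r = root_kernel (int p) (disc - r)"
      using root_kernel_prime[OF p r(1)] root_kernel_prime[OF p r'] by blast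
    \<comment> \<open>omega - r separates the two kernels: omega goes to D - r in the second, so
      membership there would mean that p divides 2 r - D.\<close>
    moreover have "elt (- r) 1 \<in> root_kernel (int p) r" by (simp add: elt_in_root_kernel)
    ultimately have "elt (- r) 1 \<in> root_kernel (int p) (disc - r)" by simp
    then have "int p dvd - (2 * r - disc)" by (simp add: elt_in_root_kernel)
    then show False using r(2) by (simp only: dvd_minus_iff)
  qed
qed

text \<open>An element a + b omega of the prime over p has p dividing both a and b, so each factor
  over p contributes a factor p to the image a + b r. The exponent is capped at L because omega -> r
  is multiplicative only modulo p^L.\<close>

lemma atoms_product_in_root_kernel:
  assumes p: "p dvd f" and r: "int p ^ L dvd r\<^sup>2 - disc * r + nrm"
    and as: "set as \<subseteq> atoms (ideal_monoid A)"
    and y: "y \<in> foldr (\<cdot>\<^bsub>A\<^esub>) as R"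
  shows "y \<in> root_kernel (int p ^ min (length (filter (\<lambda>Q. Q \<subseteq> prime_over p) as)) L) r"
  using as y
proof (induction as arbitrary: y)
  case Nil
  then have "y \<in> R" by simp
  then obtain a b where "y = elt a b" by (rule R_elt)
  then show ?case by (simp add: elt_in_root_kernel)
next
  case (Cons Q as)
  let ?k = "length (filter (\<lambda>Q. Q \<subseteq> prime_over p) as)"
  let ?k' = "length (filter (\<lambda>Q. Q \<subseteq> prime_over p) (Q # as))"
  have Qid: "ideal Q A" using Cons.prems(1) A.atom_idealD(1) by simp
  have "int p ^ min ?k' L dvd int p ^ L" by (intro le_imp_power_dvd) simp
  then have rk: "int p ^ min ?k' L dvd r\<^sup>2 - disc * r + nrm" using r by (rule dvd_trans)
  have "y \<in> Q \<cdot>\<^bsub>A\<^esub> foldr (\<cdot>\<^bsub>A\<^esub>) as R" using Cons.prems(2) by simp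
  then show ?case
  proof induction
    case (prod i j)
    have "i \<in> R" using prod(1) ideal_A_subset[OF Qid] by blast
    then obtain a b where i: "i = elt a b" "int f dvd b" by (rule R_elt)
    have "j \<in> root_kernel (int p ^ min ?k L) r" using Cons.IH Cons.prems(1) prod(2) by simp
    then obtain a' b' where j: "j = elt a' b'" "int p ^ min ?k L dvd a' + b' * r"
      by (auto simp: root_kernel_def)
    have "int p ^ min ?k' L dvd (a + b * r) * (a' + b' * r)"
    proof (cases "Q \<subseteq> prime_over p")
      case True
      then have "int p dvd a" using prod(1) i(1) elt_in_prime_over by blast
      moreover have "int p dvd b" using i(2) p by (meson dvd_trans of_nat_dvd_iff)
      ultimately have "int p dvd a + b * r" by simp
      then have "int p ^ Suc (min ?k L) dvd (a + b * r) * (a' + b' * r)"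
        using j(2) by (simp add: mult_dvd_mono)
      moreover have "int p ^ min ?k' L dvd int p ^ Suc (min ?k L)"
        using True by (intro le_imp_power_dvd) simp
      ultimately show ?thesis by (rule dvd_trans[rotated])
    next
      case False
      then show ?thesis using j(2) by simp
    qed
    then show ?case using elt_mult_in_root_kernel[OF rk] unfolding i(1) j(1) by simp
  next
    case (sum s1 s2)
    then show ?case using root_kernel_add by simp
  qed
qed

text \<open>Each factor contained in the prime over p contributes p^M, and any other an element
  outside that prime; the latter elements make up t.\<close>

lemma power_in_atoms_product:
  assumes p: "Factorial_Ring.prime p" "p dvd f" and as: "set as \<subseteq> atoms (ideal_monoid A)"
    and M: "\<And>Q. \<lbrakk>Q \<in> set as; Q \<subseteq> prime_over p\<rbrakk> \<Longrightarrow> \<iota> (int p ^ M) \<in> Q"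
  shows "\<exists>t\<in>carrier A - prime_over p.
    t \<otimes> \<iota> (int p ^ (M * length (filter (\<lambda>Q. Q \<subseteq> prime_over p) as))) \<in> foldr (\<cdot>\<^bsub>A\<^esub>) as R"
  using as M
proof (induction as)
  case Nil
  show ?case
    using one_in_compl_prime[OF prime_over_is_prime[OF p]] by (intro bexI[of _ \<one>]) (auto intro: subringE(3)[OF subring_R])
next
  case (Cons Q as)
  let ?k = "length (filter (\<lambda>Q. Q \<subseteq> prime_over p) as)"
  obtain t where t: "t \<in> carrier A - prime_over p" "t \<otimes> \<iota> (int p ^ (M * ?k)) \<in> foldr (\<cdot>\<^bsub>A\<^esub>) as R"
    using Cons by auto
  have tK: "t \<in> carrier K" using t(1) R_subset by auto
  show ?case
  proof (cases "Q \<subseteq> prime_over p")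
    case True
    then have "\<iota> (int p ^ M) \<in> Q" using Cons.prems(2) by simp
    then have "\<iota> (int p ^ M) \<otimes> (t \<otimes> \<iota> (int p ^ (M * ?k))) \<in> Q \<cdot>\<^bsub>A\<^esub> foldr (\<cdot>\<^bsub>A\<^esub>) as R"
      using ideal_prod.prod[of _ Q _ "foldr (\<cdot>\<^bsub>A\<^esub>) as R" A] t(2) by simp
    moreover have "\<iota> (int p ^ M) \<otimes> (t \<otimes> \<iota> (int p ^ (M * ?k))) = t \<otimes> \<iota> (int p ^ (M * Suc ?k))"
      using tK by (simp add: power_add Z_embed_mult m_lcomm)
    ultimately show ?thesis using True t(1) by auto
  next
    case False
    then obtain s where s: "s \<in> Q" "s \<notin> prime_over p" by blast
    have "ideal Q A" using Cons.prems(1) A.atom_idealD(1) by simp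
    then have sR: "s \<in> R" using s(1) ideal_A_subset by blast
    have "s \<otimes> (t \<otimes> \<iota> (int p ^ (M * ?k))) \<in> Q \<cdot>\<^bsub>A\<^esub> foldr (\<cdot>\<^bsub>A\<^esub>) as R"
      using ideal_prod.prod[of _ Q _ "foldr (\<cdot>\<^bsub>A\<^esub>) as R" A, OF s(1) t(2)] by simp
    then have "(s \<otimes> t) \<otimes> \<iota> (int p ^ (M * ?k)) \<in> Q \<cdot>\<^bsub>A\<^esub> foldr (\<cdot>\<^bsub>A\<^esub>) as R"
      using sR R_subset tK by (auto simp: m_assoc)
    moreover have "s \<otimes> t \<in> carrier A - prime_over p"
      using compl_prime_mult_closed[OF prime_over_is_prime[OF p], of s t] sR s(2) t(1) by simp
    ultimately show ?thesis using False by auto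
  qed
qed

text \<open>
  If \<open>p\<close> splits, let \<open>r\<close> be a root of \<open>t\<^sup>2 - D t + n\<close> modulo a high power \<open>p\<^sup>L\<close>, so that
  \<open>D - r\<close> is the other one. The element \<open>f (\<omega> - r)\<close> vanishes under \<open>\<omega> \<mapsto> r\<close>, whereas under
  \<open>\<omega> \<mapsto> D - r\<close> its \<open>p\<close>-adic valuation is that of \<open>f\<close>. The latter bounds the number of factors
  over \<open>p\<close>, so by the former these factors cannot all contain a fixed power of \<open>p\<close>.
\<close>

theorem cond_C3_if_cond_C1:
  assumes C1: "cond_C1 K R"
  shows "cond_C3 K f"
  unfolding cond_C3_def disc_eq
proof (intro allI impI notI; elim conjE)
  fix p assume p: "Factorial_Ring.prime p" "p dvd f" and split: "kronecker_prime disc p = 1"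
  let ?P = "prime_over p"
  define \<Q> where "\<Q> = {Q \<in> atoms (ideal_monoid A). invertible_ideal K R Q \<and>
      primary_ideal Q A \<and> ideal_radical A Q = ?P}"
  have ip: "Factorial_Ring.prime (int p)" "int p dvd int f" using p by auto
  have P: "primeideal ?P A" "?P \<noteq> {\<zero>\<^bsub>A\<^esub>}" using prime_over_is_prime[OF p] prime_over_nonzero by simp_all
  have fin: "finite \<Q>"
    using C1 p unfolding cond_C1_def conductor_primes_quadratic \<Q>_def by blast
  have pP: "\<iota> (int p) \<in> ?P" by (simp add: elt_int elt_in_prime_over)
  have "\<exists>m::nat. \<iota> (int p ^ m) \<in> Q" if Q: "Q \<in> \<Q>" for Q
  proof -
    obtain m where "\<iota> (int p) [^]\<^bsub>A\<^esub> (m::nat) \<in> Q"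
      using A.primary_at_iff[OF P, of Q] Q pP by (auto simp: \<Q>_def)
    moreover have "\<iota> (int p) [^]\<^bsub>A\<^esub> m = \<iota> (int p) [^] m" for m :: nat by (induction m) auto
    ultimately show ?thesis unfolding Z_embed_power by auto
  qed
  then obtain \<mu> :: "'a set \<Rightarrow> nat" where \<mu>: "\<And>Q. Q \<in> \<Q> \<Longrightarrow> \<iota> (int p ^ \<mu> Q) \<in> Q" by metis
  \<comment> \<open>The sum is a common exponent for the finite set \<Q>, also when \<Q> is
    empty.\<close>
  define M where "M = (\<Sum>Q\<in>\<Q>. \<mu> Q)"
  have M: "\<iota> (int p ^ M) \<in> Q" if Q: "Q \<in> \<Q>" for Q
  proof -
    have "\<mu> Q \<le> M" unfolding M_def using member_le_sum[OF Q _ fin, of \<mu>] by simp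
    then have "int p ^ M = int p ^ (M - \<mu> Q) * int p ^ \<mu> Q" by (simp flip: power_add)
    then have "\<iota> (int p ^ M) = \<iota> (int p ^ (M - \<mu> Q)) \<otimes> \<iota> (int p ^ \<mu> Q)" by (simp only: Z_embed_mult)
    moreover have "ideal Q A" using Q A.atom_idealD(1) by (auto simp: \<Q>_def)
    ultimately show ?thesis using ideal.I_l_closed[OF _ \<mu>[OF Q], of A "\<iota> (int p ^ (M - \<mu> Q))"] int_in_R by simp
  qed
  have p0: "p \<noteq> 0" "\<not> is_unit p" using p(1) by auto
  define e where "e = multiplicity p f"
  obtain f' where f': "f = p ^ e * f'" "\<not> p dvd f'"
  proof -
    have "f \<noteq> 0" using f_pos by simp
    from multiplicity_decompose'[OF this p0(2)] show thesis using that unfolding e_def by blast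
  qed
  \<comment> \<open>L exceeds e, so that the bound k \<le> e can be read off modulo p^L, and it
    exceeds M e, which is contradicted in the end.\<close>
  define L where "L = Suc (M * e + e)"
  obtain r where r: "int p ^ L dvd r\<^sup>2 - disc * r + nrm" "\<not> int p dvd 2 * r - disc"
    using split_root_mod_power[OF p(1) split] unfolding L_def by blast
  define z where "z = elt (- (int f * r)) (int f)"
  have zR: "z \<in> R" by (simp add: z_def elt_in_R)
  have z0: "z \<noteq> \<zero>" unfolding z_def elt_zero elt_inject using f_pos by simp
  have zid: "ideal (PIdl\<^bsub>A\<^esub> z) A" by (rule A.cgenideal_ideal) (simp add: zR)
  have z_mem: "z \<in> PIdl\<^bsub>A\<^esub> z" using A.cgenideal_self[of z] zR by simp
  then have "PIdl\<^bsub>A\<^esub> z \<noteq> {\<zero>\<^bsub>A\<^esub>}" using z0 by auto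
  then obtain as where as: "set as \<subseteq> atoms (ideal_monoid A)" "foldr (\<cdot>\<^bsub>A\<^esub>) as R = PIdl\<^bsub>A\<^esub> z"
    using A.ideal_is_prod_of_atoms[OF zid] by auto
  define k where "k = length (filter (\<lambda>Q. Q \<subseteq> ?P) as)"
  have k_le: "k \<le> e"
  proof (rule ccontr)
    assume "\<not> k \<le> e"
    then have "Suc e \<le> min k L" by (simp add: L_def)
    have r': "int p ^ L dvd (disc - r)\<^sup>2 - disc * (disc - r) + nrm" unfolding conjugate_root by (rule r(1))
    have "z \<in> foldr (\<cdot>\<^bsub>A\<^esub>) as R" using z_mem as(2) by simp
    then have "z \<in> root_kernel (int p ^ min k L) (disc - r)"
      unfolding k_def by (rule atoms_product_in_root_kernel[OF p(2) r' as(1)])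
    then have "int p ^ min k L dvd - (int f * (2 * r - disc))"
      unfolding z_def elt_in_root_kernel by (simp add: algebra_simps)
    then have "int p ^ min k L dvd int f * (2 * r - disc)" by (simp only: dvd_minus_iff)
    moreover have "int p ^ Suc e dvd int p ^ min k L" using \<open>Suc e \<le> min k L\<close> by (rule le_imp_power_dvd)
    ultimately have "int p ^ Suc e dvd int f * (2 * r - disc)" by (rule dvd_trans[rotated])
    moreover have "coprime (int p ^ Suc e) (2 * r - disc)"
      using prime_imp_coprime[OF ip(1) r(2)] by simp
    ultimately have "int p ^ Suc e dvd int f" using coprime_dvd_mult_left_iff by blast
    then have "int p ^ e * int p dvd int p ^ e * int f'" by (simp add: f'(1) mult.commute)
    then have "int p dvd int f'" using p0 by simp
    then show False using f'(2) by simp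
  qed
  \<comment> \<open>A factor of the principal ideal of z is invertible, so every factor over p is
    one of the finitely many atoms in \<Q>.\<close>
  have M': "\<iota> (int p ^ M) \<in> Q" if Q: "Q \<in> set as" "Q \<subseteq> ?P" for Q
  proof -
    have at: "Q \<in> atoms (ideal_monoid A)" using Q(1) as(1) by blast
    obtain J where J: "ideal J A" "Q \<cdot>\<^bsub>A\<^esub> J = PIdl\<^bsub>A\<^esub> z"
      using A.ideal_list_prod_factor[OF as(1) Q(1)] as(2) by auto
    have "invertible_ideal K R Q"
      by (rule invertible_idealI[OF A.atom_idealD(1)[OF at] zR z0 J(2,1)])
    then have "Q \<in> \<Q>" using at A.atom_is_primary(2)[OF at P(1) Q(2)] by (simp add: \<Q>_def)
    then show ?thesis by (rule M)
  qed
  obtain t where t: "t \<in> carrier A - ?P" "t \<otimes> \<iota> (int p ^ (M * k)) \<in> PIdl\<^bsub>A\<^esub> z"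
    using power_in_atoms_product[OF p as(1) M'] unfolding k_def as(2) by blast
  obtain u where u: "u \<in> R" "t \<otimes> \<iota> (int p ^ (M * k)) = u \<otimes> z"
    using t(2) by (auto simp: cgenideal_def)
  obtain a b where ab: "t = elt a b" "int f dvd b" using R_elt[of t] t(1) by auto
  obtain a' b' where u': "u = elt a' b'" by (rule R_elt[OF u(1)])
  \<comment> \<open>Under omega -> r the element u z vanishes modulo p^L, while t, lying outside P,
    has an image prime to p. So p^L divides p^(M k).\<close>
  have "u \<otimes> z \<in> root_kernel (int p ^ L) r"
    unfolding u' z_def elt_mult_in_root_kernel[OF r(1)] by simp
  moreover have "u \<otimes> z = elt (a * int p ^ (M * k)) (b * int p ^ (M * k))"
    unfolding u(2)[symmetric] ab(1) elt_int elt_mult by (simp add: mult.commute)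
  ultimately have "int p ^ L dvd (a + b * r) * int p ^ (M * k)"
    by (simp add: elt_in_root_kernel algebra_simps)
  moreover have "\<not> int p dvd a + b * r"
  proof -
    have "int p dvd b * r" using ab(2) ip(2) by (meson dvd_mult2 dvd_trans)
    then have "int p dvd a + b * r \<longleftrightarrow> int p dvd a" by (rule dvd_add_left_iff)
    moreover have "\<not> int p dvd a" using t(1) ab by (simp add: elt_in_prime_over)
    ultimately show ?thesis by blast
  qed
  then have "coprime (int p ^ L) (a + b * r)"
    using prime_imp_coprime[OF ip(1), of "a + b * r"] by simp
  ultimately have "int p ^ L dvd int p ^ (M * k)" using coprime_dvd_mult_right_iff by blast
  then have "p ^ L dvd p ^ (M * k)" by (simp only: of_nat_power[symmetric] int_dvd_int_iff)
  then have "L \<le> M * k" using power_dvd_imp_le prime_gt_1_nat[OF p(1)] by blast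
  moreover have "M * k \<le> M * e" using k_le by simp
  ultimately show False by (simp add: L_def)
qed

end

theorem corollary3p8:
  fixes K :: "('a, 'b) ring_scheme" and R :: "'a set"
  assumes "is_quotient_field K R"
    and "noetherian_domain (K\<lparr>carrier := R\<rparr>)"
    and "krull_dim (K\<lparr>carrier := R\<rparr>) = 1"
    and "fin_gen_submodule K R (integral_closure K R)"
  shows "(cond_C K R \<longrightarrow>
            structure_theorem_for_unions (system_of_lengths (ideal_monoid (K\<lparr>carrier := R\<rparr>)))) \<and>
         (cohen_kaplansky_domain (K\<lparr>carrier := R\<rparr>) \<longrightarrow> cond_C K R) \<and>
         (\<forall>f::nat. quadratic_number_field K \<and> order_in K R \<and> f > 0 \<and>
            conductor K R = (\<lambda>x. add_pow K f x) ` integral_closure K R \<longrightarrow>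
            (cond_C K R \<longleftrightarrow> cond_C1 K R) \<and>
            (cond_C K R \<longleftrightarrow> cond_C2 K R) \<and>
            (cond_C K R \<longleftrightarrow> cond_C3 K f))"
proof -
  have setting: "one_dim_noetherian_in_quotient_field K R"
    using assms by (intro one_dim_noetherian_in_quotient_field.intro
        one_dim_noetherian_in_quotient_field_axioms.intro) (auto simp: is_quotient_field_def)
  interpret one_dim_noetherian_in_quotient_field K R by (rule setting)
  have "(cond_C K R \<longleftrightarrow> cond_C1 K R) \<and> (cond_C K R \<longleftrightarrow> cond_C2 K R) \<and> (cond_C K R \<longleftrightarrow> cond_C3 K f)"
    if h: "quadratic_number_field K" "order_in K R" "f > 0"
      "conductor K R = (\<lambda>x. add_pow K f x) ` integral_closure K R" for f :: nat
  proof -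
    obtain w d where root: "quadratic_field_root K w d"
      using quadratic_field_root_exists[OF h(1)] by blast
    interpret quadratic_order K R w d f
      by (intro quadratic_order.intro quadratic_order_axioms.intro setting root h)
    show ?thesis
      using cond_C1_if_cond_C cond_C3_if_cond_C1 cond_C_if_cond_C3 cond_C2_iff_cond_C3 by blast
  qed
  then show ?thesis
    using structure_theorem_if_cond_C cond_C_if_cohen_kaplansky by blast
qed

end
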